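(* Let $M\ge 1$ and $0\le a<M$ be integers. Then \[ D(a,M,q)=d(a,M,q)+T_{a,M}(q), \] where $T_{a,M}(q)$ is a theta function (in the sense described in the context; when $M\equiv 0\pmod 3$ it also depends on the auxiliary parameter $z$, which is an arbitrary nonzero complex number for which all the Appell--Lerch sums below are defined, and $T_{a,M}$ does not depend on $z$ otherwise), and $d(a,M,q)$ is given as follows. Case $M\equiv 0\pmod 3$: - if $a=0$: $d=2\,m\big((-1)^{M+1}q^{M(M-1)/6},q^{M^2/3},z\big)$; - if $a\equiv 0\pmod 3$, $a\neq 0$: $d=(-1)^a q^{-a(a+1)/6}\, m\big((-1)^{M+1}q^{M(M-2a-1)/6},q^{M^2/3},z\big)+(-1)^{a+1}q^{-a(a-1)/6}\, m\big((-1)^{M+1}q^{M(M-2a+1)/6},q^{M^2/3},z\big)$; - if $a\equiv 1\pmod 3$: $d=(-1)^a q^{-a(a-1)/6}\, m\big((-1)^{M+1}q^{M(M-2a+1)/6},q^{M^2/3},z\big)$. Case $M\equiv 1\pmod 3$: - if $a=0$ and $M=1$: $d=0$; - if $a=0$ and $M\neq 1$: $d=2+2(-1)^{M+1}q^{M(M-1)/6}\, g\big((-1)^{M+1}q^{M(M-1)/6},q^{M^2}\big)$; - if $a\equiv 0\pmod 3$, $a\ne 0$, $M\neq 2a+1$: $d=(-1)^a q^{-a(a+1)/6}+(-1)^{M+a+1}q^{(M(M-2a-1)-a(a+1))/6}\, g\big((-1)^{M+1}q^{M(M-2a-1)/6},q^{M^2}\big)+(-1)^{M+a+1}q^{(M(M+2a-1)-a(a-1))/6}\,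 g\big((-1)^{M+1}q^{M(M+2a-1)/6},q^{M^2}\big)$; - if $a\equiv 0\pmod 3$, $a\neq 0$, $M=2a+1$: $d=(-1)^a q^{a(7a+5)/6}\, g\big(q^{2aM/3},q^{M^2}\big)$; - if $a\equiv 2\pmod 3$: $d=(-1)^{M+a+1}q^{(M(M+2a+1)-a(a+1))/6}\, g\big((-1)^{M+1}q^{M(M+2a+1)/6},q^{M^2}\big)+(-1)^{a+1}q^{(2M^2-a(a-1))/6}\, g\big((-1)^{M+1}q^{M(3M+2a-1)/6},q^{M^2}\big)$. Case $M\equiv 2\pmod 3$: - if $a=0$: $d=2(-1)^M q^{M(M+1)/6}\, g\big((-1)^{M+1}q^{M(M+1)/6},q^{M^2}\big)$; - if $a\equiv 0\pmod 3$, $a\neq 0$, $M\neq 2a-1$: $d=(-1)^{a+1}q^{-a(a-1)/6}+(-1)^{M+a}q^{(M(M-2a+1)-a(a-1))/6}\, g\big((-1)^{M+1}q^{M(M-2a+1)/6},q^{M^2}\big)+(-1)^{M+a}q^{(M(M+2a+1)-a(a+1))/6}\, g\big((-1)^{M+1}q^{M(M+2a+1)/6},q^{M^2}\big)$; - if $a\equiv 0\pmod 3$ and $M=2a-1$: $d=(-1)^{a+1}q^{a(7a-5)/6}\, g\big(q^{2aM/3},q^{M^2}\big)$; - if $a\equiv 1\pmod 3$: $d=(-1)^{M+a}q^{(M(M+2a-1)-a(a-1))/6}\, g\big((-1)^{M+1}q^{M(M+2a-1)/6},q^{M^2}\big)+(-1)^a q^{(2M^2-a(a+1))/6}\, g\big((-1)^{M+1}q^{M(3M-2a-1)/6},q^{M^2}\big)$.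 In the remaining cases ($a\equiv 2\pmod 3$ with $M\equiv 0$; $a\equiv 1\pmod 3$ with $M\equiv 1$; $a\equiv 2\pmod 3$ with $M\equiv 2\pmod 3$; all with $0<a<M$), $d(a,M,q):=d(M-a,M,q)$, consistent with $D(a,M,q)=D(M-a,M,q)$.
   Context: Let $q\in\mathbb{C}$ with $0<|q|<1$. Write $(x;q)_n=\prod_{i=0}^{n-1}(1-xq^i)$, $(x;q)_\infty=\prod_{i\ge0}(1-xq^i)$, and $j(x;q)=(x;q)_\infty(q/x;q)_\infty(q;q)_\infty=\sum_{n\in\mathbb{Z}}(-1)^nq^{\binom n2}x^n$. For nonzero $x,z$ with neither $z$ nor $xz$ an integral power of $q$, the Appell--Lerch sum is \[ m(x,q,z)=\frac{1}{j(z;q)}\sum_{r\in\mathbb{Z}}\frac{(-1)^rq^{\binom r2}z^r}{1-q^{r-1}xz}, \] and this is used with $q$ replaced by $q^{M^2/3}$ (a power of $q$ when $3\mid M$). The universal mock theta function is \[ g(x,q)=x^{-1}\Big(-1+\sum_{n\ge0}\frac{q^{n^2}}{(x;q)_{n+1}(q/x;q)_n}\Big). \] A partition of $n$ is a weakly decreasing sequence of positive integers summing to $n$; $p(n)$ is the number of partitions of $n$. The rank of a partition is its largest part minus its number of parts; the empty partition of $0$ is assigned rank $0$. $N(a,M;n)$ is the number of partitions of $n$ with rank congruent to $a$ modulo $M$, and \[ D(a,M,q)=\sum_{n\ge0}\Big(N(a,M;n)-\frac{p(n)}{M}\Big)q^n. \] "Theta function" here means a finite sum of terms of the form $c\,q^{e}\prod_i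 j(x_i;q^{k_i})^{\pm1}$ with constants $c$ (depending on $M$-th roots of unity and, when $3\mid M$, on $z$), rational exponents $e$, positive integers $k_i$, and $x_i$ of the form (constant)$\cdot q^{s}$ (possibly also involving $z$). *)

theory Defs
  imports "HOL-Analysis.Analysis" "HOL-Number_Theory.Cong"
begin

section \<open>Partitions, ranks and rank deviations\<close>

definition partitions_of :: "nat \<Rightarrow> nat list set" where
  "partitions_of n = {xs. sorted_wrt (\<ge>) xs \<and> (\<forall>x\<in>set xs. 0 < x) \<and> sum_list xs = n}"

definition partition_rank :: "nat list \<Rightarrow> int" where
  "partition_rank xs = (if xs = [] then 0 else int (Max (set xs)) - int (length xs))"

definition num_partitions :: "nat \<Rightarrow> nat" where
  "num_partitions n = card (partitions_of n)"

definition rank_count :: "int \<Rightarrow> int \<Rightarrow> nat \<Rightarrow> nat" where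
  "rank_count a M n = card {xs \<in> partitions_of n. [partition_rank xs = a] (mod M)}"

definition rank_deviation :: "int \<Rightarrow> int \<Rightarrow> complex \<Rightarrow> complex" where
  "rank_deviation a M q =
     (\<Sum>n. (of_nat (rank_count a M n) - of_nat (num_partitions n) / of_int M) * q ^ n)"

section \<open>Theta functions, Appell--Lerch sums and the universal mock theta function\<close>

definition qpoch :: "complex \<Rightarrow> complex \<Rightarrow> nat \<Rightarrow> complex" where
  "qpoch x q n = (\<Prod>i<n. 1 - x * q ^ i)"

definition qpoch_inf :: "complex \<Rightarrow> complex \<Rightarrow> complex" where
  "qpoch_inf x q = (\<Prod>i. 1 - x * q ^ i)"

definition jtheta :: "complex \<Rightarrow> complex \<Rightarrow> complex" where
  "jtheta x q = qpoch_inf x q * qpoch_inf (q / x) q * qpoch_inf q q"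

definition appell_defined :: "complex \<Rightarrow> complex \<Rightarrow> complex \<Rightarrow> bool" where
  "appell_defined x q z \<longleftrightarrow>
     x \<noteq> 0 \<and> z \<noteq> 0 \<and> (\<forall>k::int. z \<noteq> q powi k) \<and> (\<forall>k::int. x * z \<noteq> q powi k)"

definition appell_m :: "complex \<Rightarrow> complex \<Rightarrow> complex \<Rightarrow> complex" where
  "appell_m x q z =
     1 / jtheta z q *
     (\<Sum>\<^sub>\<infinity>r::int. (-1) powi r * q powi (r * (r - 1) div 2) * z powi r
                  / (1 - q powi (r - 1) * x * z))"

definition mock_g :: "complex \<Rightarrow> complex \<Rightarrow> complex" where
  "mock_g x q =
     inverse x * (- 1 + (\<Sum>n. q ^ (n ^ 2) / (qpoch x q (n + 1) * qpoch (q / x) q n)))"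

section \<open>The mock part\<close>

text \<open>
  In every case in which they are used below, the quotients by 3 and by 6 in the exponents
  are exact, so \<open>div\<close> is genuine division and only integer powers of \<open>q\<close> occur.
\<close>

definition appell_x :: "int \<Rightarrow> complex \<Rightarrow> int \<Rightarrow> complex" where
  "appell_x M q n = (-1) powi (M + 1) * q powi (M * n div 6)"

abbreviation m_at :: "int \<Rightarrow> complex \<Rightarrow> complex \<Rightarrow> int \<Rightarrow> complex" where
  "m_at M q z n \<equiv> appell_m (appell_x M q n) (q powi (M\<^sup>2 div 3)) z"

abbreviation g_at :: "int \<Rightarrow> complex \<Rightarrow> int \<Rightarrow> complex" where
  "g_at M q n \<equiv> mock_g (appell_x M q n) (q powi M\<^sup>2)"

definition mock_part0 :: "int \<Rightarrow> int \<Rightarrow> complex \<Rightarrow> complex \<Rightarrow> complex" where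
  "mock_part0 a M q z =
    (if a = 0 then 2 * m_at M q z (M - 1)
     else if a mod 3 = 0 then
         (-1) powi a * q powi (- (a * (a + 1)) div 6) * m_at M q z (M - 2 * a - 1)
       + (-1) powi (a + 1) * q powi (- (a * (a - 1)) div 6) * m_at M q z (M - 2 * a + 1)
     else (-1) powi a * q powi (- (a * (a - 1)) div 6) * m_at M q z (M - 2 * a + 1))"

definition mock_part1 :: "int \<Rightarrow> int \<Rightarrow> complex \<Rightarrow> complex" where
  "mock_part1 a M q =
    (if a = 0 \<and> M = 1 then 0
     else if a = 0 then
         2 + 2 * (-1) powi (M + 1) * q powi (M * (M - 1) div 6) * g_at M q (M - 1)
     else if a mod 3 = 0 \<and> M \<noteq> 2 * a + 1 then
         (-1) powi a * q powi (- (a * (a + 1)) div 6)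
       + (-1) powi (M + a + 1) * q powi ((M * (M - 2 * a - 1) - a * (a + 1)) div 6)
           * g_at M q (M - 2 * a - 1)
       + (-1) powi (M + a + 1) * q powi ((M * (M + 2 * a - 1) - a * (a - 1)) div 6)
           * g_at M q (M + 2 * a - 1)
     else if a mod 3 = 0 then
         (-1) powi a * q powi (a * (7 * a + 5) div 6)
           * mock_g (q powi (2 * a * M div 3)) (q powi M\<^sup>2)
     else
         (-1) powi (M + a + 1) * q powi ((M * (M + 2 * a + 1) - a * (a + 1)) div 6)
           * g_at M q (M + 2 * a + 1)
       + (-1) powi (a + 1) * q powi ((2 * M\<^sup>2 - a * (a - 1)) div 6)
           * g_at M q (3 * M + 2 * a - 1))"

definition mock_part2 :: "int \<Rightarrow> int \<Rightarrow> complex \<Rightarrow> complex" where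
  "mock_part2 a M q =
    (if a = 0 then
         2 * (-1) powi M * q powi (M * (M + 1) div 6) * g_at M q (M + 1)
     else if a mod 3 = 0 \<and> M \<noteq> 2 * a - 1 then
         (-1) powi (a + 1) * q powi (- (a * (a - 1)) div 6)
       + (-1) powi (M + a) * q powi ((M * (M - 2 * a + 1) - a * (a - 1)) div 6)
           * g_at M q (M - 2 * a + 1)
       + (-1) powi (M + a) * q powi ((M * (M + 2 * a + 1) - a * (a + 1)) div 6)
           * g_at M q (M + 2 * a + 1)
     else if a mod 3 = 0 then
         (-1) powi (a + 1) * q powi (a * (7 * a - 5) div 6)
           * mock_g (q powi (2 * a * M div 3)) (q powi M\<^sup>2)
     else
         (-1) powi (M + a) * q powi ((M * (M + 2 * a - 1) - a * (a - 1)) div 6)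
           * g_at M q (M + 2 * a - 1)
       + (-1) powi a * q powi ((2 * M\<^sup>2 - a * (a + 1)) div 6)
           * g_at M q (3 * M - 2 * a - 1))"

text \<open>
  The residue classes of \<open>a\<close> modulo 3 not covered by an explicit formula are
  reduced by \<open>a \<mapsto> M - a\<close>, which leads to a covered class.
\<close>

definition reduced_residue :: "int \<Rightarrow> int \<Rightarrow> int" where
  "reduced_residue a M =
     (if (M mod 3 = 0 \<and> a mod 3 = 2) \<or> (M mod 3 = 1 \<and> a mod 3 = 1) \<or> (M mod 3 = 2 \<and> a mod 3 = 2)
      then M - a else a)"

definition mock_part :: "int \<Rightarrow> int \<Rightarrow> complex \<Rightarrow> complex \<Rightarrow> complex" where
  "mock_part a M q z =
    (let b = reduced_residue a M in
     if M mod 3 = 0 then mock_part0 b M q z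
     else if M mod 3 = 1 then mock_part1 b M q
     else mock_part2 b M q)"

text \<open>
  The values \<open>n\<close> for which \<open>m_at M q z n\<close> occurs in \<open>mock_part a M q z\<close>,
  when 3 divides \<open>M\<close>.
\<close>

definition appell_indices :: "int \<Rightarrow> int \<Rightarrow> int set" where
  "appell_indices a M =
    (let b = reduced_residue a M in
     if b = 0 then {M - 1}
     else if b mod 3 = 0 then {M - 2 * b - 1, M - 2 * b + 1}
     else {M - 2 * b + 1})"

definition admissible :: "int \<Rightarrow> int \<Rightarrow> (complex \<times> complex) set" where
  "admissible a M =
    {(q, z). 0 < norm q \<and> norm q < 1 \<and>
       (3 dvd M \<longrightarrow>
          (\<forall>n\<in>appell_indices a M. appell_defined (appell_x M q n) (q powi (M\<^sup>2 div 3)) z))}"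

section \<open>Finite sums of theta quotients\<close>

text \<open>
  A term is \<open>c z\<^sup>t q\<^sup>e \<Prod>\<^sub>i j(x\<^sub>i; q ^ k\<^sub>i)\<^sup>\<plusminus>\<^sup>1\<close> with
  \<open>x\<^sub>i = \<kappa>\<^sub>i z ^ t\<^sub>i q ^ s\<^sub>i\<close>. The data \<open>c\<close>, \<open>t\<close>, \<open>e\<close>,
  \<open>\<kappa>\<^sub>i\<close>, \<open>t\<^sub>i\<close>, \<open>s\<^sub>i\<close>, \<open>k\<^sub>i\<close> depend neither on \<open>q\<close> nor on
  \<open>z\<close>. Since sums of terms are allowed, a coefficient can be any Laurent polynomial in \<open>z\<close>.
  Rational powers of \<open>q\<close> are taken with the principal logarithm of \<open>q\<close>,
  the same one in all factors.
\<close>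

datatype theta_factor = ThetaFactor
  (factor_const: complex) (factor_zexp: int) (factor_qexp: rat) (factor_base: nat)
  (factor_inverted: bool)

datatype theta_term = ThetaTerm
  (term_coeff: complex) (term_zexp: int) (term_qexp: rat) (term_factors: "theta_factor list")

definition factor_j :: "theta_factor \<Rightarrow> complex \<Rightarrow> complex \<Rightarrow> complex" where
  "factor_j f q z =
     jtheta (factor_const f * z powi factor_zexp f * q powr of_rat (factor_qexp f))
            (q ^ factor_base f)"

definition factor_eval :: "theta_factor \<Rightarrow> complex \<Rightarrow> complex \<Rightarrow> complex" where
  "factor_eval f q z =
     (if factor_inverted f then inverse (factor_j f q z) else factor_j f q z)"

definition term_eval :: "theta_term \<Rightarrow> complex \<Rightarrow> complex \<Rightarrow> complex" where
  "term_eval t q z =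
     term_coeff t * z powi term_zexp t * q powr of_rat (term_qexp t) *
     (\<Prod>f\<leftarrow>term_factors t. factor_eval f q z)"

text \<open>The cyclotomic field generated over the rationals by the \<open>M\<close>-th roots of unity.\<close>

definition cyclotomic :: "int \<Rightarrow> complex set" where
  "cyclotomic M =
     {c. \<exists>r :: nat \<Rightarrow> rat. c = (\<Sum>k<nat M. of_rat (r k) * cis (2 * pi * real k / real_of_int M))}"

definition wf_theta_term :: "int \<Rightarrow> theta_term \<Rightarrow> bool" where
  "wf_theta_term M t \<longleftrightarrow>
     term_coeff t \<in> cyclotomic M \<and>
     (\<forall>f\<in>set (term_factors t). factor_const f \<noteq> 0 \<and> 0 < factor_base f) \<and>
     (\<not> 3 dvd M \<longrightarrow> term_zexp t = 0 \<and> (\<forall>f\<in>set (term_factors t). factor_zexp f = 0))"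

text \<open>
  One finite family of terms has to represent \<open>T\<close> on all of the domain \<open>\<Omega>\<close>
  of pairs \<open>(q, z)\<close>, and no denominator may vanish anywhere on \<open>\<Omega>\<close>.
\<close>

definition is_theta_function ::
  "int \<Rightarrow> (complex \<times> complex) set \<Rightarrow> (complex \<Rightarrow> complex \<Rightarrow> complex) \<Rightarrow> bool" where
  "is_theta_function M \<Omega> T \<longleftrightarrow>
     (\<exists>ts. (\<forall>t\<in>set ts. wf_theta_term M t) \<and>
        (\<forall>(q, z)\<in>\<Omega>.
           (\<forall>t\<in>set ts. \<forall>f\<in>set (term_factors t). factor_inverted f \<longrightarrow> factor_j f q z \<noteq> 0) \<and>
           T q z = (\<Sum>t\<leftarrow>ts. term_eval t q z)))"

end

(*
  Extracting the ranks congruent to a modulo M with the M-th roots of unity w expresses D(a,M,q)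
  through the values (1 - w) S(w) of the generating function of the rank, where
  S(x) = 1/(q;q) * sum_r (-1)^r q^(3r(r+1)/2) / (1 - x q^r) = 1 + x g(x,q).
  For n > 0, S(x) and the sum over 0 <= N < 3n of the functions
  s_N (-1)^N q^(-N(N+1)/6) x^N m(y_N x^(3n), q^(3n^2), i), with s_N = 1, 0, -1 for N = 0, 1, 2 mod 3
  and y_N = (-1)^(n+1) q^(n(3n-1)/2 - nN), satisfy the same inhomogeneous functional equation under
  x -> qx. Their difference is quasi-periodic, hence a theta function of x by its partial fraction
  expansion. When M divides 3n, averaging over the roots of unity retains the residues N modulo 3n
  congruent to a or a - 1 modulo M. If 3 divides M, take n = M/3: each class consists of a single N,
  and m depends on z only up to a theta function. Otherwise take n = M: each class consists of three
  residues N, and the same expansion of S, read backwards with base q^(M^2) and n = 1, recombines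
  them to g.
*)

theory Submission
  imports Defs "HOL-Complex_Analysis.Complex_Analysis"
begin

section \<open>Infinite products and theta functions\<close>

text \<open>The notion of theta function shapes the argument: one list of terms must serve the whole
  domain, no inverted factor may vanish anywhere on it, and leading coefficients are cyclotomic. So
  each denominator has to be some j(c q^s; q^k) that is nonzero for all q at once; for |c| = 1 this
  holds as soon as c is not 1 or s is no multiple of k. This dictates the constants: the parameter
  i, because i times a sign is never a power of q; the root b with b^(12n) = -1, which is no 6n-th
  root of unity and has b^3 different from 1; poles whose unit parts are 6n-th roots of -1.
  Constants such as i in the residues are absorbed as quotients j(qc; q) / j(c; q). The factor -q
  x^3 of the functional equation is not constant. Multiplication by j(x/b)^3 turns it into q b^3,
  and b keeps this from being a power of q, where monomials would destroy uniqueness. If M = 2a + 1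
  or M = 2a - 1, one argument of g would be 1, a pole. The three residues concerned then combine to
  m(Q, q^(3M^2), i) - m(Q, q^(3M^2), -i) with Q = q^(M^2), which is itself a theta function.\<close>

locale nome =
  fixes q :: complex
  assumes q_nz: "q \<noteq> 0" and q_lt1: "norm q < 1"
begin

definition J :: complex where "J = qpoch_inf q q"

lemma norm_q_pos: "0 < norm q"
  using q_nz by simp

lemma power_q_tendsto_0: "(\<lambda>n. q ^ n) \<longlonglongrightarrow> 0"
  using q_lt1 by (rule LIMSEQ_power_zero)

lemma power_q_neq_1: "0 < n \<Longrightarrow> q ^ n \<noteq> 1"
  by (metis norm_one norm_power norm_q_pos power_less_one_iff q_lt1 less_irrefl norm_ge_zero)

lemma norm_powi_less_1: "0 < k \<Longrightarrow> norm (q powi k) < 1"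
  using q_lt1 norm_q_pos
  by (metis norm_power norm_power_int power_int_def nat_0_less_mult_iff norm_ge_zero
      order_less_imp_le power_less_one_iff zero_less_nat_eq)

lemma powi_eq_1_iff [simp]: "q powi k = 1 \<longleftrightarrow> k = 0"
proof
  assume *: "q powi k = 1"
  show "k = 0"
  proof (rule ccontr)
    assume "k \<noteq> 0"
    then consider "0 < k" | "0 < - k" by linarith
    then show False
    proof cases
      case 1 then show False using norm_powi_less_1[OF 1] * by simp
    next
      case 2 then show False using norm_powi_less_1[OF 2] * by (simp add: power_int_minus)
    qed
  qed
qed simp

lemma powi_eq_iff: "q powi k = q powi l \<longleftrightarrow> k = l"
proof
  assume "q powi k = q powi l"
  hence "q powi (k - l) = 1" using q_nz by (simp add: power_int_diff)
  thus "k = l" by simp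
qed simp

lemma nome_power: "0 < k \<Longrightarrow> nome (q ^ k)"
  using q_nz q_lt1 by unfold_locales (auto simp: norm_power power_less_one_iff)

lemma summable_norm_qpoch: "summable (\<lambda>i. norm (- x * q ^ i))"
  using q_lt1 by (simp add: norm_mult norm_power summable_geometric summable_mult)

lemma convergent_prod_qpoch: "convergent_prod (\<lambda>i. 1 - x * q ^ i)"
proof -
  have "abs_convergent_prod (\<lambda>i. 1 + - x * q ^ i)"
    using summable_norm_qpoch[of x] unfolding abs_convergent_prod_conv_summable by simp
  from abs_convergent_prod_imp_convergent_prod[OF this] show ?thesis by simp
qed

lemma qpoch_tendsto: "(\<lambda>n. qpoch x q n) \<longlonglongrightarrow> qpoch_inf x q"
  using convergent_prod_LIMSEQ[OF convergent_prod_qpoch[of x]]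
  unfolding qpoch_def qpoch_inf_def LIMSEQ_lessThan_iff_atMost[symmetric] .

lemma qpoch_0 [simp]: "qpoch x q 0 = 1"
  by (simp add: qpoch_def)

lemma qpoch_Suc: "qpoch x q (Suc n) = qpoch x q n * (1 - x * q ^ n)"
  by (simp add: qpoch_def)

lemma qpoch_Suc': "qpoch x q (Suc n) = (1 - x) * qpoch (q * x) q n"
  unfolding qpoch_def by (subst prod.lessThan_Suc_shift) (simp add: mult_ac)

lemma qpoch_inf_Suc: "qpoch_inf x q = (1 - x) * qpoch_inf (q * x) q"
proof (rule LIMSEQ_unique)
  show "(\<lambda>n. qpoch x q (Suc n)) \<longlonglongrightarrow> qpoch_inf x q"
    using qpoch_tendsto by (rule LIMSEQ_Suc)
  show "(\<lambda>n. qpoch x q (Suc n)) \<longlonglongrightarrow> (1 - x) * qpoch_inf (q * x) q"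
    unfolding qpoch_Suc' by (intro tendsto_intros qpoch_tendsto)
qed

text \<open>Convergence of a product demands that its tails tend to a nonzero limit, so the value
  can vanish only through one of the factors.\<close>

lemma qpoch_inf_eq_0_iff: "qpoch_inf x q = 0 \<longleftrightarrow> (\<exists>i::nat. x * q ^ i = 1)"
proof
  assume "qpoch_inf x q = 0"
  thus "\<exists>i. x * q ^ i = 1"
    using prodinf_nonzero[OF convergent_prod_qpoch[of x]] unfolding qpoch_inf_def by force
next
  assume "\<exists>i. x * q ^ i = 1"
  then obtain i where i: "x * q ^ i = 1" by blast
  have "\<forall>\<^sub>F n in sequentially. qpoch x q n = 0"
    using eventually_gt_at_top[of i]
    by eventually_elim (use i in \<open>auto simp: qpoch_def prod_zero_iff\<close>)
  hence "(\<lambda>n. qpoch x q n) \<longlonglongrightarrow> 0" by (rule tendsto_eventually)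
  thus "qpoch_inf x q = 0" using qpoch_tendsto LIMSEQ_unique by blast
qed

lemma qpoch_inf_q_nz: "qpoch_inf q q \<noteq> 0"
  unfolding qpoch_inf_eq_0_iff using power_q_neq_1[of "Suc _"] by auto

text \<open>The partial products converge uniformly on unit discs: the n-th factor differs from 1 by
  at most (|x| + 1) |q|^n.\<close>

lemma qpoch_inf_holomorphic: "(\<lambda>x. qpoch_inf x q) holomorphic_on UNIV"
proof (rule holomorphic_uniform_sequence)
  fix x :: complex
  have "uniformly_convergent_on (cball x 1) (\<lambda>N y. \<Prod>n<N. 1 - y * q ^ n)"
  proof (rule uniformly_convergent_on_prod')
    show "uniformly_convergent_on (cball x 1) (\<lambda>N y. \<Sum>n<N. norm (1 - y * q ^ n - 1))"
    proof (rule Weierstrass_m_test'_ev)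
      show "summable (\<lambda>n. (norm x + 1) * norm q ^ n)"
        using q_lt1 by (intro summable_mult summable_geometric) auto
      have "norm (norm (1 - y * q ^ n - 1)) \<le> (norm x + 1) * norm q ^ n"
        if "y \<in> cball x 1" for y n
      proof -
        have "norm y \<le> norm x + 1"
          using that norm_triangle_ineq2[of y x] by (simp add: dist_norm norm_minus_commute)
        thus ?thesis by (auto simp: norm_mult norm_power intro!: mult_right_mono)
      qed
      thus "\<forall>\<^sub>F n in sequentially. \<forall>y\<in>cball x 1.
              norm (norm (1 - y * q ^ n - 1)) \<le> (norm x + 1) * norm q ^ n"
        by simp
    qed
  qed (auto intro!: continuous_intros)
  then obtain l where l: "uniform_limit (cball x 1) (\<lambda>N y. \<Prod>n<N. 1 - y * q ^ n) l sequentially"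
    unfolding uniformly_convergent_on_def by blast
  have "l y = qpoch_inf y q" if "y \<in> cball x 1" for y
    using tendsto_uniform_limitI[OF l that] qpoch_tendsto[of y] LIMSEQ_unique
    unfolding qpoch_def by blast
  hence "uniform_limit (cball x 1) (\<lambda>N y. \<Prod>n<N. 1 - y * q ^ n) (\<lambda>y. qpoch_inf y q) sequentially"
    by (intro uniform_limit_cong'[THEN iffD1, OF _ _ l]) auto
  thus "\<exists>d>0. cball x d \<subseteq> UNIV \<and>
      uniform_limit (cball x d) (\<lambda>N y. \<Prod>n<N. 1 - y * q ^ n) (\<lambda>y. qpoch_inf y q) sequentially"
    by (intro exI[of _ 1]) auto
qed (auto intro!: holomorphic_intros)

lemma qpoch_inf_isCont: "isCont (\<lambda>x. qpoch_inf x q) x"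
  using qpoch_inf_holomorphic holomorphic_on_imp_continuous_on continuous_on_eq_continuous_at
    open_UNIV by blast

lemma qpoch_inf_holomorphic' [holomorphic_intros]:
  "f holomorphic_on S \<Longrightarrow> (\<lambda>x. qpoch_inf (f x) q) holomorphic_on S"
  using holomorphic_on_compose_gen[OF _ qpoch_inf_holomorphic] by (auto simp: o_def)

lemma jtheta_holomorphic [holomorphic_intros]:
  "f holomorphic_on S \<Longrightarrow> (\<And>x. x \<in> S \<Longrightarrow> f x \<noteq> 0) \<Longrightarrow> (\<lambda>x. jtheta (f x) q) holomorphic_on S"
  unfolding jtheta_def by (intro holomorphic_intros) auto

lemma jtheta_isCont: "x \<noteq> 0 \<Longrightarrow> isCont (\<lambda>x. jtheta x q) x"
proof -
  have "(\<lambda>x. jtheta x q) holomorphic_on -{0}" by (intro holomorphic_intros) auto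
  thus "x \<noteq> 0 \<Longrightarrow> isCont (\<lambda>x. jtheta x q) x"
    using holomorphic_on_imp_continuous_on continuous_on_eq_continuous_at[of "-{0}"] by blast
qed

lemma jtheta_tendsto [tendsto_intros]:
  "(f \<longlongrightarrow> l) F \<Longrightarrow> l \<noteq> 0 \<Longrightarrow> ((\<lambda>x. jtheta (f x) q) \<longlongrightarrow> jtheta l q) F"
  using isCont_tendsto_compose[OF jtheta_isCont] by blast

text \<open>The product in x supplies the zeros at nonpositive powers of q, the product in q/x those
  at positive powers, and the third product never vanishes.\<close>

lemma jtheta_eq_0_iff:
  assumes "x \<noteq> 0"
  shows "jtheta x q = 0 \<longleftrightarrow> (\<exists>k::int. x = q powi k)"
proof
  assume "jtheta x q = 0"
  then consider i :: nat where "x * q ^ i = 1" | i :: nat where "q / x * q ^ i = 1"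
    unfolding jtheta_def by (auto simp: qpoch_inf_q_nz) (auto simp: qpoch_inf_eq_0_iff)
  thus "\<exists>k. x = q powi k"
  proof cases
    case 1
    hence "x = q powi (- int i)" using q_nz by (simp add: power_int_minus field_simps)
    thus ?thesis by blast
  next
    case 2
    hence "x = q powi (int (Suc i))" using assms by (simp only: power_int_of_nat) (simp add: field_simps)
    thus ?thesis by blast
  qed
next
  assume "\<exists>k. x = q powi k"
  then obtain k where k: "x = q powi k" by blast
  show "jtheta x q = 0"
  proof (cases "0 < k")
    case True
    hence "x = q ^ Suc (nat (k - 1))"
      using k by (simp add: power_int_def del: power_Suc)
        (metis Suc_nat_eq_nat_zadd1 add.commute diff_add_cancel int_ops(2) le_diff_eq
          zle_diff1_eq zle_add1_eq_le)
    hence "q / x * q ^ nat (k - 1) = 1" using q_nz by simp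
    thus ?thesis unfolding jtheta_def using qpoch_inf_eq_0_iff by auto
  next
    case False
    hence "x * q ^ nat (- k) = 1"
      using k q_nz by (simp add: power_int_def) (auto simp: field_simps)
    thus ?thesis unfolding jtheta_def using qpoch_inf_eq_0_iff by auto
  qed
qed

lemma jtheta_1 [simp]: "jtheta 1 q = 0"
  using jtheta_eq_0_iff[of 1] by (metis one_neq_zero power_int_0_right)

lemma jtheta_q_div: "x \<noteq> 0 \<Longrightarrow> jtheta (q / x) q = jtheta x q"
  unfolding jtheta_def using q_nz by simp

text \<open>The shift gains the factor 1 - 1/x in one product and loses 1 - x in the other; their
  quotient is -1/x.\<close>

lemma jtheta_mult_q: 
  assumes "x \<noteq> 0"
  shows "jtheta (q * x) q = - jtheta x q / x"
proof -
  have "qpoch_inf (q / (q * x)) q = (1 - 1 / x) * qpoch_inf (q / x) q"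
    using qpoch_inf_Suc[of "1 / x"] q_nz by simp
  hence "jtheta (q * x) q = qpoch_inf (q * x) q * ((1 - 1 / x) * qpoch_inf (q / x) q) * J"
    by (simp add: jtheta_def J_def)
  moreover have "jtheta x q = (1 - x) * qpoch_inf (q * x) q * qpoch_inf (q / x) q * J"
    using qpoch_inf_Suc[of x] by (simp add: jtheta_def J_def)
  ultimately show ?thesis
    using assms by (simp add: divide_simps) (simp add: algebra_simps)
qed

lemma jtheta_inverse: "x \<noteq> 0 \<Longrightarrow> jtheta (inverse x) q = - jtheta x q / x"
  using jtheta_q_div[of "q * x"] jtheta_mult_q[of x] q_nz by (simp add: field_simps)

lemma jtheta_mult_powi_eq_0_iff:
  assumes "x \<noteq> 0"
  shows "jtheta (x * q powi k) q = 0 \<longleftrightarrow> jtheta x q = 0"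
proof -
  have "(\<exists>l. x * q powi k = q powi l) \<longleftrightarrow> (\<exists>l. x = q powi l)"
  proof safe
    fix l assume "x * q powi k = q powi l"
    hence "x = q powi (l - k)" using q_nz by (simp add: power_int_diff field_simps)
    thus "\<exists>l. x = q powi l" by blast
  next
    fix l show "\<exists>l'. q powi l * q powi k = q powi l'" using q_nz by (metis power_int_add)
  qed
  thus ?thesis using assms q_nz by (simp add: jtheta_eq_0_iff)
qed

lemma J_nz: "J \<noteq> 0"
  unfolding J_def by (rule qpoch_inf_q_nz)

text \<open>The factor 1 - x cancels, and each of the three remaining products equals
  \<open>J\<close> at x = 1. This value normalises the residues of all later theta
  quotients.\<close>

lemma jtheta_simple_zero: "((\<lambda>x. jtheta x q / (1 - x)) \<longlongrightarrow> J ^ 3) (at 1)"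
proof -
  have "((\<lambda>x. qpoch_inf (q * x) q * qpoch_inf (q / x) q * J)
         \<longlongrightarrow> qpoch_inf (q * 1) q * qpoch_inf (q / 1) q * J) (at 1)"
    by (intro tendsto_intros isCont_tendsto_compose[OF qpoch_inf_isCont]) auto
  hence *: "((\<lambda>x. qpoch_inf (q * x) q * qpoch_inf (q / x) q * J) \<longlongrightarrow> J ^ 3) (at 1)"
    by (simp add: J_def power3_eq_cube)
  show ?thesis
  proof (rule Lim_transform_eventually[OF *])
    have "qpoch_inf (q * x) q * qpoch_inf (q / x) q * J = jtheta x q / (1 - x)" if "x \<noteq> 1" for x
      unfolding jtheta_def J_def using that by (subst (3) qpoch_inf_Suc) (simp add: field_simps)
    thus "\<forall>\<^sub>F x in at 1. qpoch_inf (q * x) q * qpoch_inf (q / x) q * J = jtheta x q / (1 - x)"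
      unfolding eventually_at by (intro exI[of _ 1]) auto
  qed
qed

end

text \<open>Tannery's theorem: the majorant makes the finite partial sums converge uniformly in n,
  so that the two limits may be exchanged.\<close>

lemma tendsto_infsum_dominated:
  fixes f :: "nat \<Rightarrow> 'a \<Rightarrow> 'b :: banach"
  assumes lim: "\<And>x. x \<in> X \<Longrightarrow> (\<lambda>n. f n x) \<longlonglongrightarrow> g x"
    and bound: "\<And>n x. x \<in> X \<Longrightarrow> norm (f n x) \<le> h x"
    and summable: "h summable_on X"
  shows "(\<lambda>n. \<Sum>\<^sub>\<infinity>x\<in>X. f n x) \<longlonglongrightarrow> (\<Sum>\<^sub>\<infinity>x\<in>X. g x)"
proof (rule swap_uniform_limit')
  show "uniform_limit UNIV (\<lambda>F n. \<Sum>x\<in>F. f n x) (\<lambda>n. \<Sum>\<^sub>\<infinity>x\<in>X. f n x) (finite_subsets_at_top X)"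
    by (rule Weierstrass_m_test_general[OF bound summable])
  show "\<forall>\<^sub>F F in finite_subsets_at_top X. ((\<lambda>n. \<Sum>x\<in>F. f n x) \<longlongrightarrow> sum g F) sequentially"
    by (intro eventually_finite_subsets_at_top_weakI tendsto_sum lim) auto
  have "norm (g x) \<le> h x" if "x \<in> X" for x
    by (rule Lim_bounded[OF tendsto_norm[OF lim[OF that]]]) (use bound[OF that] in auto)
  hence "g summable_on X"
    by (rule abs_summable_summable[OF Infinite_Sum.abs_summable_on_comparison_test'[OF summable]])
  thus "(sum g \<longlongrightarrow> (\<Sum>\<^sub>\<infinity>x\<in>X. g x)) (finite_subsets_at_top X)"
    using has_sum_infsum unfolding has_sum_def by blast
qed auto

lemma has_sum_diff:
  fixes f g :: "'a \<Rightarrow> 'b :: real_normed_vector"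
  assumes "(f has_sum S) A" "(g has_sum T) A"
  shows "((\<lambda>x. f x - g x) has_sum (S - T)) A"
proof -
  have "((\<lambda>x. - g x) has_sum (- T)) A" using assms(2) by (simp add: has_sum_uminus)
  from has_sum_add[OF assms(1) this] show ?thesis by simp
qed

lemma summable_on_diff:
  fixes f g :: "'a \<Rightarrow> 'b :: real_normed_vector"
  assumes "f summable_on A" "g summable_on A"
  shows "(\<lambda>x. f x - g x) summable_on A"
  using summable_on_add[OF assms(1) summable_on_uminus[THEN iffD2, OF assms(2)]] by simp

lemma infsum_diff:
  fixes f g :: "'a \<Rightarrow> 'b :: real_normed_vector"
  assumes "f summable_on A" "g summable_on A"
  shows "(\<Sum>\<^sub>\<infinity>x\<in>A. f x - g x) = (\<Sum>\<^sub>\<infinity>x\<in>A. f x) - (\<Sum>\<^sub>\<infinity>x\<in>A. g x)"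
  using infsum_add[OF assms(1) summable_on_uminus[THEN iffD2, OF assms(2)]]
  by (simp add: infsum_uminus)

lemma infsum_int_shift:
  fixes f :: "int \<Rightarrow> 'a :: {comm_monoid_add, t2_space}"
  shows "(\<Sum>\<^sub>\<infinity>r. f (r + k)) = (\<Sum>\<^sub>\<infinity>r. f r)"
  by (rule infsum_reindex_bij_witness[of _ "\<lambda>r. r - k" "\<lambda>r. r + k"]) auto

lemma infsum_int_reflect:
  fixes f :: "int \<Rightarrow> 'a :: {comm_monoid_add, t2_space}"
  shows "(\<Sum>\<^sub>\<infinity>r. f (k - r)) = (\<Sum>\<^sub>\<infinity>r. f r)"
  by (rule infsum_reindex_bij_witness[of _ "\<lambda>r. k - r" "\<lambda>r. k - r"]) auto

lemma summable_on_int_shift: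
  fixes f :: "int \<Rightarrow> 'a :: {comm_monoid_add, t2_space}"
  assumes "f summable_on UNIV"
  shows "(\<lambda>r. f (r + k)) summable_on UNIV"
  using assms by (subst summable_on_reindex_bij_witness[of _ "\<lambda>r. r - k" "\<lambda>r. r + k" UNIV f]) auto

lemma triangle_Suc: "(r + 1) * (r + 1 - 1) div 2 = r * (r - 1) div 2 + (r::int)"
proof -
  have "(r + 1) * (r + 1 - 1) = r * (r - 1) + 2 * r" by (simp add: algebra_simps)
  thus ?thesis by simp
qed

section \<open>The Jacobi triple product, as the limit of a finite identity\<close>

definition theta_coeff :: "complex \<Rightarrow> complex \<Rightarrow> int \<Rightarrow> complex" where
  "theta_coeff q z r = (-1) powi r * q powi (r * (r - 1) div 2) * z powi r"

context nome
begin

lemma theta_coeff_Suc: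
  assumes "z \<noteq> 0"
  shows "theta_coeff q z (r + 1) = - z * q powi r * theta_coeff q z r"
  unfolding theta_coeff_def triangle_Suc using assms q_nz by (simp add: power_int_add)

lemma theta_coeff_0 [simp]: "theta_coeff q z 0 = 1"
  by (simp add: theta_coeff_def)

lemma theta_coeff_mult_powi:
  "theta_coeff q (z * q powi k) r = theta_coeff q z r * q powi (k * r)"
  unfolding theta_coeff_def by (simp add: power_int_mult_distrib power_int_mult)

lemma theta_coeff_minus:
  assumes "z \<noteq> 0"
  shows "theta_coeff q z (- r) = theta_coeff q (q / z) r"
proof -
  have "- r * (- r - 1) = r * (r - 1) + 2 * r" by (simp add: algebra_simps)
  hence "- r * (- r - 1) div 2 = r * (r - 1) div 2 + r" by simp
  thus ?thesis
    unfolding theta_coeff_def using assms q_nz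
    by (simp add: power_int_add power_int_minus power_int_divide_distrib divide_simps)
qed

text \<open>The exponent r(r+1)/2 is symmetric about r = -1/2 while the sign alternates: the
  termwise form of j(q; q) = 0.\<close>

lemma theta_coeff_reflect: "theta_coeff q q (- 1 - r) = - theta_coeff q q r"
  using theta_coeff_minus[of q "r + 1"] theta_coeff_Suc[of 1 r] q_nz
    theta_coeff_mult_powi[of 1 1 r] by (simp add: algebra_simps)

lemma theta_coeff_summable_nat:
  assumes "z \<noteq> 0"
  shows "summable (\<lambda>n. norm (theta_coeff q z (int n)))"
proof -
  have "(\<lambda>n. norm (z * q ^ n)) \<longlonglongrightarrow> norm (z * 0)"
    by (intro tendsto_intros power_q_tendsto_0)
  hence "\<forall>\<^sub>F n in sequentially. norm (z * q ^ n) < 1 / 2"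
    by (rule order_tendstoD) simp
  then obtain N where N: "\<And>n. n \<ge> N \<Longrightarrow> norm (z * q ^ n) < 1 / 2"
    unfolding eventually_sequentially by blast
  show ?thesis
  proof (rule summable_ratio_test[of "1 / 2" N])
    fix n assume "N \<le> n"
    have "norm (theta_coeff q z (int (Suc n))) = norm (z * q ^ n) * norm (theta_coeff q z (int n))"
      using theta_coeff_Suc[OF assms, of "int n"] by (simp add: norm_mult add.commute)
    also have "\<dots> \<le> 1 / 2 * norm (theta_coeff q z (int n))"
      using N[OF \<open>N \<le> n\<close>] by (intro mult_right_mono) auto
    finally show "norm (norm (theta_coeff q z (int (Suc n)))) \<le> 1 / 2 * norm (norm (theta_coeff q z (int n)))"
      by simp
  qed auto
qed

text \<open>The ratio test handles r >= 0; the terms with r <= 0 are those of the series for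
  q/z.\<close>

lemma theta_coeff_abs_summable:
  assumes "z \<noteq> 0"
  shows "(\<lambda>r. norm (theta_coeff q z r)) summable_on UNIV"
proof -
  have *: "(\<lambda>n. norm (theta_coeff q y (int n))) summable_on UNIV" if "y \<noteq> 0" for y
    using theta_coeff_summable_nat[OF that] by (simp add: summable_on_UNIV_nonneg_real_iff)
  have 1: "(\<lambda>r. norm (theta_coeff q z r)) summable_on range int"
    by (subst summable_on_reindex) (use *[OF assms] in \<open>auto simp: o_def\<close>)
  have "(\<lambda>r. norm (theta_coeff q z r)) summable_on range (\<lambda>n. - int n)"
    by (subst summable_on_reindex)
      (use *[of "q / z"] assms q_nz in \<open>auto simp: o_def theta_coeff_minus inj_on_def\<close>)
  hence 2: "(\<lambda>r. norm (theta_coeff q z r)) summable_on (range (\<lambda>n. - int n) - range int)"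
    by (rule summable_on_subset_banach) auto
  have "(\<lambda>r. norm (theta_coeff q z r)) summable_on (range int \<union> (range (\<lambda>n. - int n) - range int))"
    by (intro summable_on_Un_disjoint 1 2) auto
  also have "range int \<union> (range (\<lambda>n. - int n) - range int) = UNIV"
    by (auto simp: image_iff) (metis int_cases2)
  finally show ?thesis .
qed

lemma theta_coeff_summable: "z \<noteq> 0 \<Longrightarrow> theta_coeff q z summable_on UNIV"
  using theta_coeff_abs_summable by (rule abs_summable_summable)

text \<open>The value 0 at negative indices is the usual convention for 1/(q;q)_k. It lets finite
  sums run over all integers and makes \<open>rq_pred\<close> hold without exception, as 1 - q^0 =
  0.\<close>

definition rq :: "int \<Rightarrow> complex" where
  "rq k = (if k < 0 then 0 else 1 / qpoch q q (nat k))"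

lemma rq_neg [simp]: "k < 0 \<Longrightarrow> rq k = 0"
  by (simp add: rq_def)

lemma rq_of_nat: "rq (int n) = 1 / qpoch q q n"
  by (simp add: rq_def)

lemma rq_0 [simp]: "rq 0 = 1"
  by (simp add: rq_def)

lemma rq_pred: "rq (k - 1) = (1 - q powi k) * rq k"
proof -
  consider "k < 0" | "k = 0" | n where "k = int (Suc n)"
    by (metis int_cases neg_int_cases not0_implies_Suc of_nat_0 zero_le_imp_eq_int linorder_not_less)
  thus ?thesis
  proof cases
    case 3
    have "1 - q * q ^ n \<noteq> 0" using power_q_neq_1[of "Suc n"] by simp
    thus ?thesis using 3 by (simp add: rq_of_nat qpoch_Suc del: of_nat_Suc) (simp add: rq_of_nat)
  qed auto
qed

lemma rq_bounded: "\<exists>C>0. \<forall>k. norm (rq k) \<le> C"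
proof -
  have "(\<lambda>n. 1 / qpoch q q n) \<longlonglongrightarrow> 1 / J"
    unfolding J_def by (intro tendsto_intros qpoch_tendsto qpoch_inf_q_nz)
  hence "Bseq (\<lambda>n. 1 / qpoch q q n)" by (intro convergent_imp_Bseq convergentI)
  then obtain C where "C > 0" "\<And>n. norm (1 / qpoch q q n) \<le> C" by (auto simp: Bseq_def)
  thus ?thesis by (intro exI[of _ C]) (auto simp: rq_def)
qed

lemma rq_tendsto: "(\<lambda>n. rq (int n + k)) \<longlonglongrightarrow> 1 / J"
proof -
  have "(\<lambda>n. 1 / qpoch q q n) \<longlonglongrightarrow> 1 / J"
    unfolding J_def by (intro tendsto_intros qpoch_tendsto qpoch_inf_q_nz)
  moreover have "filterlim (\<lambda>n. nat (int n + k)) at_top sequentially"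
    unfolding filterlim_at_top eventually_sequentially
    by (intro allI, rule_tac x="nat \<bar>k\<bar> + Z" in exI) auto
  ultimately have "(\<lambda>n. 1 / qpoch q q (nat (int n + k))) \<longlonglongrightarrow> 1 / J"
    by (rule filterlim_compose)
  moreover have "\<forall>\<^sub>F n in sequentially. 1 / qpoch q q (nat (int n + k)) = rq (int n + k)"
    using eventually_ge_at_top[of "nat \<bar>k\<bar>"] by eventually_elim (auto simp: rq_def)
  ultimately show ?thesis by (rule Lim_transform_eventually)
qed

text \<open>Up to the factor (q;q)_(2n) this is the Gaussian binomial coefficient of 2n over n + r,
  and it is also the kernel of a Bailey pair relative to 1.\<close>

definition rqq :: "int \<Rightarrow> int \<Rightarrow> complex" where
  "rqq n r = rq (n - r) * rq (n + r)"

lemma rqq_eq_0: "n < \<bar>r\<bar> \<Longrightarrow> rqq n r = 0"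
  by (auto simp: rqq_def abs_if split: if_splits)

lemma summable_on_rqq: "(\<And>r. rqq n r = 0 \<Longrightarrow> f r = 0) \<Longrightarrow> f summable_on UNIV" 
proof (rule finite_nonzero_values_imp_summable_on)
  assume *: "\<And>r. rqq n r = 0 \<Longrightarrow> f r = 0"
  have "{r \<in> UNIV. f r \<noteq> 0} \<subseteq> {-\<bar>n\<bar>..\<bar>n\<bar>}"
  proof
    fix r assume "r \<in> {r \<in> UNIV. f r \<noteq> 0}"
    hence "\<not> n < \<bar>r\<bar>" using *[of r] rqq_eq_0[of n r] by auto
    thus "r \<in> {-\<bar>n\<bar>..\<bar>n\<bar>}" by auto
  qed
  thus "finite {r \<in> UNIV. f r \<noteq> 0}" by (rule finite_subset) simp
qed

definition jfin :: "nat \<Rightarrow> complex \<Rightarrow> complex" where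
  "jfin n x = (\<Sum>\<^sub>\<infinity>r. theta_coeff q x r * rqq (int n) r)"

lemma jfin_0: "jfin 0 x = 1"
proof -
  have "jfin 0 x = (\<Sum>\<^sub>\<infinity>r\<in>{0}. theta_coeff q x r * rqq (int 0) r)"
    unfolding jfin_def by (rule infsum_cong_neutral) (auto simp: rqq_eq_0)
  thus ?thesis by (simp add: rqq_def)
qed

text \<open>Expanding the two new factors of the product gives 1 + q^(2n+1), a term in x and a term
  in 1/x. The last two are absorbed by shifting r, after which the coefficients are compared one by
  one.\<close>

lemma jfin_Suc:
  assumes "x \<noteq> 0"
  shows "(1 - q ^ (2 * n + 2)) * (1 - q ^ (2 * n + 1)) * jfin (Suc n) x =
         (1 - x * q ^ n) * (1 - q ^ Suc n / x) * jfin n x"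
proof -
  define c where "c = (\<lambda>r. theta_coeff q x r * rqq (int n) r)"
  have c: "c summable_on UNIV" by (rule summable_on_rqq[of "int n"]) (simp add: c_def)
  have c1: "(\<lambda>r. c (r + k)) summable_on UNIV" for k using c by (rule summable_on_int_shift)
  have qq: "q ^ (2 * n + 1) = q ^ n * q ^ Suc n" by (simp add: mult_2 flip: power_add)
  have "(1 - x * q ^ n) * (1 - q ^ Suc n / x) * jfin n x =
        (1 + q ^ (2 * n + 1)) * (\<Sum>\<^sub>\<infinity>r. c r) - x * q ^ n * (\<Sum>\<^sub>\<infinity>r. c r)
          - q ^ Suc n / x * (\<Sum>\<^sub>\<infinity>r. c r)"
    unfolding jfin_def c_def[symmetric] qq using assms by (simp add: field_simps)
  also have "\<dots> = (1 + q ^ (2 * n + 1)) * (\<Sum>\<^sub>\<infinity>r. c r) - x * q ^ n * (\<Sum>\<^sub>\<infinity>r. c (r + (-1)))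
          - q ^ Suc n / x * (\<Sum>\<^sub>\<infinity>r. c (r + 1))"
    by (simp only: infsum_int_shift)
  also have "\<dots> = (\<Sum>\<^sub>\<infinity>r. (1 + q ^ (2 * n + 1)) * c r - x * q ^ n * c (r + (-1)) - q ^ Suc n / x * c (r + 1))"
    by (rule infsumI[symmetric], intro has_sum_diff has_sum_cmult_right has_sum_infsum c c1)
  also have "\<dots> = (\<Sum>\<^sub>\<infinity>r. (1 - q ^ (2 * n + 2)) * (1 - q ^ (2 * n + 1)) *
                        (theta_coeff q x r * rqq (int (Suc n)) r))"
  proof (rule infsum_cong)
    fix r :: int
    \<comment> \<open>All shifted coefficients are multiples of u v t with polynomials in A/q, B/q,
      A, B as factors, and A B = q^(2n+2). The comparison becomes a rational identity in A and
      B.\<close>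
    define u v A B t where "u = rq (int n + 1 - r)" and "v = rq (int n + 1 + r)"
      and "A = q powi (int n + 1 - r)" and "B = q powi (int n + 1 + r)"
      and "t = theta_coeff q x r"
    have e1: "q ^ (2 * n + 2) = A * B" "q ^ (2 * n + 1) = A * B / q"
      unfolding A_def B_def using q_nz
      by (simp_all add: power_int_add power_int_diff power_add mult_2 power2_eq_square)
    have u': "rq (int n - r) = (1 - A) * u" "rq (int n + r) = (1 - B) * v"
      "rq (int n - r - 1) = (1 - A / q) * (1 - A) * u" "rq (int n + r - 1) = (1 - B / q) * (1 - B) * v"
      using rq_pred[of "int n + 1 - r"] rq_pred[of "int n + 1 + r"]
        rq_pred[of "int n - r"] rq_pred[of "int n + r"] q_nz
      by (simp_all add: u_def v_def A_def B_def power_int_add power_int_diff)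
    have t1: "x * q ^ n * theta_coeff q x (r + (-1)) = - A * t"
      using theta_coeff_Suc[OF assms, of "r - 1"] q_nz
      by (simp add: A_def t_def power_int_diff power_int_add)
    have t2: "q ^ Suc n / x * theta_coeff q x (r + 1) = - B * t"
      using theta_coeff_Suc[OF assms, of r] q_nz assms
      by (simp add: B_def t_def power_int_diff power_int_add)
    have "int n - (r + (-1)) = int n + 1 - r" "int n + (r + (-1)) = int n + r - 1"
      "int n - (r + 1) = int n - r - 1" "int n + (r + 1) = int n + 1 + r" by auto
    hence R: "rqq (int n) r = (1 - A) * u * ((1 - B) * v)"
      "rqq (int n) (r + (-1)) = u * ((1 - B / q) * (1 - B) * v)"
      "rqq (int n) (r + 1) = (1 - A / q) * (1 - A) * u * v"
      unfolding rqq_def by (simp_all only: u') (simp_all only: u_def v_def)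
    have "(1 + q ^ (2 * n + 1)) * c r - x * q ^ n * c (r + (-1)) - q ^ Suc n / x * c (r + 1) =
       (1 + A * B / q) * (t * ((1 - A) * u * ((1 - B) * v)))
        - x * q ^ n * theta_coeff q x (r + (-1)) * (u * ((1 - B / q) * (1 - B) * v))
        - q ^ Suc n / x * theta_coeff q x (r + 1) * ((1 - A / q) * (1 - A) * u * v)"
      unfolding c_def R e1 t_def by (simp only: mult.assoc)
    also have "\<dots> = (1 - A * B) * (1 - A * B / q) * (t * (u * v))"
      unfolding t1 t2 using q_nz by (simp add: field_simps)
    finally show "(1 + q ^ (2 * n + 1)) * c r - x * q ^ n * c (r + (-1)) - q ^ Suc n / x * c (r + 1) =
        (1 - q ^ (2 * n + 2)) * (1 - q ^ (2 * n + 1)) * (theta_coeff q x r * rqq (int (Suc n)) r)"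
      unfolding e1 by (simp add: t_def u_def v_def rqq_def add_ac)
  qed
  also have "\<dots> = (1 - q ^ (2 * n + 2)) * (1 - q ^ (2 * n + 1)) * jfin (Suc n) x"
    unfolding jfin_def by (rule infsum_cmult_right')
  finally show ?thesis by simp
qed

lemma jfin_eq:
  assumes "x \<noteq> 0"
  shows "jfin n x = qpoch x q n * qpoch (q / x) q n / qpoch q q (2 * n)"
proof (induction n)
  case 0
  show ?case by (simp add: jfin_0)
next
  case (Suc n)
  define a b where "a = 1 - q ^ (2 * n + 2)" and "b = 1 - q ^ (2 * n + 1)"
  have ab: "a \<noteq> 0" "b \<noteq> 0"
    using power_q_neq_1[of "2 * n + 1"] power_q_neq_1[of "2 * n + 2"] by (auto simp: a_def b_def)
  have p: "qpoch q q (2 * Suc n) = qpoch q q (2 * n) * b * a"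
    by (simp add: qpoch_Suc a_def b_def mult_ac)
  have "jfin (Suc n) x = (1 - x * q ^ n) * (1 - q ^ Suc n / x) * jfin n x / (a * b)"
    using jfin_Suc[OF assms, of n] ab unfolding a_def[symmetric] b_def[symmetric]
    by (simp add: field_simps)
  thus ?case
    unfolding Suc p qpoch_Suc by (simp add: mult_ac)
qed

text \<open>Let n tend to infinity in \<open>jfin_eq\<close>. The coefficients \<open>rqq\<close>
  are bounded uniformly in n and tend to 1/J^2, so the theta series itself is the majorant.\<close>

theorem jacobi_triple_product:
  assumes "x \<noteq> 0"
  shows "(\<Sum>\<^sub>\<infinity>r. theta_coeff q x r) = jtheta x q"
proof -
  obtain C where C: "C > 0" "\<And>k. norm (rq k) \<le> C" using rq_bounded by blast
  have "(\<lambda>n. jfin n x) \<longlonglongrightarrow> (\<Sum>\<^sub>\<infinity>r. theta_coeff q x r * (1 / J * (1 / J)))"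
    unfolding jfin_def
  proof (rule tendsto_infsum_dominated)
    fix r :: int
    show "(\<lambda>n. theta_coeff q x r * rqq (int n) r) \<longlonglongrightarrow> theta_coeff q x r * (1 / J * (1 / J))"
      unfolding rqq_def using rq_tendsto[of "- r"] by (intro tendsto_intros rq_tendsto) auto
    show "norm (theta_coeff q x r * rqq (int n) r) \<le> norm (theta_coeff q x r) * (C * C)" for n
      unfolding rqq_def norm_mult using C by (intro mult_left_mono mult_mono) auto
  qed (intro summable_on_cmult_left theta_coeff_abs_summable assms)
  also have "(\<Sum>\<^sub>\<infinity>r. theta_coeff q x r * (1 / J * (1 / J))) = (\<Sum>\<^sub>\<infinity>r. theta_coeff q x r) / J\<^sup>2"
    by (subst infsum_cmult_left') (simp add: power2_eq_square)
  finally have 1: "(\<lambda>n. jfin n x) \<longlonglongrightarrow> (\<Sum>\<^sub>\<infinity>r. theta_coeff q x r) / J\<^sup>2" .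
  have "filterlim (\<lambda>n::nat. 2 * n) at_top sequentially"
    by (rule filterlim_subseq) (auto simp: strict_mono_def)
  hence "(\<lambda>n. qpoch q q (2 * n)) \<longlonglongrightarrow> qpoch_inf q q"
    using qpoch_tendsto filterlim_compose by blast
  hence 2: "(\<lambda>n. jfin n x) \<longlonglongrightarrow> qpoch_inf x q * qpoch_inf (q / x) q / qpoch_inf q q"
    unfolding jfin_eq[OF assms] by (intro tendsto_intros qpoch_tendsto qpoch_inf_q_nz)
  have "(\<Sum>\<^sub>\<infinity>r. theta_coeff q x r) / J\<^sup>2 = qpoch_inf x q * qpoch_inf (q / x) q / J"
    using LIMSEQ_unique[OF 1 2] by (simp add: J_def)
  thus ?thesis
    using J_nz by (simp add: jtheta_def J_def field_simps power2_eq_square)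
qed

end

section \<open>Appell sums\<close>

definition appell_sum :: "(int \<Rightarrow> complex) \<Rightarrow> complex \<Rightarrow> complex \<Rightarrow> complex" where
  "appell_sum a q w = (\<Sum>\<^sub>\<infinity>r. a r / (1 - w * q powi r))"

context nome
begin

lemma jtheta_nz_iff: "w \<noteq> 0 \<Longrightarrow> jtheta w q \<noteq> 0 \<longleftrightarrow> (\<forall>r::int. w * q powi r \<noteq> 1)"
proof -
  have "(\<exists>k. w = q powi k) \<longleftrightarrow> (\<exists>r. w * q powi r = 1)"
  proof safe
    fix k show "\<exists>r. q powi k * q powi r = 1"
      using q_nz by (intro exI[of _ "-k"]) (simp flip: power_int_add)
  next
    fix r assume "w * q powi r = 1"
    hence "w = q powi (-r)" using q_nz by (simp add: power_int_minus field_simps)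
    thus "\<exists>k. w = q powi k" by blast
  qed
  thus "w \<noteq> 0 \<Longrightarrow> ?thesis" by (simp add: jtheta_eq_0_iff)
qed

lemma norm_powi_decreasing: "k \<le> l \<Longrightarrow> norm q powi l \<le> norm q powi k"
  using norm_q_pos q_lt1 by (intro power_int_decreasing) auto

lemma finite_norm_powi_between:
  assumes "0 < y"
  shows "finite {r::int. 1 / 4 < y * norm q powi r \<and> y * norm q powi r < 4}"
proof -
  obtain K where K: "norm q ^ K < 1 / (4 * y)" "norm q ^ K < y / 4"
    using real_arch_pow_inv[of "min (1 / (4 * y)) (y / 4)" "norm q"] q_lt1 assms by auto
  have "{r::int. 1 / 4 < y * norm q powi r \<and> y * norm q powi r < 4} \<subseteq> {- int K..int K}"
  proof safe
    fix r :: int assume r: "1 / 4 < y * norm q powi r" "y * norm q powi r < 4"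
    have "r \<le> int K"
    proof (rule ccontr)
      assume "\<not> r \<le> int K"
      hence "norm q powi r \<le> norm q ^ K" using norm_powi_decreasing[of "int K" r] by simp
      hence "y * norm q powi r \<le> y * norm q ^ K" using assms by simp
      also have "\<dots> < 1 / 4" using K assms by (simp add: field_simps)
      finally show False using r by simp
    qed
    moreover have "- int K \<le> r"
    proof (rule ccontr)
      assume "\<not> - int K \<le> r"
      hence "norm q powi (- int K) \<le> norm q powi r" using norm_powi_decreasing[of r "- int K"] by simp
      hence "y / norm q ^ K \<le> y * norm q powi r"
        using mult_left_mono[of "norm q powi (- int K)" "norm q powi r" y] assms
        by (simp add: power_int_minus divide_inverse)
      moreover have "4 < y / norm q ^ K" using K assms norm_q_pos by (simp add: field_simps)
      ultimately show False using r by simp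
    qed
    ultimately show "r \<in> {- int K..int K}" by simp
  qed
  thus ?thesis by (rule finite_subset) simp
qed

text \<open>For all but finitely many r the modulus of x q^r stays away from 1, and on the remaining
  r a minimum exists. The bound is uniform in r and near x0, also when x0 is itself a pole of some
  other term.\<close>

lemma one_minus_powi_bounded_below:
  assumes "x0 \<noteq> 0"
  obtains d c where "0 < d" "d < norm x0" "0 < c"
    "\<And>x r. x \<in> cball x0 d \<Longrightarrow> x0 * q powi r \<noteq> 1 \<Longrightarrow> c \<le> norm (1 - x * q powi r)"
proof -
  define y where "y = norm x0"
  have y: "y > 0" using assms by (simp add: y_def)
  define S where "S = {r::int. 1 / 4 < y * norm q powi r \<and> y * norm q powi r < 4}"
  have S: "finite S" unfolding S_def by (rule finite_norm_powi_between[OF y])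
  \<comment> \<open>Inserting 1 makes the minimum meaningful for an empty set and gives m <= 1,
    which settles the indices outside S.\<close>
  define m where "m = Min (insert 1 ((\<lambda>r. norm (1 - x0 * q powi r)) ` {r \<in> S. x0 * q powi r \<noteq> 1}))"
  have m: "m > 0" "m \<le> 1" "\<And>r. r \<in> S \<Longrightarrow> x0 * q powi r \<noteq> 1 \<Longrightarrow> m \<le> norm (1 - x0 * q powi r)"
    unfolding m_def using S by (auto simp: Min_gr_iff intro!: Min_le)
  \<comment> \<open>On S the modulus of x0 q^r is below 4, so the radius y m / 8 changes 1 - x q^r
    by at most m/2.\<close>
  define d where "d = min (y / 2) (y * m / 8)"
  show ?thesis
  proof (rule that[of d "m / 2"])
    show "0 < d" "d < norm x0" "0 < m / 2" using y m by (auto simp: d_def y_def min_def)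
    fix x r assume x: "x \<in> cball x0 d" and r: "x0 * q powi r \<noteq> 1"
    have dx: "norm (x - x0) \<le> d" using x by (simp add: dist_norm norm_minus_commute)
    have nx: "norm x \<le> 3 / 2 * y" "norm x \<ge> y / 2"
      using norm_triangle_ineq2[of x x0] norm_triangle_ineq2[of x0 x] dx
      by (auto simp: d_def y_def norm_minus_commute[of x0])
    define p where "p = norm q powi r"
    have p: "p > 0" using norm_q_pos by (simp add: p_def)
    have np: "norm (x * q powi r) = norm x * p" by (simp add: p_def norm_mult norm_power_int)
    consider "y * p \<le> 1 / 4" | "y * p \<ge> 4" | "r \<in> S" unfolding S_def p_def by force
    thus "m / 2 \<le> norm (1 - x * q powi r)"
    proof cases
      case 1
      have "norm x * p \<le> 3 / 2 * y * p" using nx p by simp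
      hence "norm (x * q powi r) \<le> 3 / 8" using 1 np by simp
      thus ?thesis using norm_triangle_ineq2[of 1 "x * q powi r"] m by simp
    next
      case 2
      have "y / 2 * p \<le> norm x * p" using nx p by simp
      hence "norm (x * q powi r) \<ge> 2" using 2 np by simp
      thus ?thesis using norm_triangle_ineq3[of 1 "x * q powi r"] m by simp
    next
      case 3
      have "norm (x - x0) * p \<le> y * m / 8 * p" using dx p by (intro mult_right_mono) (auto simp: d_def)
      also have "\<dots> = m / 8 * (y * p)" by simp
      also have "\<dots> \<le> m / 8 * 4" using 3 m unfolding S_def p_def by (intro mult_left_mono) auto
      finally have "norm ((x - x0) * q powi r) \<le> m / 2" by (simp add: p_def norm_mult norm_power_int)
      moreover have "1 - x0 * q powi r = (1 - x * q powi r) + (x - x0) * q powi r"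
        by (simp add: algebra_simps)
      hence "norm (1 - x0 * q powi r) \<le> norm (1 - x * q powi r) + norm ((x - x0) * q powi r)"
        by (metis norm_triangle_ineq)
      ultimately show ?thesis using m(3)[OF 3 r] by linarith
    qed
  qed
qed

text \<open>Leaves out the term that may be singular at x0: the rest is dominated by |a_r| / c on a
  disc, hence converges uniformly to a holomorphic function.\<close>

lemma appell_sum_regular_part:
  assumes a: "(\<lambda>r. norm (a r)) summable_on UNIV" and x0: "x0 \<noteq> 0"
    and X: "X = {r. x0 * q powi r \<noteq> 1}"
  obtains d where "0 < d" "d < norm x0"
    "\<forall>w\<in>ball x0 d. (\<lambda>r. a r / (1 - w * q powi r)) summable_on X"
    "(\<lambda>w. \<Sum>\<^sub>\<infinity>r\<in>X. a r / (1 - w * q powi r)) holomorphic_on ball x0 d"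
proof -
  obtain d c where d: "0 < d" "d < norm x0" "0 < c"
    and c: "\<And>x r. x \<in> cball x0 d \<Longrightarrow> x0 * q powi r \<noteq> 1 \<Longrightarrow> c \<le> norm (1 - x * q powi r)"
    using one_minus_powi_bounded_below[OF x0] by metis
  have aX: "(\<lambda>r. norm (a r) / c) summable_on X"
    using summable_on_subset_banach[OF a, of X] unfolding divide_inverse
    by (intro summable_on_cmult_left) auto
  have bound: "norm (a r / (1 - w * q powi r)) \<le> norm (a r) / c" if "r \<in> X" "w \<in> cball x0 d" for r w
    unfolding norm_divide using c[OF that(2), of r] that(1) d X by (intro divide_left_mono mult_pos_pos) auto
  have ul: "uniform_limit (cball x0 d) (\<lambda>F w. \<Sum>r\<in>F. a r / (1 - w * q powi r))
              (\<lambda>w. \<Sum>\<^sub>\<infinity>r\<in>X. a r / (1 - w * q powi r)) (finite_subsets_at_top X)"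
    by (rule Weierstrass_m_test_general[OF _ aX]) (rule bound)
  have hol: "(\<lambda>w. \<Sum>r\<in>F. a r / (1 - w * q powi r)) holomorphic_on cball x0 d" if "F \<subseteq> X" for F
  proof (intro holomorphic_intros)
    fix r w assume "r \<in> F" "w \<in> cball x0 d"
    thus "1 - w * q powi r \<noteq> 0" using c[of w r] d that X by auto
  qed
  have "(\<lambda>w. \<Sum>\<^sub>\<infinity>r\<in>X. a r / (1 - w * q powi r)) holomorphic_on ball x0 d"
  proof (rule holomorphic_uniform_limit[OF _ ul])
    show "\<forall>\<^sub>F F in finite_subsets_at_top X.
       continuous_on (cball x0 d) (\<lambda>w. \<Sum>r\<in>F. a r / (1 - w * q powi r)) \<and>
       (\<lambda>w. \<Sum>r\<in>F. a r / (1 - w * q powi r)) holomorphic_on ball x0 d"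
      by (intro eventually_finite_subsets_at_top_weakI conjI holomorphic_on_imp_continuous_on hol
          holomorphic_on_subset[OF hol ball_subset_cball]) auto
  qed auto
  moreover have "(\<lambda>r. a r / (1 - w * q powi r)) summable_on X" if "w \<in> ball x0 d" for w
    by (rule abs_summable_summable[OF Infinite_Sum.abs_summable_on_comparison_test'[OF aX]])
      (use bound that in auto)
  ultimately show ?thesis using d that by blast
qed

lemma appell_sum_summable:
  assumes a: "(\<lambda>r. norm (a r)) summable_on UNIV" and w: "w \<noteq> 0" "jtheta w q \<noteq> 0"
  shows "(\<lambda>r. a r / (1 - w * q powi r)) summable_on UNIV"
proof -
  have "UNIV = {r. w * q powi r \<noteq> 1}" using w jtheta_nz_iff[of w] by auto
  from appell_sum_regular_part[OF a w(1) this]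
  obtain d where "0 < d" "\<forall>v\<in>ball w d. (\<lambda>r. a r / (1 - v * q powi r)) summable_on UNIV"
    by metis
  thus ?thesis by simp
qed

lemma appell_sum_holomorphic:
  assumes a: "(\<lambda>r. norm (a r)) summable_on UNIV"
  shows "appell_sum a q holomorphic_on {w. w \<noteq> 0 \<and> jtheta w q \<noteq> 0}"
  unfolding holomorphic_on_def
proof
  fix w assume "w \<in> {w. w \<noteq> 0 \<and> jtheta w q \<noteq> 0}"
  hence w: "w \<noteq> 0" "jtheta w q \<noteq> 0" by auto
  have U: "UNIV = {r. w * q powi r \<noteq> 1}" using w jtheta_nz_iff[of w] by auto
  obtain d where d: "0 < d" "d < norm w"
    "\<forall>v\<in>ball w d. (\<lambda>r. a r / (1 - v * q powi r)) summable_on UNIV"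
    "(\<lambda>w. \<Sum>\<^sub>\<infinity>r. a r / (1 - w * q powi r)) holomorphic_on ball w d"
    by (rule appell_sum_regular_part[OF a w(1) U])
  have "(\<lambda>v. appell_sum a q v) holomorphic_on ball w d"
    using d(4) unfolding appell_sum_def .
  hence "appell_sum a q field_differentiable (at w)"
    using d holomorphic_on_imp_differentiable_at by force
  thus "appell_sum a q field_differentiable (at w within {w. w \<noteq> 0 \<and> jtheta w q \<noteq> 0})"
    by (rule field_differentiable_at_within)
qed

lemma appell_sum_holomorphic' [holomorphic_intros]:
  assumes "(\<lambda>r. norm (a r)) summable_on UNIV" "f holomorphic_on S"
    "\<And>x. x \<in> S \<Longrightarrow> f x \<noteq> 0" "\<And>x. x \<in> S \<Longrightarrow> jtheta (f x) q \<noteq> 0"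
  shows "(\<lambda>x. appell_sum a q (f x)) holomorphic_on S"
  using holomorphic_on_compose_gen[OF assms(2) appell_sum_holomorphic[OF assms(1)]] assms(3,4)
  by (auto simp: o_def image_subset_iff)

text \<open>Powers of q with different exponents differ, so only the term with index k is singular
  at w0; the factor 1 - w q^k annihilates the regular rest in the limit.\<close>

lemma appell_sum_pole:
  assumes a: "(\<lambda>r. norm (a r)) summable_on UNIV" and w0: "w0 * q powi k = 1"
  shows "((\<lambda>w. (1 - w * q powi k) * appell_sum a q w) \<longlongrightarrow> a k) (at w0)"
proof -
  have nz: "w0 \<noteq> 0" using w0 by auto
  have X: "- {k} = {r. w0 * q powi r \<noteq> 1}"
  proof safe
    fix r assume "w0 * q powi r = 1" "r \<noteq> k"
    thus False using w0 nz powi_eq_iff[of r k] by (metis mult_left_cancel)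
  qed (use w0 in auto)
  define R where "R = (\<lambda>w. \<Sum>\<^sub>\<infinity>r\<in>-{k}. a r / (1 - w * q powi r))"
  obtain d where d: "0 < d" "d < norm w0"
    and sm: "\<forall>w\<in>ball w0 d. (\<lambda>r. a r / (1 - w * q powi r)) summable_on -{k}"
    and hol: "R holomorphic_on ball w0 d"
    unfolding R_def by (rule appell_sum_regular_part[OF a nz X])
  have "isCont R w0"
    using hol d by (metis centre_in_ball continuous_on_eq_continuous_at holomorphic_on_imp_continuous_on open_ball)
  hence "((\<lambda>w. a k + (1 - w * q powi k) * R w) \<longlongrightarrow> a k + (1 - w0 * q powi k) * R w0) (at w0)"
    by (intro tendsto_intros) (simp add: isCont_def)
  hence *: "((\<lambda>w. a k + (1 - w * q powi k) * R w) \<longlongrightarrow> a k) (at w0)" using w0 by simp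
  have U: "insert k (- {k}) = UNIV" by auto
  show ?thesis
  proof (rule Lim_transform_within_open[OF *])
    fix w assume w: "w \<in> ball w0 d" "w \<noteq> w0"
    have "w * q powi k \<noteq> 1" using w0 w(2) q_nz by (metis mult_right_cancel power_int_not_zero)
    have "((\<lambda>r. a r / (1 - w * q powi r)) has_sum R w) (-{k})"
      unfolding R_def using sm w(1) by (intro has_sum_infsum) blast
    hence "((\<lambda>r. a r / (1 - w * q powi r)) has_sum (a k / (1 - w * q powi k) + R w)) (insert k (-{k}))"
      by (intro has_sum_insert) auto
    hence "appell_sum a q w = a k / (1 - w * q powi k) + R w"
      unfolding appell_sum_def by (intro infsumI) (simp only: U)
    thus "a k + (1 - w * q powi k) * R w = (1 - w * q powi k) * appell_sum a q w"
      using \<open>w * q powi k \<noteq> 1\<close> by (simp add: field_simps)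
  qed (use d in auto)
qed

section \<open>The partial fraction expansion of the universal mock theta function\<close>

text \<open>The partial fraction expansion of 1/((x;q)_(n+1) (q/x;q)_n), with simple poles at x =
  q^(-r) for |r| <= n.\<close>

definition pfin :: "nat \<Rightarrow> complex \<Rightarrow> complex" where
  "pfin n x = (\<Sum>\<^sub>\<infinity>r. theta_coeff q q r * rqq (int n) r / (1 - x * q powi r))"

lemma pfin_0: "pfin 0 x = 1 / (1 - x)"
proof -
  have "pfin 0 x = (\<Sum>\<^sub>\<infinity>r\<in>{0}. theta_coeff q q r * rqq (int 0) r / (1 - x * q powi r))"
    unfolding pfin_def by (rule infsum_cong_neutral) (auto simp: rqq_eq_0)
  thus ?thesis by (simp add: rqq_def)
qed

lemma theta_coeff_q_powi: "theta_coeff q q r * q powi (- r) = theta_coeff q 1 r"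
  using theta_coeff_mult_powi[of 1 1 r] q_nz by (simp add: power_int_minus)

text \<open>The finite triple product contains the factor 1 - x, and here x = 1.\<close>

lemma rqq_sum_1: "(\<Sum>\<^sub>\<infinity>r. theta_coeff q 1 r * rqq (int (Suc n)) r) = 0"
proof -
  have "jfin (Suc n) 1 = 0"
    by (subst jfin_eq) (auto simp: qpoch_Suc')
  thus ?thesis by (simp add: jfin_def)
qed

text \<open>The summand is odd under r -> -1 - r.\<close>

lemma rqq_sum_q: "(\<Sum>\<^sub>\<infinity>r. theta_coeff q q r * (rq (int n - r) * rq (int n + 1 + r))) = 0" (is "?S = 0")
proof -
  have "?S = (\<Sum>\<^sub>\<infinity>r. theta_coeff q q (-1 - r) * (rq (int n - (-1 - r)) * rq (int n + 1 + (-1 - r))))"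
    by (rule infsum_int_reflect[of _ "-1", symmetric])
  also have "\<dots> = (\<Sum>\<^sub>\<infinity>r. - (theta_coeff q q r * (rq (int n - r) * rq (int n + 1 + r))))"
    by (intro infsum_cong) (simp add: theta_coeff_reflect algebra_simps)
  also have "\<dots> = - ?S" by (rule infsum_uminus)
  finally show ?thesis by simp
qed

text \<open>After multiplication by the two new factors, division by 1 - x q^r leaves the summand
  for n and two parts without a pole. Their sums are the vanishing ones of \<open>rqq_sum_1\<close>
  and \<open>rqq_sum_q\<close>.\<close>

lemma pfin_Suc:
  assumes "x \<noteq> 0" "jtheta x q \<noteq> 0"
  shows "(1 - x * q ^ Suc n) * (1 - q ^ Suc n / x) * pfin (Suc n) x = pfin n x"
proof -
  define N where "N = int (Suc n)"
  have N: "q ^ Suc n = q powi N" unfolding N_def by (simp only: power_int_of_nat)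
  have nz: "1 - x * q powi r \<noteq> 0" for r using assms jtheta_nz_iff by auto
  have s1: "(\<lambda>r. theta_coeff q 1 r * rqq N r) summable_on UNIV"
    by (rule summable_on_rqq[of N]) auto
  have r0: "rq (N - 1 - r) * rq (N + r) = (1 - q powi (N - r)) * rqq N r" for r
    using rq_pred[of "N - r"] diff_diff_eq[of N r 1] diff_diff_eq[of N 1 r] add.commute[of 1 r] unfolding rqq_def by (simp only: mult.assoc)
  have r1: "rqq (N - 1) r = (1 - q powi (N + r)) * (rq (N - 1 - r) * rq (N + r))" for r
    using rq_pred[of "N + r"] diff_add_eq[of N 1 r] unfolding rqq_def
    by (simp only: mult.left_commute)
  have s2: "(\<lambda>r. theta_coeff q q r * (rq (N - 1 - r) * rq (N + r))) summable_on UNIV"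
    by (rule summable_on_rqq[of N]) (auto simp: r0)
  have s3: "(\<lambda>r. theta_coeff q q r * rqq (N - 1) r / (1 - x * q powi r)) summable_on UNIV"
    by (rule summable_on_rqq[of N]) (auto simp: r0 r1)
  have z1: "(\<Sum>\<^sub>\<infinity>r. theta_coeff q 1 r * rqq N r) = 0" unfolding N_def by (rule rqq_sum_1)
  have z2: "(\<Sum>\<^sub>\<infinity>r. theta_coeff q q r * (rq (N - 1 - r) * rq (N + r))) = 0"
    using rqq_sum_q[of n] by (simp add: N_def add_ac)
  have "(1 - x * q ^ Suc n) * (1 - q ^ Suc n / x) * pfin (Suc n) x =
     (\<Sum>\<^sub>\<infinity>r. (1 - x * q ^ Suc n) * (1 - q ^ Suc n / x) * (theta_coeff q q r * rqq N r / (1 - x * q powi r)))"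
    unfolding pfin_def N_def by (rule infsum_cmult_right'[symmetric])
  also have "\<dots> = (\<Sum>\<^sub>\<infinity>r. (1 - q powi N / x) * q powi N * (theta_coeff q 1 r * rqq N r)
       - q powi N / x * (theta_coeff q q r * (rq (N - 1 - r) * rq (N + r)))
       + theta_coeff q q r * rqq (N - 1) r / (1 - x * q powi r))"
  proof (rule infsum_cong)
    fix r :: int
    define Q p t b where "Q = q powi N" and "p = q powi r" and "t = theta_coeff q q r" and "b = rqq N r"
    have p: "p \<noteq> 0" using q_nz by (simp add: p_def)
    have t: "theta_coeff q 1 r = t / p"
      using theta_coeff_q_powi[of r] by (simp add: t_def p_def power_int_minus divide_inverse)
    have e: "q powi (N - r) = Q / p" "q powi (N + r) = Q * p"
      using q_nz by (simp_all add: Q_def p_def power_int_diff power_int_add)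
    have nz': "1 - x * p \<noteq> 0" using nz by (simp add: p_def)
    have "(1 - x * Q) * (1 - Q / x) * (t * b / (1 - x * p)) =
       (1 - Q / x) * Q * (t / p * b) - Q / x * (t * ((1 - Q / p) * b))
       + t * ((1 - Q * p) * ((1 - Q / p) * b)) / (1 - x * p)"
      using p nz' assms(1) by (simp add: divide_simps) (simp add: algebra_simps)
    thus "(1 - x * q ^ Suc n) * (1 - q ^ Suc n / x) * (theta_coeff q q r * rqq N r / (1 - x * q powi r)) =
       (1 - q powi N / x) * q powi N * (theta_coeff q 1 r * rqq N r)
       - q powi N / x * (theta_coeff q q r * (rq (N - 1 - r) * rq (N + r)))
       + theta_coeff q q r * rqq (N - 1) r / (1 - x * q powi r)"
      unfolding N r1 r0 t e by (simp add: Q_def p_def t_def b_def)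
  qed
  also have "\<dots> = (\<Sum>\<^sub>\<infinity>r. theta_coeff q q r * rqq (N - 1) r / (1 - x * q powi r))"
    using infsumI[OF has_sum_add[OF has_sum_diff[OF
          has_sum_cmult_right[OF has_sum_infsum[OF s1], of "(1 - q powi N / x) * q powi N"]
          has_sum_cmult_right[OF has_sum_infsum[OF s2], of "q powi N / x"]]
          has_sum_infsum[OF s3]]]
    unfolding z1 z2 by simp
  also have "\<dots> = pfin n x" by (simp add: pfin_def N_def)
  finally show ?thesis .
qed

lemma pfin_eq:
  assumes "x \<noteq> 0" "jtheta x q \<noteq> 0"
  shows "pfin n x = 1 / (qpoch x q (n + 1) * qpoch (q / x) q n)"
proof (induction n)
  case 0
  show ?case by (simp add: pfin_0 qpoch_Suc)
next
  case (Suc n)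
  have nz: "1 - x * q powi r \<noteq> 0" for r using assms jtheta_nz_iff by auto
  have 1: "1 - x * q ^ Suc n \<noteq> 0" using nz[of "int (Suc n)"] unfolding power_int_of_nat .
  have "1 - x * q powi (- int (Suc n)) \<noteq> 0" by (rule nz)
  hence "x \<noteq> q ^ Suc n"
    unfolding power_int_minus power_int_of_nat using q_nz
    by (metis diff_self power_not_zero right_inverse)
  hence 2: "1 - q ^ Suc n / x \<noteq> 0"
    using assms(1) by (auto simp del: power_Suc)
  have "pfin (Suc n) x = pfin n x / ((1 - x * q ^ Suc n) * (1 - q ^ Suc n / x))"
    using pfin_Suc[OF assms, of n] 1 2 by (subst nonzero_eq_divide_eq) (simp_all add: mult.commute)
  thus ?case unfolding Suc by (simp add: qpoch_Suc mult_ac)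
qed

text \<open>Combinatorially, partitions sorted by their Durfee rectangle. Analytically, the
  differences d of the sums for s and s + 1 satisfy d(s) = -q^(s+1) d(s+1) and are bounded, so they
  vanish; the common value is the limit for large s, where only m = 0 survives.\<close>

lemma durfee_rectangle:
  "(\<Sum>\<^sub>\<infinity>m. q ^ (m ^ 2 + m * s) * rq (int m) * rq (int (m + s))) = 1 / J"
proof -
  obtain C where C: "C > 0" "\<And>k. norm (rq k) \<le> C" using rq_bounded by blast
  define t where "t = (\<lambda>s m. q ^ (m ^ 2 + m * s) * rq (int m) * rq (int (m + s)))"
  define f where "f = (\<lambda>s. \<Sum>\<^sub>\<infinity>m. t s m)"
  have g1: "summable (\<lambda>m. norm q ^ m * (C * C))"
    using q_lt1 by (intro summable_mult2 summable_geometric) auto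
  have g: "(\<lambda>m. norm q ^ m * (C * C)) summable_on UNIV"
    by (rule norm_summable_imp_summable_on) (use g1 in \<open>auto simp: norm_mult norm_power\<close>)
  have bd: "norm (t s m) \<le> norm q ^ m * (C * C)" for s m
  proof -
    have "m \<le> m ^ 2 + m * s" using self_le_power[of m 2] by (cases m) auto
    hence "norm q ^ (m ^ 2 + m * s) \<le> norm q ^ m"
      using q_lt1 by (intro power_decreasing) auto
    thus ?thesis unfolding t_def norm_mult norm_power mult.assoc
      using C by (intro mult_mono) auto
  qed
  have ts: "t s summable_on UNIV" for s
    by (rule abs_summable_summable[OF Infinite_Sum.abs_summable_on_comparison_test'[OF g]]) (rule bd)
  have shift: "(\<Sum>\<^sub>\<infinity>m. h (Suc m)) = (\<Sum>\<^sub>\<infinity>m. h m)" if "h 0 = 0" for h :: "nat \<Rightarrow> complex"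
  proof -
    have "(\<Sum>\<^sub>\<infinity>m. h (Suc m)) = infsum h (range Suc)"
      by (subst infsum_reindex) (auto simp: o_def)
    also have "\<dots> = infsum h UNIV"
    proof (rule infsum_cong_neutral)
      fix n assume "n \<in> UNIV - range Suc"
      hence "n = 0" by (cases n) auto
      thus "h n = 0" using that by simp
    qed auto
    finally show ?thesis .
  qed
  define d where "d = (\<lambda>s. f s - f (Suc s))"
  have d_rec: "d s = - (q ^ Suc s) * d (Suc s)" for s
  proof -
    \<comment> \<open>The factor 1 - q^m cancels against \<open>rq\<close> when m is lowered by one,
      which turns this part of the difference into terms for s + 2.\<close>
    define h where "h = (\<lambda>m. q ^ (m ^ 2 + m * s) * ((1 - q ^ m) * rq (int m)) * rq (int (m + Suc s)))"
    have dec: "t s m - t (Suc s) m = h m - q ^ Suc s * t (Suc s) m" for m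
    proof -
      have r: "rq (int (m + s)) = (1 - q ^ (m + Suc s)) * rq (int (m + Suc s))"
        using rq_pred[of "int (m + Suc s)"] unfolding power_int_of_nat by simp
      show ?thesis unfolding t_def h_def r
        by (simp add: algebra_simps power_add)
    qed
    have hS: "h (Suc m) = q ^ Suc s * t (Suc (Suc s)) m" for m
    proof -
      have r: "(1 - q ^ Suc m) * rq (int (Suc m)) = rq (int m)"
        using rq_pred[of "int (Suc m)"] unfolding power_int_of_nat by simp
      have e: "(Suc m)\<^sup>2 + Suc m * s = Suc s + (m\<^sup>2 + m * Suc (Suc s))"
        by (simp add: power2_eq_square)
      show ?thesis unfolding h_def r t_def e
        by (simp add: power_add mult_ac add_ac)
    qed
    have "(\<Sum>\<^sub>\<infinity>m. h m) = (\<Sum>\<^sub>\<infinity>m. h (Suc m))" by (rule shift[symmetric]) (simp add: h_def)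
    also have "\<dots> = q ^ Suc s * f (Suc (Suc s))"
      unfolding hS f_def by (rule infsum_cmult_right')
    finally have hsum: "(\<Sum>\<^sub>\<infinity>m. h m) = q ^ Suc s * f (Suc (Suc s))" .
    have "h = (\<lambda>m. t s m - t (Suc s) m + q ^ Suc s * t (Suc s) m)" using dec by (auto simp: fun_eq_iff)
    hence hs: "h summable_on UNIV"
      using ts by (auto intro!: summable_on_add summable_on_diff summable_on_cmult_right)
    have "d s = (\<Sum>\<^sub>\<infinity>m. t s m - t (Suc s) m)"
      unfolding d_def f_def using ts by (simp add: infsum_diff)
    also have "\<dots> = (\<Sum>\<^sub>\<infinity>m. h m) - q ^ Suc s * f (Suc s)"
      unfolding dec f_def using ts hs
      by (simp add: infsum_diff summable_on_cmult_right infsum_cmult_right' del: power_Suc)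
    finally show ?thesis unfolding hsum by (simp add: d_def algebra_simps)
  qed
  define B where "B = (\<Sum>\<^sub>\<infinity>m. norm q ^ m * (C * C))"
  have fB: "norm (f s) \<le> B" for s
    unfolding f_def B_def
    by (rule norm_infsum_le[OF has_sum_infsum[OF ts] has_sum_infsum[OF g]]) (rule bd)
  have d_iter: "norm (d s) \<le> norm q ^ k * (2 * B)" for s k
  proof (induction k arbitrary: s)
    case 0
    show ?case unfolding d_def using norm_triangle_ineq4[of "f s" "f (Suc s)"] fB[of s] fB[of "Suc s"] by simp
  next
    case (Suc k)
    have "norm (d s) = norm q ^ Suc s * norm (d (Suc s))"
      by (subst d_rec) (simp add: norm_mult norm_power)
    also have "\<dots> \<le> norm q ^ 1 * (norm q ^ k * (2 * B))"
      using q_lt1 by (intro mult_mono Suc power_decreasing) auto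
    finally show ?case by (simp add: mult_ac)
  qed
  have "d s = 0" for s
  proof -
    have "(\<lambda>k. norm q ^ k * (2 * B)) \<longlonglongrightarrow> 0 * (2 * B)"
      using q_lt1 by (intro tendsto_intros LIMSEQ_power_zero) auto
    hence "norm (d s) \<le> 0 * (2 * B)"
      by (rule Lim_bounded2) (use d_iter in auto)
    thus ?thesis by simp
  qed
  hence const: "f s = f 0" for s by (induction s) (auto simp: d_def)
  have "f \<longlonglongrightarrow> (\<Sum>\<^sub>\<infinity>m. if m = (0::nat) then 1 / J else 0)"
    unfolding f_def
  proof (rule tendsto_infsum_dominated[OF _ bd g])
    fix m :: nat
    show "(\<lambda>s. t s m) \<longlonglongrightarrow> (if m = 0 then 1 / J else 0)"
    proof (cases "m = 0")
      case True
      thus ?thesis using rq_tendsto[of 0] by (simp add: t_def)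
    next
      case False
      have 1: "(\<lambda>s. (q ^ m) ^ s) \<longlonglongrightarrow> 0"
        using nome.q_lt1[OF nome_power[of m]] False by (intro LIMSEQ_power_zero) auto
      have "(\<lambda>s. q ^ m\<^sup>2 * (q ^ m) ^ s * rq (int m) * rq (int s + int m)) \<longlonglongrightarrow> q ^ m\<^sup>2 * 0 * rq (int m) * (1 / J)"
        by (intro tendsto_intros 1 rq_tendsto)
      thus ?thesis using False by (simp add: t_def power_add power_mult add.commute[of "int m"] mult.assoc)
    qed
  qed
  also have "(\<Sum>\<^sub>\<infinity>m. if m = (0::nat) then 1 / J else 0) = (\<Sum>\<^sub>\<infinity>m\<in>{0::nat}. 1 / J)"
    by (rule infsum_cong_neutral) auto
  finally have "f \<longlonglongrightarrow> 1 / J" by simp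
  moreover have "f = (\<lambda>_. f s)" using const by metis
  hence "f \<longlonglongrightarrow> f s" using tendsto_const[of "f s"] by metis
  ultimately have "f s = 1 / J" using LIMSEQ_unique by blast
  thus ?thesis unfolding f_def t_def .
qed

text \<open>Terms with n < |r| vanish, and n = m + |r| gives (m + |r|)^2 = r^2 + m^2 + 2 m |r|,
  hence \<open>durfee_rectangle\<close> with s = 2|r|. This is the limiting case of Bailey's
  lemma.\<close>

lemma rqq_gauss_sum:
  "(\<Sum>\<^sub>\<infinity>n. q ^ (n ^ 2) * rqq (int n) r) = q ^ (nat \<bar>r\<bar> ^ 2) / J"
proof -
  define k where "k = nat \<bar>r\<bar>"
  have sym: "rqq (int n) r = rqq (int n) (int k)" for n
    by (cases "r \<ge> 0") (auto simp: k_def rqq_def mult_ac)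
  have "(\<Sum>\<^sub>\<infinity>n. q ^ (n ^ 2) * rqq (int n) r) = (\<Sum>\<^sub>\<infinity>n\<in>range (\<lambda>m. m + k). q ^ (n ^ 2) * rqq (int n) (int k))"
    unfolding sym
  proof (rule infsum_cong_neutral)
    fix n assume "n \<in> UNIV - range (\<lambda>m. m + k)"
    hence "n < k" by (metis DiffD2 add.commute le_Suc_ex not_less rangeI)
    thus "q ^ n\<^sup>2 * rqq (int n) (int k) = 0" by (simp add: rqq_eq_0)
  qed auto
  also have "\<dots> = (\<Sum>\<^sub>\<infinity>m. q ^ ((m + k) ^ 2) * rqq (int (m + k)) (int k))"
    by (subst infsum_reindex) (auto simp: o_def inj_on_def)
  also have "\<dots> = (\<Sum>\<^sub>\<infinity>m. q ^ (k ^ 2) * (q ^ (m ^ 2 + m * (2 * k)) * rq (int m) * rq (int (m + 2 * k))))"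
  proof (rule infsum_cong)
    fix m :: nat
    have "(m + k)\<^sup>2 = k ^ 2 + (m ^ 2 + m * (2 * k))" by (simp add: power2_eq_square algebra_simps)
    thus "q ^ (m + k)\<^sup>2 * rqq (int (m + k)) (int k) =
      q ^ k\<^sup>2 * (q ^ (m\<^sup>2 + m * (2 * k)) * rq (int m) * rq (int (m + 2 * k)))"
      by (simp add: rqq_def power_add mult_ac add_ac)
  qed
  also have "\<dots> = q ^ (k ^ 2) / J" unfolding infsum_cmult_right' durfee_rectangle by simp
  finally show ?thesis by (simp add: k_def)
qed

text \<open>This is \<open>\<Sum>\<^sub>r (-1)\<^sup>r q\<^bsup>3r(r+1)/2\<^esup> / (1 - x q\<^sup>r)\<close>.\<close>

definition level3 :: "complex \<Rightarrow> complex" where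
  "level3 x = appell_sum (theta_coeff (q ^ 3) (q ^ 2)) q x"

lemma nome_3: "nome (q ^ 3)" by (rule nome_power) simp

text \<open>The Gaussian weight raises the exponent r(r+1)/2 to r(3r+1)/2, whose quadratic part
  belongs to a theta series in base q^3.\<close>

lemma level3_coeff: "theta_coeff q q r * q ^ (nat \<bar>r\<bar> ^ 2) = theta_coeff (q ^ 3) (q ^ 2) r"
proof -
  have "even (r * (r - 1))" by simp
  then obtain s where s: "r * (r - 1) = 2 * s" by (rule evenE)
  hence sq: "r ^ 2 = 2 * s + r" by (simp only: power2_eq_square right_diff_distrib)
  have "int (nat \<bar>r\<bar> ^ 2) = r ^ 2" by simp
  hence "int (nat \<bar>r\<bar> ^ 2) = 2 * s + r" unfolding sq .
  hence 1: "q ^ (nat \<bar>r\<bar> ^ 2) = q powi (2 * s + r)" by (metis power_int_of_nat)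
  have 2: "(q ^ 3) powi s = q powi (3 * s)" "(q ^ 2) powi r = q powi (2 * r)"
    using power_int_mult[of q 3 s] power_int_mult[of q 2 r] by (simp_all only: power_int_numeral)
  have d: "r * (r - 1) div 2 = s" unfolding s by simp
  have "q powi (s + r + (2 * s + r)) = q powi (3 * s + 2 * r)" by (rule arg_cong[of _ _ "power_int q"]) simp
  hence "q powi s * q powi r * q powi (2 * s + r) = q powi (3 * s) * q powi (2 * r)"
    unfolding power_int_add[OF disjI1[OF q_nz]] .
  thus ?thesis
    unfolding theta_coeff_def d 1 2 by (simp only: mult.assoc)
qed

text \<open>Each summand is replaced by its partial fractions \<open>pfin\<close> and the two sums
  are exchanged; the sum over n is then \<open>rqq_gauss_sum\<close>. The majorant separates into
  |q|^n and the coefficients of j(q; q).\<close>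

theorem universal_mock_theta_level3:
  assumes "x \<noteq> 0" "jtheta x q \<noteq> 0"
  shows "((\<lambda>n. q ^ (n ^ 2) / (qpoch x q (n + 1) * qpoch (q / x) q n)) has_sum level3 x / J) UNIV"
proof -
  obtain C where C: "C > 0" "\<And>k. norm (rq k) \<le> C" using rq_bounded by blast
  obtain c where c: "c > 0" "\<And>r. c \<le> norm (1 - x * q powi r)"
    using one_minus_powi_bounded_below[OF assms(1)] assms jtheta_nz_iff
    by (metis centre_in_cball less_eq_real_def)
  define F where "F = (\<lambda>(n::nat, r::int). q ^ (n ^ 2) * (theta_coeff q q r * rqq (int n) r / (1 - x * q powi r)))"
  have bd: "norm (F (n, r)) \<le> norm q ^ n * (norm (theta_coeff q q r) * (C * C / c))" for n r
  proof -
    have 1: "norm q ^ (n\<^sup>2) \<le> norm q ^ n"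
      using q_lt1 by (intro power_decreasing) (auto simp: power2_eq_square)
    have 2: "norm (rqq (int n) r) \<le> C * C"
      unfolding rqq_def norm_mult using C by (intro mult_mono) auto
    have 3: "norm (rqq (int n) r) / norm (1 - x * q powi r) \<le> C * C / c"
      using 2 c C by (intro frac_le) auto
    have "norm (F (n, r)) = norm q ^ (n\<^sup>2) * (norm (theta_coeff q q r) * (norm (rqq (int n) r) / norm (1 - x * q powi r)))"
      by (simp add: F_def norm_mult norm_divide norm_power)
    also have "\<dots> \<le> norm q ^ n * (norm (theta_coeff q q r) * (C * C / c))"
      using 1 3 by (intro mult_mono mult_left_mono) auto
    finally show ?thesis .
  qed
  have s1: "(\<lambda>n. norm q ^ n) summable_on (UNIV :: nat set)"
    using q_lt1 by (subst summable_on_UNIV_nonneg_real_iff) (auto intro!: summable_geometric)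
  have s2: "(\<lambda>r. norm (theta_coeff q q r) * (C * C / c)) summable_on UNIV"
    using theta_coeff_abs_summable q_nz by (intro summable_on_cmult_left) auto
  have "(\<lambda>(n::nat, r). norm q ^ n * (norm (theta_coeff q q r) * (C * C / c))) summable_on (UNIV \<times> UNIV)"
  proof (rule summable_on_SigmaI)
    fix n :: nat
    show "((\<lambda>r. case (n, r) of (n, r) \<Rightarrow> norm q ^ n * (norm (theta_coeff q q r) * (C * C / c))) has_sum
       norm q ^ n * (\<Sum>\<^sub>\<infinity>r. norm (theta_coeff q q r) * (C * C / c))) UNIV"
      using has_sum_cmult_right[OF has_sum_infsum[OF s2]] by simp
  qed (use s1 C c in \<open>auto intro!: summable_on_cmult_left\<close>)
  hence sF: "F summable_on (UNIV \<times> UNIV)"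
    by (rule abs_summable_summable[OF Infinite_Sum.abs_summable_on_comparison_test'])
      (use bd in auto)
  have eq1: "(\<Sum>\<^sub>\<infinity>r. F (n, r)) = q ^ (n ^ 2) / (qpoch x q (n + 1) * qpoch (q / x) q n)" for n
    unfolding F_def prod.case infsum_cmult_right' pfin_def[symmetric] pfin_eq[OF assms] by simp
  have eq2: "(\<Sum>\<^sub>\<infinity>n. F (n, r)) = theta_coeff (q ^ 3) (q ^ 2) r / (1 - x * q powi r) * (1 / J)" for r
  proof -
    have "(\<Sum>\<^sub>\<infinity>n. F (n, r)) = (\<Sum>\<^sub>\<infinity>n. theta_coeff q q r / (1 - x * q powi r) * (q ^ (n ^ 2) * rqq (int n) r))"
      by (intro infsum_cong) (simp add: F_def)
    also have "\<dots> = theta_coeff q q r / (1 - x * q powi r) * (q ^ (nat \<bar>r\<bar> ^ 2) / J)"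
      by (simp add: infsum_cmult_right' rqq_gauss_sum del: times_divide_eq_left times_divide_eq_right)
    finally show ?thesis by (simp flip: level3_coeff)
  qed
  have Fs: "(F has_sum infsum F (UNIV \<times> UNIV)) (UNIV \<times> UNIV)" using sF by (rule has_sum_infsum)
  have Fn: "(\<lambda>r. F (n, r)) summable_on UNIV" for n
    using summable_on_SigmaD1[of "\<lambda>n r. F (n, r)" UNIV "\<lambda>_. UNIV" n] sF by (simp add: case_prod_unfold)
  have "((\<lambda>n. \<Sum>\<^sub>\<infinity>r. F (n, r)) has_sum infsum F (UNIV \<times> UNIV)) UNIV"
    by (rule has_sum_SigmaD[OF Fs]) (rule has_sum_infsum[OF Fn])
  moreover have "infsum F (UNIV \<times> UNIV) = (\<Sum>\<^sub>\<infinity>r. \<Sum>\<^sub>\<infinity>n. F (n, r))"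
    using infsum_swap_banach[of "\<lambda>n r. F (n, r)" UNIV UNIV] infsum_Sigma_banach[OF sF] sF
    by (simp add: case_prod_unfold)
  moreover have "\<dots> = level3 x / J"
    unfolding eq2 level3_def appell_sum_def by (subst infsum_cmult_left') simp
  ultimately show ?thesis unfolding eq1 by simp
qed

lemma mock_g_level3:
  assumes "x \<noteq> 0" "jtheta x q \<noteq> 0"
  shows "x * mock_g x q = level3 x / J - 1"
  using sums_unique[OF has_sum_imp_sums[OF universal_mock_theta_level3[OF assms]]] assms
  by (simp add: mock_g_def)

end

context nome
begin

section \<open>Partial fractions of quasi-periodic functions\<close>

text \<open>After multiplication by a power of x the function stays bounded near 0, so it extends
  there. Its Taylor coefficients are then multiplied by q^n on one side and by a constant that is no
  power of q on the other.\<close>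

lemma quasi_periodic_holomorphic_eq_0:
  assumes hol: "H holomorphic_on -{0}" and per: "\<And>x. x \<noteq> 0 \<Longrightarrow> H (q * x) = c * H x"
    and c: "c \<noteq> 0" "jtheta c q \<noteq> 0" and x: "x \<noteq> 0"
  shows "H x = 0"
proof -
  \<comment> \<open>Chosen such that x^N H has a multiplier c q^N of modulus at most 1; bounds then
    propagate from an annulus towards 0.\<close>
  obtain N where N: "norm q ^ N < 1 / norm c"
    using real_arch_pow_inv[of "1 / norm c" "norm q"] q_lt1 c by auto
  define G where "G = (\<lambda>x. x ^ N * H x)"
  define c' where "c' = c * q ^ N"
  have c'1: "norm c' \<le> 1"
    using N c by (simp add: c'_def norm_mult norm_power field_simps)
  have holG: "G holomorphic_on -{0}" unfolding G_def by (intro holomorphic_intros hol)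
  have perG: "G (q * x) = c' * G x" if "x \<noteq> 0" for x
    using per[OF that] by (simp add: G_def c'_def power_mult_distrib)
  \<comment> \<open>A compact annulus that meets every orbit under multiplication by q.\<close>
  define K where "K = cball 0 1 - ball 0 (norm q) \<inter> (UNIV :: complex set)"
  have "compact K" unfolding K_def by (simp add: compact_diff)
  moreover have "continuous_on K G"
    by (rule continuous_on_subset[OF holomorphic_on_imp_continuous_on[OF holG]])
      (use norm_q_pos in \<open>auto simp: K_def\<close>)
  ultimately have "bounded (G ` K)" by (intro compact_imp_bounded compact_continuous_image)
  then obtain B where B: "\<And>x. x \<in> K \<Longrightarrow> norm (G x) \<le> B" by (auto simp: bounded_iff)
  have bound: "norm (G x) \<le> B" if "norm q ^ n \<le> norm x" "norm x \<le> 1" for n x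
    using that
  proof (induction n arbitrary: x)
    case 0
    thus ?case using q_lt1 by (intro B) (auto simp: K_def)
  next
    case (Suc n)
    show ?case
    proof (cases "norm q \<le> norm x")
      case True
      thus ?thesis using Suc by (intro B) (auto simp: K_def)
    next
      case False
      have "x \<noteq> 0" using Suc.prems(1) norm_q_pos by (metis norm_zero not_le zero_less_power)
      have "norm (G (x / q)) \<le> B"
        using Suc.prems False norm_q_pos by (intro Suc.IH) (auto simp: norm_divide field_simps)
      moreover have "G x = c' * G (x / q)" using perG[of "x / q"] \<open>x \<noteq> 0\<close> q_nz by simp
      ultimately show ?thesis
        using c'1 by (simp add: norm_mult) (metis mult_left_le_one_le norm_ge_zero order_trans)
    qed
  qed
  have bound': "norm (G x) \<le> B" if x: "x \<noteq> 0" "norm x < 1" for x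
  proof -
    obtain n where "norm q ^ n < norm x"
      using real_arch_pow_inv[of "norm x" "norm q"] q_lt1 x by auto
    thus ?thesis using x by (intro bound[of n]) auto
  qed
  have "\<exists>g. g holomorphic_on ball 0 1 \<and> (\<forall>x\<in>ball 0 1 - {0}. g x = G x)"
  proof (subst holomorphic_on_extend_bounded)
    show "G holomorphic_on ball 0 1 - {0}" using holG by (rule holomorphic_on_subset) auto
    show "\<exists>B. \<forall>\<^sub>F x in at 0. norm (G x) \<le> B"
      unfolding eventually_at using bound' by (intro exI[of _ B] exI[of _ 1]) auto
  qed auto
  then obtain g where g: "g holomorphic_on ball 0 1" "\<And>x. x \<in> ball 0 1 - {0} \<Longrightarrow> g x = G x" by blast
  have qball: "q * x \<in> ball 0 1" if "x \<in> ball 0 1" for x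
  proof -
    have "norm q * norm x \<le> 1 * norm x" using q_lt1 by (intro mult_right_mono) auto
    thus ?thesis using that by (simp add: norm_mult)
  qed
  have gc: "isCont g 0" using g(1)
    by (metis centre_in_ball continuous_on_eq_continuous_at holomorphic_on_imp_continuous_on open_ball zero_less_one)
  have per_nz: "g (q * x) = c' * g x" if "x \<in> ball 0 1" "x \<noteq> 0" for x
  proof -
    have "g (q * x) = G (q * x)" using qball[OF that(1)] that(2) q_nz by (intro g(2)) auto
    also have "\<dots> = c' * G x" by (rule perG[OF that(2)])
    also have "G x = g x" using that by (intro g(2)[symmetric]) auto
    finally show ?thesis .
  qed
  have l1: "((\<lambda>x. g (q * x)) \<longlongrightarrow> g (q * 0)) (at 0)"
    using gc by (intro isCont_tendsto_compose[of _ g] tendsto_intros) auto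
  have l2: "((\<lambda>x. c' * g x) \<longlongrightarrow> c' * g 0) (at 0)"
    using gc by (intro tendsto_intros) (simp add: isCont_def)
  have "\<forall>\<^sub>F x in at 0. g (q * x) = c' * g x"
    unfolding eventually_at using per_nz by (intro exI[of _ 1]) auto
  with l1 have "((\<lambda>x. c' * g x) \<longlongrightarrow> g (q * 0)) (at 0)"
    by (rule Lim_transform_eventually)
  with l2 have "g (q * 0) = c' * g 0" by (metis LIM_unique)
  hence perg: "g (q * x) = c' * g x" if "x \<in> ball 0 1" for x using per_nz[OF that] by (cases "x = 0") auto
  \<comment> \<open>Differentiating g(qx) = c' g(x) n times at 0 leaves c' = q^n as the only
    alternative, and this would make c a power of q.\<close>
  have d0: "(deriv ^^ n) g 0 = 0" for n
  proof -
    have "(deriv ^^ n) (\<lambda>x. g (q * x)) 0 = q ^ n * (deriv ^^ n) g (q * 0)"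
      using qball by (intro higher_deriv_compose_linear[OF g(1), of "ball 0 1"]) auto
    moreover have "(deriv ^^ n) (\<lambda>x. g (q * x)) 0 = (deriv ^^ n) (\<lambda>x. c' * g x) 0"
    proof (rule higher_deriv_transform_within_open)
      show "(\<lambda>x. g (q * x)) holomorphic_on ball 0 1"
      proof -
        have "(\<lambda>x. q * x) holomorphic_on ball 0 1" by (intro holomorphic_intros)
        moreover have "(\<lambda>x. q * x) ` ball 0 1 \<subseteq> ball 0 1" using qball by blast
        ultimately show ?thesis using holomorphic_on_compose_gen[OF _ g(1)] by (simp add: o_def)
      qed
    qed (use g perg in \<open>auto intro!: holomorphic_intros\<close>)
    moreover have "(deriv ^^ n) (\<lambda>x. c' * g x) 0 = c' * (deriv ^^ n) g 0"
      by (rule higher_deriv_cmult[OF g(1)]) auto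
    ultimately have "q ^ n * (deriv ^^ n) g 0 = c' * (deriv ^^ n) g 0" by (simp only: mult_zero_right)
    moreover have "c' \<noteq> q ^ n"
    proof
      assume "c' = q ^ n"
      hence "c = q powi (int n - int N)" using q_nz by (simp add: c'_def power_int_diff nonzero_eq_divide_eq)
      thus False using c jtheta_eq_0_iff by blast
    qed
    ultimately show ?thesis by simp
  qed
  have g0: "g x = 0" if "x \<in> ball 0 1" for x
    using holomorphic_fun_eq_0_on_ball[OF g(1) that d0] .
  have H0: "H y = 0" if "y \<noteq> 0" "norm y < 1" for y
    using g0[of y] g(2)[of y] that by (simp add: G_def)
  have iter: "H (q ^ n * x) = c ^ n * H x" for n
  proof (induction n)
    case (Suc n)
    thus ?case using per[of "q ^ n * x"] x q_nz by (simp add: mult_ac)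
  qed simp
  obtain n where "norm q ^ n < 1 / norm x"
    using real_arch_pow_inv[of "1 / norm x" "norm q"] q_lt1 x by auto
  hence "H (q ^ n * x) = 0" using x q_nz by (intro H0) (auto simp: norm_mult norm_power field_simps)
  thus ?thesis using iter[of n] c by simp
qed

text \<open>By the zeros of j, these are the nonzero points outside all orbits p_i q^k with integral
  k.\<close>

definition regular_points :: "'i set \<Rightarrow> ('i \<Rightarrow> complex) \<Rightarrow> complex set" where
  "regular_points I p = {x. x \<noteq> 0 \<and> (\<forall>i\<in>I. jtheta (x / p i) q \<noteq> 0)}"

lemma regular_points_powi:
  assumes "x \<in> regular_points I p" "\<And>i. i \<in> I \<Longrightarrow> p i \<noteq> 0"
  shows "q powi k * x \<in> regular_points I p"
  using assms jtheta_mult_powi_eq_0_iff[of "x / p _" k] q_nz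
  by (auto simp: regular_points_def mult.commute)

text \<open>The limit condition is given at one point of each orbit only; quasi-periodicity carries
  it to p_i q^k. All singularities are then removable, and the extension satisfies the hypotheses of
  \<open>quasi_periodic_holomorphic_eq_0\<close>.\<close>

lemma quasi_periodic_removable_eq_0:
  assumes I: "finite I" and p: "\<And>i. i \<in> I \<Longrightarrow> p i \<noteq> 0"
    and hol: "h holomorphic_on regular_points I p"
    and per: "\<And>x. x \<in> regular_points I p \<Longrightarrow> h (q * x) = c * h x"
    and lim: "\<And>i. i \<in> I \<Longrightarrow> ((\<lambda>x. (1 - x / p i) * h x) \<longlongrightarrow> 0) (at (p i))"
    and c: "c \<noteq> 0" "jtheta c q \<noteq> 0" and x: "x \<in> regular_points I p"
  shows "h x = 0"
proof -
  define D where "D = regular_points I p"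
  have Dq: "q powi k * y \<in> D" if "y \<in> D" for y k
    using regular_points_powi[of y I p k] p that by (simp add: D_def)
  have Dq1: "q * y \<in> D" if "y \<in> D" for y using Dq[OF that, of 1] by simp
  have per_n: "h (q ^ n * y) = c ^ n * h y" if "y \<in> D" for n y
  proof (induction n)
    case (Suc n)
    have "q ^ n * y \<in> D" using Dq[OF that, of "int n"] by simp
    from per[folded D_def, OF this] show ?case by (simp add: Suc mult.assoc)
  qed simp
  have per_k: "h (q powi k * y) = c powi k * h y" if "y \<in> D" for k y
  proof (cases "k \<ge> 0")
    case True
    thus ?thesis using per_n[OF that, of "nat k"] by (simp add: power_int_def)
  next
    case False
    then obtain n where n: "k = - int n" by (metis int_cases4 linorder_not_le nat_int_comparison(1) of_nat_0_le_iff)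
    have "h (q ^ n * (q powi k * y)) = c ^ n * h (q powi k * y)"
      by (rule per_n[OF Dq[OF that]])
    moreover have "q ^ n * (q powi k * y) = y" using n q_nz by (simp add: power_int_minus)
    ultimately show ?thesis using n c by (simp add: power_int_minus field_simps)
  qed
  \<comment> \<open>Exceptional points are isolated: they are the zeros of a product of theta
    functions that does not vanish at the given point x.\<close>
  have local_ext: "\<exists>r>0. \<exists>g. ball e r - {e} \<subseteq> D \<and> g holomorphic_on ball e r \<and> (\<forall>y\<in>ball e r - {e}. g y = h y)"
    if e: "e \<noteq> 0" "e \<notin> D" for e
  proof -
    obtain i where i: "i \<in> I" "jtheta (e / p i) q = 0" using e by (auto simp: D_def regular_points_def)
    have pi: "p i \<noteq> 0" using p i by simp
    obtain k where "e / p i = q powi k" using i jtheta_eq_0_iff[of "e / p i"] e pi by auto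
    hence k: "e = p i * q powi k" using pi by (simp add: field_simps)
    define F where "F = (\<lambda>x. \<Prod>i\<in>I. jtheta (x / p i) q)"
    have holF: "F holomorphic_on -{0}"
      unfolding F_def using p by (intro holomorphic_intros) auto
    have F0: "F y = 0 \<longleftrightarrow> y \<notin> D" if "y \<noteq> 0" for y
      using I that by (auto simp: F_def D_def regular_points_def)
    obtain r where r: "0 < r" "ball e r \<subseteq> -{0}" "\<And>z. z \<in> ball e r - {e} \<Longrightarrow> F z \<noteq> 0"
    proof (rule isolated_zeros[OF holF, of e x])
      show "connected (- {0 :: complex})" by (rule connected_punctured_universe) simp
      show "x \<in> -{0}" "F x \<noteq> 0" using x F0[of x] by (auto simp: D_def regular_points_def)
      show "F e = 0" using F0 e by simp
    qed (use e in auto)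
    have sub: "ball e r - {e} \<subseteq> D" using r F0 by blast
    have "((\<lambda>y. c powi k * ((1 - (q powi (-k) * y) / p i) * h (q powi (-k) * y))) \<longlongrightarrow> c powi k * 0) (at e)"
    proof (intro tendsto_intros filterlim_compose[OF lim[OF i(1)]])
      have ke: "q powi (-k) * e = p i" using k q_nz by (simp add: power_int_minus)
      show "LIM y at e. q powi (-k) * y :> at (p i)"
      proof (rule filterlim_atI)
        have "((\<lambda>y. q powi (-k) * y) \<longlongrightarrow> q powi (-k) * e) (at e)" by (intro tendsto_intros)
        thus "((\<lambda>y. q powi (-k) * y) \<longlongrightarrow> p i) (at e)" using ke by simp
        show "\<forall>\<^sub>F y in at e. q powi (-k) * y \<noteq> p i"
          using k q_nz by (auto simp: eventually_at power_int_minus field_simps intro!: exI[of _ 1])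
      qed
    qed
    moreover have "\<forall>\<^sub>F y in at e. - e * (c powi k * ((1 - (q powi (-k) * y) / p i) * h (q powi (-k) * y))) = (y - e) * h y"
      unfolding eventually_at
    proof (intro exI[of _ r] conjI ballI impI)
      fix y assume y: "y \<noteq> e \<and> dist y e < r"
      hence "y \<in> D" using sub by (auto simp: dist_commute)
      hence "h y = c powi k * h (q powi (-k) * y)"
      proof -
        have e: "q powi k * (q powi (-k) * y) = y" using q_nz by (simp add: power_int_minus)
        show ?thesis using per_k[OF Dq[OF \<open>y \<in> D\<close>, of "-k"], of k] unfolding e .
      qed
      moreover have "- e * (1 - (q powi (-k) * y) / p i) = y - e"
        using k pi q_nz by (simp add: power_int_minus field_simps)
      ultimately show "- e * (c powi k * ((1 - (q powi (-k) * y) / p i) * h (q powi (-k) * y))) = (y - e) * h y"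
        by (metis mult.assoc mult.left_commute)
    qed (use r in auto)
    ultimately have lim0: "((\<lambda>y. (y - e) * h y) \<longlongrightarrow> - e * (c powi k * 0)) (at e)"
      by (rule Lim_transform_eventually[OF tendsto_mult[OF tendsto_const[of "- e"]]])
    have "\<exists>g. g holomorphic_on ball e r \<and> (\<forall>y\<in>ball e r - {e}. g y = h y)"
    proof (subst holomorphic_on_extend_lim)
      show "h holomorphic_on ball e r - {e}"
        using hol sub unfolding D_def by (rule holomorphic_on_subset)
      show "((\<lambda>y. (y - e) * h y) \<longlongrightarrow> 0) (at e)" using lim0 by simp
    qed (use r in auto)
    thus ?thesis using r sub by blast
  qed
  have openD: "open D"
  proof -
    define F where "F = (\<lambda>x. \<Prod>i\<in>I. jtheta (x / p i) q)"
    have "D = - {0} \<inter> F -` (- {0})"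
      using I by (auto simp: D_def regular_points_def F_def)
    moreover have "continuous_on (-{0}) F"
      unfolding F_def using p by (intro holomorphic_on_imp_continuous_on holomorphic_intros) auto
    ultimately show ?thesis
      using continuous_open_preimage[of "- {0}" F "- {0}"] by (simp add: open_Compl)
  qed
  \<comment> \<open>The limit selects the value of whichever local extension exists, so that these
    extensions fit together.\<close>
  define H where "H = (\<lambda>x. if x \<in> D then h x else Lim (at x) h)"
  have diff: "H field_differentiable (at y)" if y0: "y \<noteq> 0" for y
  proof (cases "y \<in> D")
    case True
    have "H holomorphic_on D"
      using hol unfolding D_def[symmetric] by (rule holomorphic_transform) (simp add: H_def)
    thus ?thesis using openD True holomorphic_on_imp_differentiable_at by blast
  next
    case False
    obtain r g where r: "r > 0" "ball y r - {y} \<subseteq> D" "g holomorphic_on ball y r" "\<forall>z\<in>ball y r - {y}. g z = h z"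
      using local_ext[OF y0 False] by blast
    have "isCont g y" using r
      by (metis centre_in_ball continuous_on_eq_continuous_at holomorphic_on_imp_continuous_on open_ball)
    hence "(g \<longlongrightarrow> g y) (at y)" by (simp add: isCont_def)
    hence "(h \<longlongrightarrow> g y) (at y)"
      by (rule Lim_transform_within_open[of _ _ _ _ "ball y r"]) (use r in auto)
    hence "Lim (at y) h = g y" by (intro tendsto_Lim) auto
    hence "H z = g z" if "z \<in> ball y r" for z
      using r False that by (cases "z = y") (auto simp: H_def)
    hence "H holomorphic_on ball y r" by (intro holomorphic_transform[OF r(3)]) auto
    thus ?thesis using r(1) by (intro holomorphic_on_imp_differentiable_at[OF _ open_ball]) auto
  qed
  have holH: "H holomorphic_on -{0}"
    unfolding holomorphic_on_def using diff field_differentiable_at_within by blast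
  have contH: "isCont H y" if "y \<noteq> 0" for y
    using diff[OF that] by (rule field_differentiable_imp_continuous_at)
  have perH: "H (q * y) = c * H y" if y0: "y \<noteq> 0" for y
  proof (cases "y \<in> D")
    case True
    thus ?thesis using per Dq1[OF True] by (simp add: H_def D_def)
  next
    case False
    obtain r where r: "r > 0" "ball y r - {y} \<subseteq> D" using local_ext[OF y0 False] by blast
    have "((\<lambda>z. H (q * z) - c * H z) \<longlongrightarrow> H (q * y) - c * H y) (at y)"
      using contH[OF y0] contH[of "q * y"] y0 q_nz
      by (intro tendsto_intros isCont_tendsto_compose[of _ H]) (auto simp: isCont_def)
    moreover have "((\<lambda>z. H (q * z) - c * H z) \<longlongrightarrow> 0) (at y)"
    proof (rule Lim_transform_within_open[OF tendsto_const])
      fix z assume "z \<in> ball y r" "z \<noteq> y"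
      hence "z \<in> D" using r by auto
      thus "0 = H (q * z) - c * H z" using per Dq1 by (simp add: H_def D_def)
    qed (use r in auto)
    ultimately show ?thesis using tendsto_unique[of "at y"] by fastforce
  qed
  have "H x = 0"
    using x by (intro quasi_periodic_holomorphic_eq_0[OF holH perH c]) (auto simp: regular_points_def)
  thus ?thesis using x by (simp add: H_def D_def)
qed

text \<open>The theta quotient attached to p_i has multiplier c, is singular on the orbit of p_i
  alone, and is normalised by \<open>jtheta_simple_zero\<close> to the limit 1 at p_i. Subtracting
  these quotients with weights \<sigma> leaves a function that must vanish; c is kept off the powers
  of q both for this and for j(1/c) to be nonzero.\<close>

theorem quasi_periodic_partial_fractions:
  assumes I: "finite I" and p: "\<And>i. i \<in> I \<Longrightarrow> p i \<noteq> 0"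
    and dist: "\<And>i j. i \<in> I \<Longrightarrow> j \<in> I \<Longrightarrow> i \<noteq> j \<Longrightarrow> jtheta (p i / p j) q \<noteq> 0"
    and hol: "g holomorphic_on regular_points I p"
    and per: "\<And>x. x \<in> regular_points I p \<Longrightarrow> g (q * x) = c * g x"
    and lim: "\<And>i. i \<in> I \<Longrightarrow> ((\<lambda>x. (1 - x / p i) * g x) \<longlongrightarrow> \<sigma> i) (at (p i))"
    and c: "c \<noteq> 0" "jtheta c q \<noteq> 0" and x: "x \<in> regular_points I p"
  shows "g x = (\<Sum>i\<in>I. \<sigma> i * (J ^ 3 * jtheta (x / (c * p i)) q / (jtheta (inverse c) q * jtheta (x / p i) q)))"
proof -
  define K where "K = (\<lambda>i x. J ^ 3 * jtheta (x / (c * p i)) q / (jtheta (inverse c) q * jtheta (x / p i) q))"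
  have jc: "jtheta (inverse c) q \<noteq> 0" using c by (simp add: jtheta_inverse)
  have K1: "((\<lambda>x. (1 - x / p i) * K i x) \<longlongrightarrow> 1) (at (p i))" if i: "i \<in> I" for i
  proof -
    have "LIM x at (p i). x / p i :> at 1"
    proof (rule filterlim_atI)
      have "((\<lambda>x. x / p i) \<longlongrightarrow> p i / p i) (at (p i))" using p[OF i] by (intro tendsto_intros)
      thus "((\<lambda>x. x / p i) \<longlongrightarrow> 1) (at (p i))" using p[OF i] by simp
      show "\<forall>\<^sub>F x in at (p i). x / p i \<noteq> 1"
        using p[OF i] by (auto simp: eventually_at intro!: exI[of _ 1])
    qed
    hence "((\<lambda>x. jtheta (x / p i) q / (1 - x / p i)) \<longlongrightarrow> J ^ 3) (at (p i))"
      by (rule filterlim_compose[OF jtheta_simple_zero])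
    hence "((\<lambda>x. J ^ 3 * jtheta (x / (c * p i)) q / (jtheta (inverse c) q * (jtheta (x / p i) q / (1 - x / p i))))
       \<longlongrightarrow> J ^ 3 * jtheta (p i / (c * p i)) q / (jtheta (inverse c) q * J ^ 3)) (at (p i))"
      using p[OF i] c jc J_nz by (intro tendsto_intros) auto
    moreover have "J ^ 3 * jtheta (p i / (c * p i)) q / (jtheta (inverse c) q * J ^ 3) = 1"
      using p[OF i] jc J_nz by (simp add: field_simps)
    ultimately show ?thesis by (simp add: K_def mult_ac)
  qed
  have K0: "((\<lambda>x. (1 - x / p i) * K j x) \<longlongrightarrow> 0) (at (p i))" if i: "i \<in> I" "j \<in> I" "i \<noteq> j" for i j
  proof -
    have "((\<lambda>x. (1 - x / p i) * K j x) \<longlongrightarrow> (1 - p i / p i) * K j (p i)) (at (p i))"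
      unfolding K_def using p i dist[OF i] jc c by (intro tendsto_intros) auto
    thus ?thesis using p i by simp
  qed
  define h where "h = (\<lambda>x. g x - (\<Sum>i\<in>I. \<sigma> i * K i x))"
  have "h x = 0"
  proof (rule quasi_periodic_removable_eq_0[OF I p _ _ _ c x])
    show "h holomorphic_on regular_points I p"
      unfolding h_def K_def using hol p c jc
      by (intro holomorphic_intros) (auto simp: regular_points_def)
    show "h (q * x) = c * h x" if x: "x \<in> regular_points I p" for x
    proof -
      have "K i (q * x) = c * K i x" if i: "i \<in> I" for i
      proof -
        have nz: "x \<noteq> 0" "p i \<noteq> 0" "jtheta (x / p i) q \<noteq> 0" using x i p by (auto simp: regular_points_def)
        have e: "jtheta (q * x / p i) q = - jtheta (x / p i) q / (x / p i)"
          "jtheta (q * x / (c * p i)) q = - jtheta (x / (c * p i)) q / (x / (c * p i))"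
          using jtheta_mult_q[of "x / p i"] jtheta_mult_q[of "x / (c * p i)"] nz c by simp_all
        show ?thesis unfolding K_def e using nz c jc by (simp add: field_simps)
      qed
      thus ?thesis unfolding h_def using per[OF x]
        by (simp add: algebra_simps sum_distrib_left)
    qed
    show "((\<lambda>x. (1 - x / p i) * h x) \<longlongrightarrow> 0) (at (p i))" if i: "i \<in> I" for i
    proof -
      have "((\<lambda>x. (1 - x / p i) * K j x) \<longlongrightarrow> (if j = i then 1 else 0)) (at (p i))" if "j \<in> I" for j
        using K1[OF i] K0[OF i that] by auto
      hence "((\<lambda>x. (1 - x / p i) * g x - (\<Sum>j\<in>I. \<sigma> j * ((1 - x / p i) * K j x))) \<longlongrightarrow>
         \<sigma> i - (\<Sum>j\<in>I. \<sigma> j * (if j = i then 1 else 0))) (at (p i))"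
        by (intro tendsto_intros lim[OF i]) auto
      moreover have "(\<Sum>j\<in>I. \<sigma> j * (if j = i then 1 else 0)) = \<sigma> i"
      proof -
        have "(\<Sum>j\<in>I. \<sigma> j * (if j = i then 1 else 0)) = (\<Sum>j\<in>I. if j = i then \<sigma> j else 0)"
          by (intro sum.cong) auto
        also have "\<dots> = (if i \<in> I then \<sigma> i else 0)" by (rule sum.delta[OF I])
        finally show ?thesis using i by simp
      qed
      ultimately show ?thesis
        by (simp add: h_def right_diff_distrib sum_distrib_left mult.left_commute)
    qed
  qed auto
  thus ?thesis by (simp add: h_def K_def)
qed

section \<open>Functional equations\<close>

lemma jtheta_mult_q_eq_0_iff: "x \<noteq> 0 \<Longrightarrow> jtheta (q * x) q = 0 \<longleftrightarrow> jtheta x q = 0"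
  by (simp add: jtheta_mult_q)

lemma jtheta_div_q_eq_0_iff: "x \<noteq> 0 \<Longrightarrow> jtheta (x / q) q = 0 \<longleftrightarrow> jtheta x q = 0"
  using jtheta_mult_q_eq_0_iff[of "x / q"] q_nz by simp

section \<open>The Appell-Lerch sum as a function of x and of z\<close>

lemma appell_m_eq: "appell_m x q z = appell_sum (theta_coeff q z) q (x * z / q) / jtheta z q"
proof -
  have "1 - q powi (r - 1) * x * z = 1 - x * z / q * q powi r" for r
    using q_nz by (simp add: power_int_diff)
  thus ?thesis by (simp add: appell_m_def appell_sum_def theta_coeff_def)
qed

lemma appell_m_holomorphic:
  assumes "f holomorphic_on S" "z \<noteq> 0" "\<And>x. x \<in> S \<Longrightarrow> f x \<noteq> 0" "\<And>x. x \<in> S \<Longrightarrow> jtheta (f x * z) q \<noteq> 0"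
    and "jtheta z q \<noteq> 0"
  shows "(\<lambda>x. appell_m (f x) q z) holomorphic_on S"
  unfolding appell_m_eq
  by (intro holomorphic_intros assms theta_coeff_abs_summable)
    (use assms q_nz jtheta_div_q_eq_0_iff[of "f _ * z"] in auto)

text \<open>At x = 1/z the singular index is r = 1, because the denominators contain q^(r-1); the
  numerator there is -z.\<close>

lemma appell_m_pole:
  assumes z: "z \<noteq> 0"
  shows "((\<lambda>x. (1 - x * z) * appell_m x q z) \<longlongrightarrow> - z / jtheta z q) (at (inverse z))"
proof -
  have "LIM x at (inverse z). x * z / q :> at (inverse q)"
  proof (rule filterlim_atI)
    have "((\<lambda>x. x * z / q) \<longlongrightarrow> inverse z * z / q) (at (inverse z))" using q_nz by (intro tendsto_intros)
    thus "((\<lambda>x. x * z / q) \<longlongrightarrow> inverse q) (at (inverse z))" using z by (simp add: divide_inverse)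
    show "\<forall>\<^sub>F x in at (inverse z). x * z / q \<noteq> inverse q"
      using z q_nz by (auto simp: eventually_at field_simps intro!: exI[of _ 1])
  qed
  from filterlim_compose[OF appell_sum_pole[OF theta_coeff_abs_summable[OF z], of "inverse q" 1] this]
  have "((\<lambda>x. (1 - x * z / q * q powi 1) * appell_sum (theta_coeff q z) q (x * z / q)) \<longlongrightarrow> theta_coeff q z 1) (at (inverse z))"
    using q_nz by simp
  hence "((\<lambda>x. (1 - x * z) * appell_sum (theta_coeff q z) q (x * z / q)) \<longlongrightarrow> - z) (at (inverse z))"
    using q_nz by (simp add: theta_coeff_def)
  hence "((\<lambda>x. (1 - x * z) * appell_sum (theta_coeff q z) q (x * z / q) * (1 / jtheta z q)) \<longlongrightarrow> - z * (1 / jtheta z q)) (at (inverse z))"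
    by (intro tendsto_intros)
  thus ?thesis by (simp add: appell_m_eq)
qed

text \<open>After the shift r -> r - 1, each fraction is split as 1/(1 - xt) = 1 + xt/(1 - xt). The
  first part sums to j(z; q) by the triple product and yields the constant 1.\<close>

lemma appell_m_mult_q:
  assumes z: "z \<noteq> 0" "jtheta z q \<noteq> 0" and x: "x \<noteq> 0" "jtheta (x * z) q \<noteq> 0"
  shows "appell_m (q * x) q z = 1 - x * appell_m x q z"
proof -
  have s1: "theta_coeff q z summable_on UNIV" by (rule theta_coeff_summable[OF z(1)])
  have s1': "(\<lambda>r. theta_coeff q z (r + - 1)) summable_on UNIV" using s1 by (rule summable_on_int_shift)
  have s2: "(\<lambda>r. theta_coeff q z r / (1 - x * z / q * q powi r)) summable_on UNIV"
    using x z q_nz jtheta_div_q_eq_0_iff[of "x * z"]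
    by (intro appell_sum_summable theta_coeff_abs_summable) auto
  have nz: "1 - x * z * q powi r \<noteq> 0" for r using jtheta_nz_iff[of "x * z"] x z by auto
  have "appell_sum (theta_coeff q z) q (x * z) =
      (\<Sum>\<^sub>\<infinity>r. theta_coeff q z (r + - 1) / (1 - x * z * q powi (r + - 1)))"
    unfolding appell_sum_def by (rule infsum_int_shift[symmetric])
  also have "\<dots> = (\<Sum>\<^sub>\<infinity>r. theta_coeff q z (r + - 1) - x * (theta_coeff q z r / (1 - x * z / q * q powi r)))"
  proof (rule infsum_cong)
    fix r :: int
    define t where "t = z * q powi (r - 1)"
    have t: "t \<noteq> 0" "1 - x * t \<noteq> 0" using z q_nz nz[of "r - 1"] by (auto simp: t_def mult_ac)
    have e1: "theta_coeff q z r = - t * theta_coeff q z (r + - 1)"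
      using theta_coeff_Suc[OF z(1), of "r + - 1"] by (simp add: t_def)
    have e2: "x * z / q * q powi r = x * t" "x * z * q powi (r + - 1) = x * t"
      using q_nz by (simp_all add: t_def power_int_diff)
    have "a / (1 - x * t) = a - x * (- t * a / (1 - x * t))" for a
      using t by (simp add: field_simps)
    thus "theta_coeff q z (r + - 1) / (1 - x * z * q powi (r + - 1)) =
        theta_coeff q z (r + - 1) - x * (theta_coeff q z r / (1 - x * z / q * q powi r))"
      unfolding e1 e2 .
  qed
  also have "\<dots> = jtheta z q - x * appell_sum (theta_coeff q z) q (x * z / q)"
    unfolding infsum_diff[OF s1' summable_on_cmult_right[OF s2]] infsum_cmult_right' appell_sum_def
    using infsum_int_shift[of "theta_coeff q z" "- 1"] jacobi_triple_product[OF z(1)] by simp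
  finally show ?thesis
    unfolding appell_m_eq using z q_nz by (simp add: field_simps)
qed

lemma appell_m_z_mult_q:
  assumes z: "z \<noteq> 0"
  shows "appell_m x q (q * z) = appell_m x q z"
proof -
  have "appell_sum (theta_coeff q (q * z)) q (x * z) = (\<Sum>\<^sub>\<infinity>r. - (1 / z) * (theta_coeff q z (r + 1) / (1 - x * z / q * q powi (r + 1))))"
    unfolding appell_sum_def
  proof (rule infsum_cong)
    fix r
    have "theta_coeff q (q * z) r = theta_coeff q z r * q powi r"
      using theta_coeff_mult_powi[of z 1 r] by (simp add: mult.commute)
    moreover have "theta_coeff q z (r + 1) = - z * q powi r * theta_coeff q z r" by (rule theta_coeff_Suc[OF z])
    moreover have "x * z / q * q powi (r + 1) = x * z * q powi r" using q_nz by (simp add: power_int_add)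
    ultimately show "theta_coeff q (q * z) r / (1 - x * z * q powi r) =
        - (1 / z) * (theta_coeff q z (r + 1) / (1 - x * z / q * q powi (r + 1)))"
      using z by simp
  qed
  also have "\<dots> = - (1 / z) * appell_sum (theta_coeff q z) q (x * z / q)"
    unfolding infsum_cmult_right' appell_sum_def by (subst infsum_int_shift) simp
  finally show ?thesis
    unfolding appell_m_eq using z q_nz by (simp add: jtheta_mult_q)
qed

lemma appell_m_z_mult_powi:
  assumes z: "z \<noteq> 0"
  shows "appell_m x q (z * q powi k) = appell_m x q z"
proof -
  have n: "appell_m x q (y * q ^ n) = appell_m x q y" if "y \<noteq> 0" for y n
  proof (induction n)
    case (Suc n)
    thus ?case using appell_m_z_mult_q[of "y * q ^ n" x] that q_nz by (simp add: mult_ac)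
  qed simp
  show ?thesis
  proof (cases "k \<ge> 0")
    case True
    thus ?thesis using n[OF z, of "nat k"] by (simp add: power_int_def)
  next
    case False
    have e: "z * q powi k * q ^ nat (- k) = z" using False q_nz by (simp add: power_int_def field_simps)
    have "z * q powi k \<noteq> 0" using z q_nz by simp
    from n[OF this, of "nat (- k)"] show ?thesis unfolding e by (rule sym)
  qed
qed

text \<open>Reindexing by r -> 2 - r, since the exponent r - 1 in the denominators is antisymmetric
  about r = 1.\<close>

lemma appell_m_inverse:
  assumes z: "z \<noteq> 0" and x: "x \<noteq> 0"
  shows "appell_m (inverse x) q (inverse z) = x * appell_m x q z"
proof -
  have "appell_sum (theta_coeff q (inverse z)) q (inverse x * inverse z / q) =
      (\<Sum>\<^sub>\<infinity>r. theta_coeff q (inverse z) (2 - r) / (1 - inverse x * inverse z / q * q powi (2 - r)))"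
    unfolding appell_sum_def by (rule infsum_int_reflect[symmetric])
  also have "\<dots> = (\<Sum>\<^sub>\<infinity>r. - (x / z) * (theta_coeff q z r / (1 - x * z / q * q powi r)))"
  proof (rule infsum_cong)
    fix r :: int
    define t where "t = q powi (r - 1)"
    have t: "t \<noteq> 0" using q_nz by (simp add: t_def)
    have e: "q powi r = t * q" "q powi (r - 2) = t / q" "q powi (2 - r) = q / t"
      using q_nz by (simp_all add: t_def power_int_diff power2_eq_square)
    have "theta_coeff q (inverse z) (2 - r) = theta_coeff q (q * z) (r - 2)"
      using theta_coeff_minus[of "inverse z" "r - 2"] z by (simp add: field_simps)
    also have "\<dots> = theta_coeff q z (r - 2) * q powi (r - 2)"
      using theta_coeff_mult_powi[of z 1 "r - 2"] by (simp add: mult.commute)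
    finally have a: "theta_coeff q (inverse z) (2 - r) = theta_coeff q z (r - 2) * (t / q)" by (simp add: e)
    have b: "theta_coeff q z r = z * t * (z * (t / q)) * theta_coeff q z (r - 2)"
      using theta_coeff_Suc[OF z, of "r - 1"] theta_coeff_Suc[OF z, of "r - 2"]
      by (simp add: e t_def[symmetric])
    define c D where "c = theta_coeff q z (r - 2)" and "D = 1 - x * z * t"
    have d1: "1 - inverse x * inverse z / q * (q / t) = - D / (x * z * t)"
      using x z t q_nz unfolding D_def by (simp add: field_simps)
    have d2: "1 - x * z / q * (t * q) = D" using q_nz by (simp add: D_def)
    have "c * (t / q) / (- D / (x * z * t)) = - (c * (t / q) * (x * z * t) / D)"
      by (simp only: divide_divide_eq_right minus_divide_left[symmetric] divide_minus_right)
    also have "c * (t / q) * (x * z * t) = (x / z) * (z * t * (z * (t / q)) * c)" using z by simp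
    also have "- ((x / z) * (z * t * (z * (t / q)) * c) / D) = - (x / z) * (z * t * (z * (t / q)) * c / D)"
      by (metis minus_mult_left times_divide_eq_right)
    finally have eq: "c * (t / q) / (- D / (x * z * t)) = - (x / z) * (z * t * (z * (t / q)) * c / D)" .
    show "theta_coeff q (inverse z) (2 - r) / (1 - inverse x * inverse z / q * q powi (2 - r)) =
       - (x / z) * (theta_coeff q z r / (1 - x * z / q * q powi r))"
      unfolding a b e d1 d2 c_def[symmetric] by (rule eq)
  qed
  also have "\<dots> = - (x / z) * appell_sum (theta_coeff q z) q (x * z / q)"
    unfolding infsum_cmult_right' appell_sum_def ..
  finally have eq: "appell_sum (theta_coeff q (inverse z)) q (inverse x * inverse z / q) =
      - (x / z) * appell_sum (theta_coeff q z) q (x * z / q)" .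
  have "- (x / z) * S / (- T / z) = x * (S / T)" for S T
    using z by (simp add: divide_simps)
  thus ?thesis unfolding appell_m_eq eq jtheta_inverse[OF z] .
qed

lemma appell_m_isCont:
  assumes w: "w \<noteq> 0" "jtheta w q \<noteq> 0" and v: "v \<noteq> 0" "jtheta (v * w) q \<noteq> 0"
  shows "isCont (\<lambda>x. appell_m x q w) v"
proof -
  define S where "S = {x \<in> -{0}. jtheta (x * w) q \<in> -{0}}"
  have "continuous_on (-{0}) (\<lambda>x. jtheta (x * w) q)"
    using w by (intro holomorphic_on_imp_continuous_on holomorphic_intros) auto
  hence "open S"
    using continuous_open_preimage[of "-{0}" "\<lambda>x. jtheta (x * w) q" "-{0}"]
    by (simp add: S_def vimage_def Int_def open_Compl)
  moreover have "v \<in> S" using v by (auto simp: S_def)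
  moreover have "(\<lambda>x. appell_m x q w) holomorphic_on S"
    by (rule appell_m_holomorphic[of "\<lambda>x. x"]) (use w in \<open>auto simp: S_def intro: holomorphic_intros\<close>)
  hence "continuous_on S (\<lambda>x. appell_m x q w)" by (rule holomorphic_on_imp_continuous_on)
  ultimately show ?thesis by (simp add: continuous_on_eq_continuous_at)
qed

text \<open>The inhomogeneous parts cancel in the difference. Multiplying by j(x z0) makes the
  multiplier the constant 1/z0 and removes the pole at 1/z0, so that the expansion has the single
  term belonging to 1/z1.\<close>

theorem appell_m_change_z:
  assumes x: "x \<noteq> 0" and z: "z0 \<noteq> 0" "z1 \<noteq> 0" "jtheta z0 q \<noteq> 0" "jtheta z1 q \<noteq> 0"
    and xz: "jtheta (x * z0) q \<noteq> 0" "jtheta (x * z1) q \<noteq> 0"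
  shows "appell_m x q z1 - appell_m x q z0 =
    z0 * J ^ 3 * jtheta (z1 / z0) q * jtheta (x * z0 * z1) q /
      (jtheta z0 q * jtheta z1 q * jtheta (x * z0) q * jtheta (x * z1) q)"
proof (cases "jtheta (z1 / z0) q = 0")
  case True
  then obtain k where "z1 / z0 = q powi k" using jtheta_eq_0_iff[of "z1 / z0"] z by auto
  hence "z1 = z0 * q powi k" using z by (simp add: field_simps)
  thus ?thesis using appell_m_z_mult_powi[OF z(1), of x k] True by simp
next
  case False
  \<comment> \<open>Both orbits are listed although the residue at 1/z0 is zero, because the
    difference of the Appell-Lerch sums is undefined on either.\<close>
  define p where "p = (\<lambda>b. if b then inverse z1 else inverse z0)"
  define g where "g = (\<lambda>x. (appell_m x q z1 - appell_m x q z0) * jtheta (x * z0) q)"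
  define s where "s = (\<lambda>b. if b then (- z1 / jtheta z1 q) * jtheta (inverse z1 * z0) q else 0)"
  have j01: "jtheta (z0 / z1) q \<noteq> 0" using False jtheta_inverse[of "z1 / z0"] z by simp
  have reg: "y \<in> regular_points UNIV p \<longleftrightarrow> y \<noteq> 0 \<and> jtheta (y * z0) q \<noteq> 0 \<and> jtheta (y * z1) q \<noteq> 0" for y
  proof -
    have "y / p True = y * z1" "y / p False = y * z0" by (auto simp: p_def divide_inverse)
    thus ?thesis unfolding regular_points_def by (simp add: all_bool_eq) blast
  qed
  have jiz: "jtheta (inverse z0) q \<noteq> 0" using z by (simp add: jtheta_inverse)
  have "g x = (\<Sum>b\<in>UNIV. s b * (J ^ 3 * jtheta (x / (inverse z0 * p b)) q /
            (jtheta (inverse (inverse z0)) q * jtheta (x / p b) q)))"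
  proof (rule quasi_periodic_partial_fractions)
    show "jtheta (p i / p j) q \<noteq> 0" if "i \<noteq> j" for i j
    proof -
      have "inverse z1 / inverse z0 = z0 / z1" "inverse z0 / inverse z1 = z1 / z0"
        using z by (auto simp: divide_inverse)
      thus ?thesis using that False j01 by (cases i; cases j) (simp_all add: p_def)
    qed
    show "g holomorphic_on regular_points UNIV p"
      unfolding g_def by (intro holomorphic_intros appell_m_holomorphic) (use z in \<open>auto simp: reg\<close>)
    show "g (q * y) = inverse z0 * g y" if "y \<in> regular_points UNIV p" for y
    proof -
      have y: "y \<noteq> 0" "jtheta (y * z0) q \<noteq> 0" "jtheta (y * z1) q \<noteq> 0" using that by (auto simp: reg)
      have e: "jtheta (q * y * z0) q = - jtheta (y * z0) q / (y * z0)"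
        using jtheta_mult_q[of "y * z0"] y z by (simp add: mult.assoc)
      have e0: "appell_m (q * y) q z0 = 1 - y * appell_m y q z0" "appell_m (q * y) q z1 = 1 - y * appell_m y q z1"
        using appell_m_mult_q[of z0 y] appell_m_mult_q[of z1 y] y z by auto
      show ?thesis unfolding g_def e e0 using y z by (simp add: field_simps)
    qed
    have cont: "isCont (\<lambda>x. appell_m x q w) (inverse v)"
      if "w \<noteq> 0" "jtheta w q \<noteq> 0" and "v \<noteq> 0" "jtheta (w / v) q \<noteq> 0" for w v
      using that by (intro appell_m_isCont) (auto simp: divide_inverse mult.commute)
    show "((\<lambda>y. (1 - y / p i) * g y) \<longlongrightarrow> s i) (at (p i))" for i
    proof (cases i)
      case True
      have "((\<lambda>y. ((1 - y * z1) * appell_m y q z1 - (1 - y * z1) * appell_m y q z0) * jtheta (y * z0) q) \<longlongrightarrow>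
         (- z1 / jtheta z1 q - (1 - inverse z1 * z1) * appell_m (inverse z1) q z0) * jtheta (inverse z1 * z0) q) (at (inverse z1))"
        using z cont[of z0 z1] j01
        by (intro tendsto_intros appell_m_pole) (auto simp: isCont_def)
      moreover have "(\<lambda>y. ((1 - y * z1) * appell_m y q z1 - (1 - y * z1) * appell_m y q z0) * jtheta (y * z0) q) = (\<lambda>y. (1 - y / p True) * g y)"
        by (auto simp: g_def p_def fun_eq_iff algebra_simps divide_inverse)
      ultimately show ?thesis using z True by (simp add: s_def p_def)
    next
      case False
      have "((\<lambda>y. ((1 - y * z0) * appell_m y q z1 - (1 - y * z0) * appell_m y q z0) * jtheta (y * z0) q) \<longlongrightarrow>
         ((1 - inverse z0 * z0) * appell_m (inverse z0) q z1 - (- z0 / jtheta z0 q)) * jtheta (inverse z0 * z0) q) (at (inverse z0))"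
        using z cont[of z1 z0] \<open>jtheta (z1 / z0) q \<noteq> 0\<close>
        by (intro tendsto_intros appell_m_pole) (auto simp: isCont_def)
      moreover have "(\<lambda>y. ((1 - y * z0) * appell_m y q z1 - (1 - y * z0) * appell_m y q z0) * jtheta (y * z0) q) = (\<lambda>y. (1 - y / p False) * g y)"
        by (auto simp: g_def p_def fun_eq_iff algebra_simps divide_inverse)
      ultimately show ?thesis using z False by (simp add: s_def p_def)
    qed
    show "x \<in> regular_points UNIV p" using x xz by (simp add: reg)
  qed (use z jiz in \<open>auto simp: p_def\<close>)
  also have "\<dots> = (- z1 / jtheta z1 q) * jtheta (z0 / z1) q * (J ^ 3 * jtheta (x * z0 * z1) q / (jtheta z0 q * jtheta (x * z1) q))"
    by (simp add: UNIV_bool s_def p_def divide_inverse mult_ac)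
  also have "jtheta (z0 / z1) q = - jtheta (z1 / z0) q * z0 / z1"
    using jtheta_inverse[of "z1 / z0"] z by simp
  finally have "appell_m x q z1 - appell_m x q z0 =
     (- z1 / jtheta z1 q) * (- jtheta (z1 / z0) q * z0 / z1) *
      (J ^ 3 * jtheta (x * z0 * z1) q / (jtheta z0 q * jtheta (x * z1) q)) / jtheta (x * z0) q"
    unfolding g_def using xz by (subst nonzero_eq_divide_eq)
  thus ?thesis using z by (simp add: mult_ac)
qed

text \<open>The exponents of (q;q) are sorted by residue modulo 3. This evaluates the sums in
  \<open>level3_mult_q\<close> and later writes J as a value of j.\<close>

lemma jtheta_q_cube: "jtheta q (q ^ 3) = J"
proof -
  interpret N3: nome "q ^ 3" by (rule nome_3)
  have fin: "qpoch q q (3 * n) = qpoch q (q ^ 3) n * qpoch (q ^ 3 / q) (q ^ 3) n * qpoch (q ^ 3) (q ^ 3) n" for n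
  proof (induction n)
    case (Suc n)
    define w where "w = (q ^ 3) ^ n"
    have e: "3 * Suc n = Suc (Suc (Suc (3 * n)))" by simp
    have w: "q ^ (3 * n) = w" by (simp add: w_def power_mult)
    have "q ^ 3 / q = q * q" using q_nz by (simp add: power3_eq_cube)
    thus ?case unfolding e qpoch_Suc N3.qpoch_Suc power_Suc w w_def[symmetric] Suc
      by (simp add: power3_eq_cube mult_ac)
  qed simp
  have "filterlim (\<lambda>n::nat. 3 * n) at_top sequentially"
    by (rule filterlim_subseq) (auto simp: strict_mono_def)
  hence 1: "(\<lambda>n. qpoch q q (3 * n)) \<longlonglongrightarrow> J"
    unfolding J_def using qpoch_tendsto filterlim_compose by blast
  have 2: "(\<lambda>n. qpoch q q (3 * n)) \<longlonglongrightarrow> qpoch_inf q (q ^ 3) * qpoch_inf (q ^ 3 / q) (q ^ 3) * qpoch_inf (q ^ 3) (q ^ 3)"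
    unfolding fin by (intro tendsto_intros N3.qpoch_tendsto)
  show ?thesis unfolding jtheta_def using LIMSEQ_unique[OF 2 1] .
qed

section \<open>The level three sum under x -> qx and x -> 1/x\<close>

abbreviation level3_coeff_seq :: "int \<Rightarrow> complex" where
  "level3_coeff_seq \<equiv> theta_coeff (q ^ 3) (q ^ 2)"

lemma level3_coeff_abs_summable: "(\<lambda>r. norm (level3_coeff_seq r)) summable_on UNIV"
  using nome.theta_coeff_abs_summable[OF nome_3] q_nz by simp

lemma level3_holomorphic: "level3 holomorphic_on {x. x \<noteq> 0 \<and> jtheta x q \<noteq> 0}"
  using appell_sum_holomorphic[OF level3_coeff_abs_summable] by (simp add: level3_def[abs_def])

lemma level3_pole: "((\<lambda>x. (1 - x) * level3 x) \<longlongrightarrow> 1) (at 1)"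
  using appell_sum_pole[OF level3_coeff_abs_summable, of 1 0]
  by (simp add: level3_def nome.theta_coeff_0[OF nome_3])

text \<open>Lowering r by one produces q^(-3r)/(1 - x q^r). Division by 1 - x q^r splits off three
  theta series and leaves x^3 times the original fraction.\<close>

lemma level3_mult_q:
  assumes x: "x \<noteq> 0" "jtheta x q \<noteq> 0"
  shows "level3 (q * x) = - q * x ^ 3 * level3 x + J * (1 - q * x ^ 2)"
proof -
  interpret N3: nome "q ^ 3" by (rule nome_3)
  define a where "a = theta_coeff (q ^ 3) (q ^ 2)"
  have twist: "a r * (q powi (- r)) ^ k = theta_coeff (q ^ 3) (q ^ 2 / q ^ k) r" for r k
  proof -
    have "(q powi (- r)) ^ k = inverse (q ^ k) powi r"
      by (simp add: power_int_inverse power_int_minus power_int_power power_int_power' power_inverse mult.commute)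
    thus ?thesis unfolding a_def theta_coeff_def divide_inverse
      by (simp add: power_int_mult_distrib mult.assoc)
  qed
  have h: "((\<lambda>r. a r * (q powi (- r)) ^ k) has_sum jtheta (q ^ 2 / q ^ k) (q ^ 3)) UNIV" for k
    unfolding twist using N3.jacobi_triple_product[of "q ^ 2 / q ^ k"] q_nz
      has_sum_infsum[OF N3.theta_coeff_summable[of "q ^ 2 / q ^ k"]] by simp
  \<comment> \<open>In base q^3 the three series are j(1/q), j(1) and j(q), that is -J/q, 0 and
    J.\<close>
  have j3: "jtheta (q ^ 2 / q ^ 3) (q ^ 3) = - J / q"
    using N3.jtheta_inverse[of q] q_nz jtheta_q_cube by (simp add: power2_eq_square power3_eq_cube divide_simps)
  have j2: "jtheta (q ^ 2 / q ^ 2) (q ^ 3) = 0" using q_nz by simp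
  have j1: "jtheta (q ^ 2 / q ^ 1) (q ^ 3) = J" using q_nz jtheta_q_cube by (simp add: power2_eq_square)
  have s: "((\<lambda>r. a r / (1 - x * q powi r)) has_sum level3 x) UNIV"
    unfolding a_def level3_def appell_sum_def
    by (rule has_sum_infsum[OF appell_sum_summable[OF level3_coeff_abs_summable x]])
  have nz: "1 - x * q powi r \<noteq> 0" for r using jtheta_nz_iff[of x] x by auto
  have "level3 (q * x) = (\<Sum>\<^sub>\<infinity>r. a (r + - 1) / (1 - q * x * q powi (r + - 1)))"
    unfolding level3_def appell_sum_def a_def by (rule infsum_int_shift[symmetric])
  also have "\<dots> = (\<Sum>\<^sub>\<infinity>r. - q * (a r * (q powi (- r)) ^ 3 + x * (a r * (q powi (- r)) ^ 2)
      + x ^ 2 * (a r * (q powi (- r)) ^ 1) + x ^ 3 * (a r / (1 - x * q powi r))))"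
  proof (rule infsum_cong)
    fix r :: int
    define y where "y = q powi r"
    have y: "y \<noteq> 0" "1 - x * y \<noteq> 0" using q_nz nz by (auto simp: y_def)
    have "a r = - (q ^ 2) * (q ^ 3) powi (r + - 1) * a (r + - 1)"
      using N3.theta_coeff_Suc[of "q ^ 2" "r + - 1"] q_nz by (simp add: a_def)
    moreover have "(q ^ 3) powi (r + - 1) = y ^ 3 / q ^ 3"
      using q_nz by (simp add: y_def power_int_diff power_int_power power_int_power' mult.commute)
    ultimately have "a r = - (y ^ 3 / q) * a (r + - 1)" using q_nz by (simp add: power3_eq_cube power2_eq_square)
    hence a1: "a (r + - 1) = - q * (a r * (1 / y) ^ 3)" using y q_nz by (simp add: field_simps)
    have e: "1 - q * x * q powi (r + - 1) = 1 - x * y" "q powi (- r) = 1 / y"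
      using q_nz by (simp_all add: y_def power_int_diff power_int_minus divide_inverse)
    have "A * i ^ 3 / D = A * i ^ 3 + x * (A * i ^ 2) + x ^ 2 * (A * i ^ 1) + x ^ 3 * (A / D)"
      if "D \<noteq> 0" "D = 1 - x * y" "i * y = 1" for A i D
    proof -
      have i: "i \<noteq> 0" using that(3) by auto
      hence iy: "y = 1 / i" using that(3) by (metis mult.commute nonzero_eq_divide_eq)
      have "(i ^ 3 + x * i ^ 2 + x ^ 2 * i) * D + x ^ 3 = i ^ 3"
        unfolding that(2) iy using i
        by (simp add: algebra_simps power2_eq_square power3_eq_cube)
      hence "A * i ^ 3 / D = A * ((i ^ 3 + x * i ^ 2 + x ^ 2 * i) * D + x ^ 3) / D" by simp
      also have "\<dots> = A * (i ^ 3 + x * i ^ 2 + x ^ 2 * i) + A * x ^ 3 / D"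
        using that(1) by (simp add: distrib_left add_divide_distrib)
      finally show ?thesis by (simp add: algebra_simps)
    qed
    from this[OF y(2) refl, of "1 / y" "a r"]
    have "a r * (1 / y) ^ 3 / (1 - x * y) = a r * (1 / y) ^ 3 + x * (a r * (1 / y) ^ 2)
        + x ^ 2 * (a r * (1 / y) ^ 1) + x ^ 3 * (a r / (1 - x * y))" using y(1) by simp
    thus "a (r + - 1) / (1 - q * x * q powi (r + - 1)) =
        - q * (a r * (q powi (- r)) ^ 3 + x * (a r * (q powi (- r)) ^ 2)
      + x ^ 2 * (a r * (q powi (- r)) ^ 1) + x ^ 3 * (a r / (1 - x * q powi r)))"
      unfolding a1 e y_def[symmetric] by (metis times_divide_eq_right)
  qed
  also have "\<dots> = - q * (jtheta (q ^ 2 / q ^ 3) (q ^ 3) + x * jtheta (q ^ 2 / q ^ 2) (q ^ 3)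
      + x ^ 2 * jtheta (q ^ 2 / q ^ 1) (q ^ 3) + x ^ 3 * level3 x)"
    by (rule infsumI has_sum_cmult_right has_sum_add h s)+
  finally have eq: "level3 (q * x) = - q * (jtheta (q ^ 2 / q ^ 3) (q ^ 3) + x * jtheta (q ^ 2 / q ^ 2) (q ^ 3)
      + x ^ 2 * jtheta (q ^ 2 / q ^ 1) (q ^ 3) + x ^ 3 * level3 x)" .
  have "- q * (- J / q + x * 0 + x ^ 2 * J + x ^ 3 * L) = - q * x ^ 3 * L + J * (1 - q * x ^ 2)" for L
    using q_nz by (simp add: algebra_simps)
  thus ?thesis unfolding eq j1 j2 j3 .
qed

text \<open>The substitution r -> -r. This symmetry is the source of D(a,M,q) = D(M-a,M,q) and of
  the passage between mutually inverse arguments of g.\<close>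

lemma level3_inverse:
  assumes x: "x \<noteq> 0"
  shows "level3 (inverse x) = - x * level3 x"
proof -
  interpret N3: nome "q ^ 3" by (rule nome_3)
  have "level3 (inverse x) = (\<Sum>\<^sub>\<infinity>r. level3_coeff_seq (0 - r) / (1 - inverse x * q powi (0 - r)))"
    unfolding level3_def appell_sum_def by (rule infsum_int_reflect[symmetric])
  also have "\<dots> = (\<Sum>\<^sub>\<infinity>r. - x * (level3_coeff_seq r / (1 - x * q powi r)))"
  proof (rule infsum_cong)
    fix r :: int
    define y where "y = q powi r"
    have y: "y \<noteq> 0" using q_nz by (simp add: y_def)
    have "level3_coeff_seq (- r) = theta_coeff (q ^ 3) q r"
      using N3.theta_coeff_minus[of "q ^ 2" r] q_nz by (simp add: power2_eq_square power3_eq_cube)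
    moreover have "level3_coeff_seq r = theta_coeff (q ^ 3) q r * y"
      unfolding theta_coeff_def y_def by (simp add: power2_eq_square power_int_mult_distrib)
    ultimately have a: "level3_coeff_seq r = level3_coeff_seq (- r) * y" by simp
    have e: "q powi (0 - r) = 1 / y" by (simp add: y_def power_int_minus divide_inverse)
    define c D where "c = level3_coeff_seq (- r)" and "D = 1 - x * y"
    have d: "1 - inverse x * (1 / y) = - D / (x * y)" using x y by (simp add: D_def field_simps)
    have "c / (- D / (x * y)) = - x * (c * y / D)" by simp
    thus "level3_coeff_seq (0 - r) / (1 - inverse x * q powi (0 - r)) = - x * (level3_coeff_seq r / (1 - x * q powi r))"
      unfolding e a y_def[symmetric] d D_def[symmetric] c_def by simp
  qed
  also have "\<dots> = - x * level3 x" unfolding infsum_cmult_right' level3_def appell_sum_def ..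
  finally show ?thesis .
qed

end

section \<open>Dissection of the level three Appell sum\<close>

definition dissect_sign :: "int \<Rightarrow> complex" where
  "dissect_sign N = (if N mod 3 = 0 then 1 else if N mod 3 = 2 then -1 else 0)"

text \<open>The quotient by 6 is exact unless N is 1 modulo 3, where \<open>dissect_sign\<close> is
  0. The shift rules below hold for every N, as they change the dividend by multiples of 6.\<close>

definition dissect_coeff :: "complex \<Rightarrow> int \<Rightarrow> complex" where
  "dissect_coeff q N = (-1) powi N * q powi (- (N * (N + 1)) div 6)"

definition dissect_arg :: "complex \<Rightarrow> nat \<Rightarrow> int \<Rightarrow> complex" where
  "dissect_arg q n N = (-1) ^ (n + 1) * q powi (int n * (3 * int n - 1) div 2 - int n * N)"

definition dissect_term :: "complex \<Rightarrow> nat \<Rightarrow> int \<Rightarrow> complex \<Rightarrow> complex" where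
  "dissect_term q n N x =
     dissect_sign N * dissect_coeff q N * x powi N * appell_m (dissect_arg q n N * x ^ (3 * n)) (q ^ (3 * n\<^sup>2)) \<i>"

lemma dissect_sign_plus3: "dissect_sign (N + 3 * k) = dissect_sign N"
  by (simp add: dissect_sign_def)

lemma minus_one_powi_plus3: "(-1 :: complex) powi (N + 3 * int k) = (-1) powi N * (-1) ^ k"
proof -
  have "(-1 :: complex) powi (3 * int k) = (-1) ^ (3 * k)" by (metis of_nat_mult of_nat_numeral power_int_of_nat)
  thus ?thesis by (simp add: power_int_add power_mult)
qed

lemma root_of_unity_eq_cis:
  assumes "0 < m" "y ^ m = 1"
  shows "\<exists>k<m. y = cis (2 * pi * real k / real m)"
proof -
  have "y \<in> {z. z ^ m = 1}" using assms by simp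
  thus ?thesis using Complex.bij_betw_roots_unity[OF assms(1)] unfolding bij_betw_def by auto
qed

lemma cis_root_of_unity_inj:
  assumes "0 < m" "k < m" "l < m" "cis (2 * pi * real k / real m) = cis (2 * pi * real l / real m)"
  shows "k = l"
  using Complex.bij_betw_roots_unity[OF assms(1)] assms(2-4) unfolding bij_betw_def inj_on_def by auto

lemma cis_root_of_unity_power: "0 < m \<Longrightarrow> cis (2 * pi * real k / real m) ^ m = 1"
proof -
  assume "0 < m"
  hence "real m * (2 * pi * real k / real m) = 2 * pi * real k" by simp
  thus ?thesis unfolding Complex.DeMoivre by (simp only:) (rule cis_multiple_2pi, rule Ints_of_nat)
qed

lemma norm_eq_1_of_power:
  fixes b :: complex
  assumes "norm (b ^ m) = 1" "0 < m"
  shows "norm b = 1"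
  using assms power_eq_imp_eq_base[of "norm b" m 1] by (simp add: norm_power)

context nome
begin

text \<open>Absolute values determine the exponent, and then the unit must be 1.\<close>

lemma unit_mult_powi_eq:
  assumes "u * q powi j = q powi k" "norm u = 1"
  shows "u = 1 \<and> j = k"
proof -
  interpret N: nome "of_real (norm q)" using q_nz q_lt1 by unfold_locales auto
  have "norm q powi j = norm q powi k"
    using arg_cong[OF assms(1), of norm] assms(2) by (simp add: norm_mult norm_power_int)
  hence "complex_of_real (norm q) powi j = complex_of_real (norm q) powi k"
    by (metis of_real_power_int)
  hence "j = k" by (simp add: N.powi_eq_iff)
  thus ?thesis using assms(1) q_nz by simp
qed

lemma dissect_coeff_plus3: "dissect_coeff q (N + 3) = - dissect_coeff q N * q powi (- (N + 2))"
proof -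
  have "- ((N + 3) * (N + 3 + 1)) = - (N * (N + 1)) + - (N + 2) * 6" by (simp add: algebra_simps)
  hence "- ((N + 3) * (N + 3 + 1)) div 6 = - (N * (N + 1)) div 6 + - (N + 2)"
    by (simp only: div_mult_self2)  simp
  thus ?thesis
    unfolding dissect_coeff_def using q_nz minus_one_powi_plus3[of N 1]
    by (simp only: power_int_add[OF disjI1[OF q_nz]]) simp
qed

text \<open>Hence x -> qx moves the argument of m from index N to index N - 3.\<close>

lemma dissect_arg_minus3: "dissect_arg q n N * q ^ (3 * n) = dissect_arg q n (N - 3)"
proof -
  have "q ^ (3 * n) = q powi (3 * int n)" by (metis of_nat_mult of_nat_numeral power_int_of_nat)
  thus ?thesis unfolding dissect_arg_def using q_nz by (simp add: algebra_simps flip: power_int_add)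
qed

lemma dissect_arg_plus: "dissect_arg q n N = q ^ (3 * n\<^sup>2) * dissect_arg q n (N + 3 * int n)"
proof -
  have "q ^ (3 * n\<^sup>2) = q powi (3 * (int n)\<^sup>2)" by (metis of_nat_mult of_nat_numeral of_nat_power power_int_of_nat)
  thus ?thesis unfolding dissect_arg_def using q_nz
    by (simp add: algebra_simps power2_eq_square flip: power_int_add)
qed

text \<open>Tuned to \<open>dissect_arg_plus\<close> and m(Qy) = 1 - y m(y): the term with index N +
  3n is the term with index N minus its coefficient.\<close>

lemma dissect_coeff_plus:
  "dissect_coeff q (N + 3 * int n) = - dissect_coeff q N * dissect_arg q n (N + 3 * int n)"
proof -
  define h where "h = int n * (3 * int n - 1) div 2"
  have "even (int n * (3 * int n - 1))" by auto
  hence h: "int n * (3 * int n - 1) = 2 * h" by (simp add: h_def)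
  have "- ((N + 3 * int n) * (N + 3 * int n + 1)) =
      - (N * (N + 1)) + - (2 * int n * N) * 3 - 3 * (int n * (3 * int n - 1)) - 6 * int n" by (simp add: algebra_simps)
  also have "\<dots> = - (N * (N + 1)) + (- int n * N - h - int n) * 6" unfolding h by (simp add: algebra_simps)
  finally have "- ((N + 3 * int n) * (N + 3 * int n + 1)) = - (N * (N + 1)) + (- int n * N - h - int n) * 6" .
  hence e1: "- ((N + 3 * int n) * (N + 3 * int n + 1)) div 6 = - (N * (N + 1)) div 6 + (- int n * N - h - int n)"
    by (simp only: div_mult_self2) simp
  have "int n * (3 * int n) = 2 * h + int n" using h by (simp add: algebra_simps)
  hence e2: "h - int n * (N + 3 * int n) = - int n * N - h - int n" by (simp add: algebra_simps)
  show ?thesis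
    unfolding dissect_coeff_def dissect_arg_def h_def[symmetric] e1 e2 minus_one_powi_plus3
    by (simp only: power_int_add[OF disjI1[OF q_nz]]) simp
qed

end

text \<open>Here \<pi> l is one solution x of y_l x^(3n) i = 1, hence a pole of the term with index
  l. The condition on b places it on the unit circle, makes b^3 different from 1 and keeps b away
  from the 6n-th roots of unity.\<close>

locale dissection = nome +
  fixes n :: nat and b :: complex and \<pi> :: "int \<Rightarrow> complex"
  assumes n_pos: "0 < n" and b_power: "b ^ (12 * n) = -1"
    and pole_eq: "\<And>l. l = 0 \<or> l = 2 \<Longrightarrow> \<pi> l ^ (3 * n) * (dissect_arg q n l * \<i>) = 1"
begin

text \<open>Representatives of the poles up to powers of q: \<open>None\<close> is the pole 1 of
  \<open>level3\<close>, the others belong to the terms l = 0 and l = 2. These suffice because the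
  poles of the term l + 3u are q^u times those of the term l, and terms with N = 1 modulo 3 are
  zero.\<close>

definition pole_index :: "(int \<times> nat) option set" where
  "pole_index = insert None (Some ` ({0, 2} \<times> {..<3 * n}))"

definition pole :: "(int \<times> nat) option \<Rightarrow> complex" where
  "pole s = (case s of None \<Rightarrow> 1 | Some (l, k) \<Rightarrow> \<pi> l * cis (2 * pi * real k / real (3 * n)))"

definition dissect_base :: complex where "dissect_base = q ^ (3 * n\<^sup>2)"

definition multiplier :: complex where "multiplier = q * b ^ 3"

text \<open>The limits at p of (1 - x/p) times (level3 x / J - dissect_sum x) j(x/b)^3.\<close>

definition pole_weight :: "(int \<times> nat) option \<Rightarrow> complex" where
  "pole_weight s = (case s of None \<Rightarrow> jtheta (inverse b) q ^ 3 / J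
     | Some (l, k) \<Rightarrow> dissect_sign l * dissect_coeff q l * pole s powi l * \<i> /
         (of_nat (3 * n) * jtheta \<i> dissect_base) * jtheta (pole s / b) q ^ 3)"

definition dissect_remainder :: "complex \<Rightarrow> complex" where
  "dissect_remainder x = (\<Sum>s\<in>pole_index. pole_weight s *
      (J ^ 3 * jtheta (x / (multiplier * pole s)) q / (jtheta (inverse multiplier) q * jtheta (x / pole s) q)))
      / jtheta (x / b) q ^ 3"

lemma nome_base: "nome dissect_base"
  unfolding dissect_base_def using n_pos by (intro nome_power) auto

lemma base_powi: "dissect_base powi m = q powi (3 * (int n)\<^sup>2 * m)"
proof -
  have "q ^ (3 * n\<^sup>2) = q powi (int (3 * n\<^sup>2))" by (simp only: power_int_of_nat)
  also have "int (3 * n\<^sup>2) = 3 * (int n)\<^sup>2" by simp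
  finally show ?thesis unfolding dissect_base_def by (simp only: power_int_mult)
qed

lemma norm_b: "norm b = 1"
  using norm_eq_1_of_power[of b "12 * n"] b_power n_pos by simp

lemma b_nz: "b \<noteq> 0" using norm_b by auto

lemma dissect_arg_nz: "dissect_arg q n N \<noteq> 0"
  unfolding dissect_arg_def using q_nz by simp

lemma pole_power: "Some (l, k) \<in> pole_index \<Longrightarrow> pole (Some (l, k)) ^ (3 * n) * (dissect_arg q n l * \<i>) = 1"
  using pole_eq[of l] cis_root_of_unity_power[of "3 * n" k] n_pos
  by (auto simp: pole_def pole_index_def power_mult_distrib)

lemma pole_nz: "s \<in> pole_index \<Longrightarrow> pole s \<noteq> 0"
proof (cases s)
  case (Some lk)
  assume s: "s \<in> pole_index"
  obtain l k where lk: "lk = (l, k)" by (cases lk)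
  show "pole s \<noteq> 0" using pole_power[of l k] s n_pos Some lk by (auto simp: zero_power)
qed (simp add: pole_def)

lemma unit_root_i: "((-1) ^ k * \<i>) ^ 2 = (-1 :: complex)"
  by (simp add: power_mult_distrib flip: power_mult)

text \<open>The reason for the parameter i: at signs times powers of q, in particular at x = 1, no
  term of the dissection is singular.\<close>

lemma i_powi_neq: "(-1) ^ k * \<i> * q powi j \<noteq> q powi m"
proof
  assume "(-1) ^ k * \<i> * q powi j = q powi m"
  hence "(-1) ^ k * \<i> = 1" using unit_mult_powi_eq[of "(-1) ^ k * \<i>" j m] by (simp add: norm_mult norm_power)
  thus False using unit_root_i[of k] by simp
qed

lemma jtheta_i_base: "jtheta \<i> dissect_base \<noteq> 0"
  using i_powi_neq[of 0 0] nome.jtheta_eq_0_iff[OF nome_base, of \<i>] by (auto simp: base_powi)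

lemma pole_neq_powi:
  assumes "Some (l, k) \<in> pole_index"
  shows "pole (Some (l, k)) \<noteq> q powi m"
proof
  assume "pole (Some (l, k)) = q powi m"
  hence "pole (Some (l, k)) ^ (3 * n) = q powi (m * int (3 * n))"
    by (metis power_int_mult power_int_of_nat)
  from pole_power[OF assms, unfolded this]
  have "(-1) ^ (n + 1) * \<i> * q powi (m * int (3 * n) + (int n * (3 * int n - 1) div 2 - int n * l)) = q powi 0"
    unfolding dissect_arg_def power_int_add[OF disjI1[OF q_nz]] by (simp add: mult_ac)
  thus False using i_powi_neq by blast
qed

text \<open>Taking 3n-th powers removes the root of unity and forces l - l' = 3m, so l = l' and m =
  0; then the roots of unity themselves agree.\<close>

lemma pole_ratio_neq_powi:
  assumes "Some (l, k) \<in> pole_index" "Some (l', k') \<in> pole_index" "(l, k) \<noteq> (l', k')"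
  shows "pole (Some (l, k)) \<noteq> q powi m * pole (Some (l', k'))"
proof
  assume eq: "pole (Some (l, k)) = q powi m * pole (Some (l', k'))"
  define P where "P = pole (Some (l', k')) ^ (3 * n)"
  have P: "P * (dissect_arg q n l' * \<i>) = 1" using pole_power[OF assms(2)] by (simp add: P_def)
  hence P0: "P \<noteq> 0" by auto
  have "(q powi m) ^ (3 * n) * P * (dissect_arg q n l * \<i>) = 1"
    using pole_power[OF assms(1)] unfolding eq P_def power_mult_distrib .
  with P have "P * \<i> * dissect_arg q n l' = P * \<i> * ((q powi m) ^ (3 * n) * dissect_arg q n l)"
    by (simp add: mult_ac)
  hence "dissect_arg q n l' = (q powi m) ^ (3 * n) * dissect_arg q n l" using P0 by simp
  moreover have "(q powi m) ^ (3 * n) = q powi (m * int (3 * n))" by (metis power_int_mult power_int_of_nat)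
  ultimately have "q powi (int n * (3 * int n - 1) div 2 - int n * l') =
      q powi (m * int (3 * n)) * q powi (int n * (3 * int n - 1) div 2 - int n * l)"
    unfolding dissect_arg_def by simp
  hence "int n * (3 * int n - 1) div 2 - int n * l' = m * int (3 * n) + (int n * (3 * int n - 1) div 2 - int n * l)"
    unfolding power_int_add[OF disjI1[OF q_nz], symmetric] powi_eq_iff .
  hence "int n * (l - l') = int n * (3 * m)" by (simp add: algebra_simps)
  hence "l - l' = 3 * m" using n_pos by simp
  moreover have "l \<in> {0, 2}" "l' \<in> {0, 2}" using assms by (auto simp: pole_index_def)
  ultimately have ll: "l = l'" "m = 0" by auto presburger+
  have "\<pi> l \<noteq> 0" using pole_nz[OF assms(1)] by (auto simp: pole_def)
  hence "cis (2 * pi * real k / real (3 * n)) = cis (2 * pi * real k' / real (3 * n))"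
    using eq ll by (simp add: pole_def)
  hence "k = k'" using cis_root_of_unity_inj[of "3 * n" k k'] assms(1,2) n_pos
    by (auto simp: pole_index_def)
  thus False using assms(3) ll by simp
qed

lemma pole_distinct:
  assumes "s \<in> pole_index" "s' \<in> pole_index" "s \<noteq> s'"
  shows "jtheta (pole s / pole s') q \<noteq> 0"
proof
  assume "jtheta (pole s / pole s') q = 0"
  then obtain m where "pole s / pole s' = q powi m"
    using jtheta_eq_0_iff[of "pole s / pole s'"] pole_nz assms by auto
  hence eq: "pole s = q powi m * pole s'" using pole_nz[OF assms(2)] by (simp add: field_simps)
  show False
  proof (cases s; cases s')
    fix t' assume s: "s = None" and s': "s' = Some t'"
    obtain l k where t': "t' = (l, k)" by (cases t')
    have "pole (Some (l, k)) = q powi (- m)"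
      using eq s s' t' q_nz by (simp add: pole_def[of None] power_int_minus field_simps)
    thus False using pole_neq_powi[of l k "- m"] assms s' t' by simp
  next
    fix t assume s': "s' = None" and s: "s = Some t"
    obtain l k where t: "t = (l, k)" by (cases t)
    show False using eq pole_neq_powi[of l k m] assms s s' t by (simp add: pole_def[of None])
  next
    fix t t' assume "s = Some t" "s' = Some t'"
    thus False using pole_ratio_neq_powi[of "fst t" "snd t" "fst t'" "snd t'" m] eq assms by simp
  qed (use assms in auto)
qed

text \<open>Every singular point of any term lies on one of the listed orbits: the term l + 3u at x
  behaves like the term l at x q^(-u), and a power of the base is again a 3n-th power.\<close>

lemma arg_regular:
  assumes x: "x \<in> regular_points pole_index pole" and N: "dissect_sign N \<noteq> 0"
  shows "jtheta (dissect_arg q n N * x ^ (3 * n) * \<i>) dissect_base \<noteq> 0"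
proof
  assume j0: "jtheta (dissect_arg q n N * x ^ (3 * n) * \<i>) dissect_base = 0"
  have x0: "x \<noteq> 0" using x by (simp add: regular_points_def)
  obtain m where "dissect_arg q n N * x ^ (3 * n) * \<i> = dissect_base powi m"
    using j0 nome.jtheta_eq_0_iff[OF nome_base] x0 dissect_arg_nz by auto
  hence m: "dissect_arg q n N * x ^ (3 * n) * \<i> = q powi (3 * (int n)\<^sup>2 * m)" by (simp add: base_powi)
  define l where "l = N mod 3"
  define u where "u = N div 3"
  have l: "l = 0 \<or> l = 2" using N by (auto simp: dissect_sign_def l_def split: if_splits)
  have Nlu: "N = l + 3 * u" by (simp add: l_def u_def)
  \<comment> \<open>The m-th power of the base is the 3n-th power of q^(nm), and u is the shift
    coming from N = l + 3u.\<close>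
  define v where "v = int n * m + u"
  define y where "y = x * q powi (- v)"
  have "(q powi (- v)) ^ (3 * n) = q powi (- (3 * int n * v))"
    by (metis (no_types, opaque_lifting) mult.commute mult_minus_left of_nat_mult of_nat_numeral power_int_mult power_int_of_nat)
  hence "y ^ (3 * n) * (dissect_arg q n l * \<i>) = x ^ (3 * n) * \<i> * (q powi (- (3 * int n * v)) * dissect_arg q n l)"
    by (simp add: y_def power_mult_distrib mult_ac)
  also have "q powi (- (3 * int n * v)) * dissect_arg q n l = dissect_arg q n N * q powi (- (3 * (int n)\<^sup>2 * m))"
  proof -
    have "- (3 * int n * v) + (h - int n * l) = h - int n * N + - (3 * (int n)\<^sup>2 * m)" for h
      by (simp add: v_def Nlu algebra_simps power2_eq_square)
    hence "q powi (- (3 * int n * v)) * q powi (h - int n * l) = q powi (h - int n * N) * q powi (- (3 * (int n)\<^sup>2 * m))" for h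
      unfolding power_int_add[OF disjI1[OF q_nz], symmetric] by (simp only:)
    from this[of "int n * (3 * int n - 1) div 2"] show ?thesis
      unfolding dissect_arg_def mult.assoc mult.left_commute[of _ "(- 1) ^ (n + 1)"] by (simp only:)
  qed
  also have "x ^ (3 * n) * \<i> * (dissect_arg q n N * q powi (- (3 * (int n)\<^sup>2 * m))) = 1"
  proof -
    have "x ^ (3 * n) * \<i> * (dissect_arg q n N * q powi (- (3 * (int n)\<^sup>2 * m))) =
        dissect_arg q n N * x ^ (3 * n) * \<i> * q powi (- (3 * (int n)\<^sup>2 * m))"
      by (simp only: mult_ac)
    also have "\<dots> = 1" unfolding m power_int_add[OF disjI1[OF q_nz], symmetric] by simp
    finally show ?thesis .
  qed
  finally have y: "y ^ (3 * n) * (dissect_arg q n l * \<i>) = 1" .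
  have pl: "\<pi> l ^ (3 * n) * (dissect_arg q n l * \<i>) = 1" using pole_eq l by blast
  hence pl0: "\<pi> l \<noteq> 0" using n_pos by (auto simp: zero_power)
  have "(y / \<pi> l) ^ (3 * n) = 1"
    using y pl pl0 dissect_arg_nz[of l] by (metis divide_self_if mult_cancel_right power_divide power_not_zero mult_zero_right zero_neq_one)
  then obtain k where k: "k < 3 * n" "y / \<pi> l = cis (2 * pi * real k / real (3 * n))"
    using root_of_unity_eq_cis[of "3 * n" "y / \<pi> l"] n_pos by auto
  have s: "Some (l, k) \<in> pole_index" using l k by (auto simp: pole_index_def)
  have "y = pole (Some (l, k))" using k pl0 by (simp add: pole_def field_simps)
  hence "x / pole (Some (l, k)) = q powi v"
    using x0 q_nz by (simp add: y_def power_int_minus field_simps)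
  hence "jtheta (x / pole (Some (l, k))) q = 0"
    using jtheta_eq_0_iff[of "q powi v"] q_nz by auto
  thus False using x s by (auto simp: regular_points_def)
qed

lemma regular_jtheta_nz: "x \<in> regular_points pole_index pole \<Longrightarrow> x \<noteq> 0 \<and> jtheta x q \<noteq> 0"
  by (auto simp: regular_points_def pole_index_def pole_def)

lemma dissect_term_shift:
  assumes x: "x \<noteq> 0" "dissect_sign N \<noteq> 0 \<Longrightarrow> jtheta (dissect_arg q n N * x ^ (3 * n) * \<i>) dissect_base \<noteq> 0"
  shows "dissect_term q n (N + 3 * int n) x =
    dissect_term q n N x - dissect_sign N * dissect_coeff q N * x powi N"
proof (cases "dissect_sign N = 0")
  case True
  thus ?thesis by (simp add: dissect_term_def dissect_sign_plus3)
next
  case False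
  interpret Q: nome dissect_base by (rule nome_base)
  define y where "y = dissect_arg q n (N + 3 * int n) * x ^ (3 * n)"
  have y0: "y \<noteq> 0" using x dissect_arg_nz by (simp add: y_def)
  have Qy: "dissect_arg q n N * x ^ (3 * n) = dissect_base * y"
    unfolding y_def dissect_base_def using dissect_arg_plus[of n N] by simp
  have "jtheta (y * \<i>) dissect_base \<noteq> 0"
    using x(2)[OF False] Q.jtheta_mult_q_eq_0_iff[of "y * \<i>"] y0 unfolding Qy by (simp add: mult.assoc)
  hence m: "appell_m (dissect_base * y) dissect_base \<i> = 1 - y * appell_m y dissect_base \<i>"
    using jtheta_i_base y0 by (intro Q.appell_m_mult_q) auto
  have e: "x powi (N + 3 * int n) = x powi N * x ^ (3 * n)"
    using x(1) by (metis of_nat_mult of_nat_numeral power_int_add power_int_of_nat)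
  have "dissect_term q n (N + 3 * int n) x = dissect_sign N * dissect_coeff q N * x powi N * (- y * appell_m y dissect_base \<i>)"
    unfolding dissect_term_def dissect_sign_plus3 dissect_coeff_plus e dissect_base_def[symmetric] y_def
    by simp
  also have "- y * appell_m y dissect_base \<i> = appell_m (dissect_base * y) dissect_base \<i> - 1" unfolding m by simp
  finally show ?thesis
    unfolding dissect_term_def dissect_base_def[symmetric] Qy by (simp add: algebra_simps)
qed

lemma dissect_term_mult_q:
  assumes "x \<noteq> 0"
  shows "dissect_term q n N (q * x) = - q * x ^ 3 * dissect_term q n (N - 3) x"
proof -
  have 1: "dissect_arg q n N * (q * x) ^ (3 * n) = dissect_arg q n (N - 3) * x ^ (3 * n)"
    using dissect_arg_minus3[of n N] by (simp add: power_mult_distrib mult.assoc)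
  have "dissect_coeff q N * q powi N = - q * dissect_coeff q (N - 3)"
    using dissect_coeff_plus3[of "N - 3"] q_nz by (simp add: power_int_minus power_int_diff field_simps)
  moreover have "x powi N = x ^ 3 * x powi (N - 3)"
    using assms by (simp add: power_int_diff)
  ultimately have "(dissect_coeff q N * q powi N) * x powi N = (- q * dissect_coeff q (N - 3)) * (x ^ 3 * x powi (N - 3))"
    by (simp only:)
  hence 2: "dissect_coeff q N * (q * x) powi N = - q * x ^ 3 * (dissect_coeff q (N - 3) * x powi (N - 3))"
    unfolding power_int_mult_distrib by (simp only: mult_ac mult_minus_left mult_minus_right)
  have 3: "dissect_sign N = dissect_sign (N - 3)" using dissect_sign_plus3[of "N - 3" 1] by simp
  have r: "A * C * X * D = A * D * (C * X)" for A C X D :: complex by simp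
  show ?thesis unfolding dissect_term_def 1 3
    unfolding r[of _ "dissect_coeff q N" "(q * x) powi N"] 2 by (simp add: mult_ac)
qed

text \<open>
  The constants are chosen such that this sum has the same functional equation under
  \<open>x \<mapsto> q x\<close> as \<open>level3 x / J\<close>.
\<close>

definition dissect_sum :: "complex \<Rightarrow> complex" where
  "dissect_sum x = (\<Sum>N\<in>{0..<3 * int n}. dissect_term q n N x)"

text \<open>The index range moves down by 3. Its overhang -3, -2, -1 is exchanged against the top
  three indices by \<open>dissect_term_shift\<close>, and the coefficients set free there give the
  inhomogeneous part.\<close>

lemma dissect_sum_mult_q:
  assumes x: "x \<in> regular_points pole_index pole"
  shows "dissect_sum (q * x) = - q * x ^ 3 * dissect_sum x + 1 - q * x ^ 2"
proof -
  have x0: "x \<noteq> 0" using x regular_jtheta_nz by blast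
  define t where "t = (\<lambda>N. dissect_term q n N x)"
  have f1: "(\<Sum>N\<in>{0..<3 * int n}. t (N - 3)) = (\<Sum>N\<in>{-3..<3 * int n - 3}. t N)"
    by (rule sum.reindex_bij_witness[of _ "\<lambda>N. N + 3" "\<lambda>N. N - 3"]) auto
  have f2: "(\<Sum>N\<in>{-3..<3 * int n - 3}. t N) + (\<Sum>N\<in>{3 * int n - 3..<3 * int n}. t N) = (\<Sum>N\<in>{-3..<3 * int n}. t N)"
    using n_pos by (subst sum.union_disjoint[symmetric]) (auto intro!: sum.cong)
  have f3: "(\<Sum>N\<in>{-3..<0}. t N) + (\<Sum>N\<in>{0..<3 * int n}. t N) = (\<Sum>N\<in>{-3..<3 * int n}. t N)"
    by (subst sum.union_disjoint[symmetric]) (auto intro!: sum.cong)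
  have f4: "(\<Sum>N\<in>{3 * int n - 3..<3 * int n}. t N) = (\<Sum>N\<in>{-3..<0}. t (N + 3 * int n))"
    by (rule sum.reindex_bij_witness[of _ "\<lambda>N. N + 3 * int n" "\<lambda>N. N - 3 * int n"]) auto
  have f5: "(\<Sum>N\<in>{-3..<0}. t (N + 3 * int n)) =
      (\<Sum>N\<in>{-3..<0}. t N) - (\<Sum>N\<in>{-3..<0}. dissect_sign N * dissect_coeff q N * x powi N)"
    unfolding sum_subtractf[symmetric] t_def
    by (intro sum.cong refl dissect_term_shift x0 arg_regular[OF x])
  have "(\<Sum>N\<in>{0..<3 * int n}. t (N - 3)) + (\<Sum>N\<in>{-3..<0}. t (N + 3 * int n)) =
      (\<Sum>N\<in>{-3..<0}. t N) + (\<Sum>N\<in>{0..<3 * int n}. t N)"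
    using f2 unfolding f1[symmetric] f3[symmetric] f4 .
  hence S: "(\<Sum>N\<in>{0..<3 * int n}. t (N - 3)) =
      (\<Sum>N\<in>{0..<3 * int n}. t N) + (\<Sum>N\<in>{-3..<0}. dissect_sign N * dissect_coeff q N * x powi N)"
    unfolding f5 by (simp add: algebra_simps eq_diff_eq)
  \<comment> \<open>The index -2 has sign 0; the other two contribute -1/(q x^3) and 1/x.\<close>
  have "{-3..<0} = {-3, -2, -1 :: int}" by auto
  hence "(\<Sum>N\<in>{-3..<0}. dissect_sign N * dissect_coeff q N * x powi N) = inverse x - inverse (q * x ^ 3)"
    using q_nz x0 by (simp add: dissect_sign_def dissect_coeff_def power_int_minus)
  moreover have "dissect_sum (q * x) = - q * x ^ 3 * (\<Sum>N\<in>{0..<3 * int n}. t (N - 3))"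
    unfolding dissect_sum_def t_def sum_distrib_left by (intro sum.cong refl dissect_term_mult_q x0)
  ultimately have "dissect_sum (q * x) = - q * x ^ 3 * (dissect_sum x + (inverse x - inverse (q * x ^ 3)))"
    unfolding S by (simp add: dissect_sum_def t_def)
  moreover have "q * x ^ 3 * inverse x = q * x ^ 2"
    using x0 by (simp add: power2_eq_square power3_eq_cube)
  moreover have "q * x ^ 3 * inverse (q * x ^ 3) = 1" using x0 q_nz by (intro right_inverse) simp
  moreover have "- q * x ^ 3 * (S + (u - v)) = - q * x ^ 3 * S + q * x ^ 3 * v - q * x ^ 3 * u" for S u v
    by (simp add: algebra_simps)
  ultimately show ?thesis by (simp only:)
qed

lemma dissect_term_isCont:
  assumes x: "x \<noteq> 0" "dissect_sign N \<noteq> 0 \<Longrightarrow> jtheta (dissect_arg q n N * x ^ (3 * n) * \<i>) dissect_base \<noteq> 0"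
  shows "isCont (dissect_term q n N) x"
proof (cases "dissect_sign N = 0")
  case True
  thus ?thesis by (simp add: dissect_term_def[abs_def])
next
  case False
  have "isCont (\<lambda>y. appell_m y dissect_base \<i>) (dissect_arg q n N * x ^ (3 * n))"
    using x False dissect_arg_nz jtheta_i_base by (intro nome.appell_m_isCont[OF nome_base]) auto
  hence "isCont (\<lambda>x. appell_m (dissect_arg q n N * x ^ (3 * n)) dissect_base \<i>) x"
    by (rule isCont_o2[rotated]) (intro continuous_intros)
  moreover have "isCont (\<lambda>x. x powi N) x" using x(1) by (intro continuous_intros) auto
  ultimately show ?thesis
    unfolding dissect_term_def[abs_def] dissect_base_def[symmetric]
    by (intro continuous_mult continuous_const)
qed

lemma dissect_sum_holomorphic: "dissect_sum holomorphic_on regular_points pole_index pole"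
proof -
  have "dissect_term q n N holomorphic_on regular_points pole_index pole" for N
  proof (cases "dissect_sign N = 0")
    case True
    thus ?thesis by (simp add: dissect_term_def[abs_def])
  next
    case False
    have "(\<lambda>x. appell_m (dissect_arg q n N * x ^ (3 * n)) dissect_base \<i>) holomorphic_on regular_points pole_index pole"
      by (rule nome.appell_m_holomorphic[OF nome_base])
        (use False dissect_arg_nz jtheta_i_base regular_jtheta_nz arg_regular in \<open>auto intro!: holomorphic_intros\<close>)
    thus ?thesis unfolding dissect_term_def[abs_def] dissect_base_def[symmetric]
      by (intro holomorphic_intros) (use regular_jtheta_nz in auto)
  qed
  thus ?thesis unfolding dissect_sum_def[abs_def] by (intro holomorphic_intros)
qed

text \<open>Cancelling 1 - x/p against 1 - (x/p)^m leaves a geometric sum. This converts a pole in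
  x^(3n) to one in x and is the source of the factor 1/(3n) in the residues.\<close>

lemma geometric_ratio_tendsto:
  assumes "p \<noteq> 0" "0 < m"
  shows "((\<lambda>x. (1 - x / p) / (1 - (x / p) ^ m)) \<longlongrightarrow> 1 / of_nat m) (at (p :: complex))"
    and "\<forall>\<^sub>F x in at p. (x / p) ^ m \<noteq> 1"
proof -
  have "((\<lambda>x. \<Sum>i<m. (x / p) ^ i) \<longlongrightarrow> (\<Sum>i<m. (p / p) ^ i)) (at p)"
    using assms by (intro tendsto_intros) auto
  hence lim: "((\<lambda>x. \<Sum>i<m. (x / p) ^ i) \<longlongrightarrow> of_nat m) (at p)" using assms by simp
  have nz: "\<forall>\<^sub>F x in at p. (\<Sum>i<m. (x / p) ^ i) \<noteq> 0"
    using tendsto_imp_eventually_ne[OF lim, of 0] assms by simp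
  have ne: "\<forall>\<^sub>F x in at p. x \<noteq> p" by (simp add: eventually_at_filter)
  have geo: "1 - (x / p) ^ m = (1 - x / p) * (\<Sum>i<m. (x / p) ^ i)" for x
    by (rule one_diff_power_eq)
  show "\<forall>\<^sub>F x in at p. (x / p) ^ m \<noteq> 1"
    using nz ne
  proof eventually_elim
    case (elim x)
    hence "1 - (x / p) ^ m \<noteq> 0" unfolding geo using assms by simp
    thus ?case by auto
  qed
  have "((\<lambda>x. 1 / (\<Sum>i<m. (x / p) ^ i)) \<longlongrightarrow> 1 / of_nat m) (at p)"
    using assms by (intro tendsto_intros lim) auto
  moreover have "\<forall>\<^sub>F x in at p. 1 / (\<Sum>i<m. (x / p) ^ i) = (1 - x / p) / (1 - (x / p) ^ m)"
    using ne by eventually_elim (use assms in \<open>simp add: geo\<close>)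
  ultimately show "((\<lambda>x. (1 - x / p) / (1 - (x / p) ^ m)) \<longlongrightarrow> 1 / of_nat m) (at p)"
    by (rule Lim_transform_eventually)
qed

lemma dissect_term_pole:
  assumes s: "Some (l, k) \<in> pole_index"
  defines "p \<equiv> pole (Some (l, k))"
  shows "((\<lambda>x. (1 - x / p) * dissect_term q n l x) \<longlongrightarrow>
     - (dissect_sign l * dissect_coeff q l * p powi l * \<i> / (of_nat (3 * n) * jtheta \<i> dissect_base))) (at p)"
proof -
  define W where "W = dissect_arg q n l"
  have p0: "p \<noteq> 0" using pole_nz[OF s] by (simp add: p_def)
  have m0: "0 < 3 * n" using n_pos by simp
  have pW: "p ^ (3 * n) * (W * \<i>) = 1" using pole_power[OF s] by (simp add: p_def W_def)
  \<comment> \<open>The pole equation normalises the argument, so that the factor 1 - xz of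
    \<open>appell_m_pole\<close> becomes 1 - (x/p)^(3n).\<close>
  have arg: "W * x ^ (3 * n) * \<i> = (x / p) ^ (3 * n)" for x
  proof -
    have "W * x ^ (3 * n) * \<i> = (x / p) ^ (3 * n) * (p ^ (3 * n) * (W * \<i>))"
      using p0 by (simp add: power_divide)
    thus ?thesis using pW by simp
  qed
  have "LIM x at p. W * x ^ (3 * n) :> at (inverse \<i>)"
  proof (rule filterlim_atI)
    have "((\<lambda>x. W * x ^ (3 * n)) \<longlongrightarrow> W * p ^ (3 * n)) (at p)" by (intro tendsto_intros)
    moreover have "W * p ^ (3 * n) = inverse \<i>" using pW by (metis inverse_unique mult.assoc mult.commute)
    ultimately show "((\<lambda>x. W * x ^ (3 * n)) \<longlongrightarrow> inverse \<i>) (at p)" by simp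
    show "\<forall>\<^sub>F x in at p. W * x ^ (3 * n) \<noteq> inverse \<i>"
      using geometric_ratio_tendsto(2)[OF p0 m0]
    proof eventually_elim
      case (elim x)
      show ?case
      proof
        assume "W * x ^ (3 * n) = inverse \<i>"
        hence "W * x ^ (3 * n) * \<i> = 1" by simp
        thus False using elim unfolding arg by simp
      qed
    qed
  qed
  from filterlim_compose[OF nome.appell_m_pole[OF nome_base, of \<i>] this]
  have lim: "((\<lambda>x. (1 - (x / p) ^ (3 * n)) * appell_m (W * x ^ (3 * n)) dissect_base \<i>) \<longlongrightarrow> - \<i> / jtheta \<i> dissect_base) (at p)"
    by (simp add: arg)
  have "((\<lambda>x. dissect_sign l * dissect_coeff q l * x powi l * (((1 - x / p) / (1 - (x / p) ^ (3 * n))) *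
       ((1 - (x / p) ^ (3 * n)) * appell_m (W * x ^ (3 * n)) dissect_base \<i>))) \<longlongrightarrow>
       dissect_sign l * dissect_coeff q l * p powi l * (1 / of_nat (3 * n) * (- \<i> / jtheta \<i> dissect_base))) (at p)"
    using p0 by (intro tendsto_intros lim geometric_ratio_tendsto(1)[OF p0 m0]) auto
  moreover have "\<forall>\<^sub>F x in at p. dissect_sign l * dissect_coeff q l * x powi l * (((1 - x / p) / (1 - (x / p) ^ (3 * n))) *
       ((1 - (x / p) ^ (3 * n)) * appell_m (W * x ^ (3 * n)) dissect_base \<i>)) = (1 - x / p) * dissect_term q n l x"
    using geometric_ratio_tendsto(2)[OF p0 m0]
  proof eventually_elim
    case (elim x)
    define u where "u = 1 - (x / p) ^ (3 * n)"
    have "u \<noteq> 0" using elim by (simp add: u_def)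
    hence "(1 - x / p) / u * (u * A) = (1 - x / p) * A" for A by simp
    thus ?case unfolding u_def[symmetric] dissect_term_def W_def[symmetric] dissect_base_def[symmetric]
      by (simp only: mult.left_commute)
  qed
  ultimately have "((\<lambda>x. (1 - x / p) * dissect_term q n l x) \<longlongrightarrow>
       dissect_sign l * dissect_coeff q l * p powi l * (1 / of_nat (3 * n) * (- \<i> / jtheta \<i> dissect_base))) (at p)"
    by (rule Lim_transform_eventually)
  thus ?thesis by (simp add: mult_ac)
qed

text \<open>A second singular term would have an index differing from l by a nonzero multiple of 3n,
  which the range 0, ..., 3n - 1 excludes.\<close>

lemma dissect_term_isCont_pole:
  assumes s: "Some (l, k) \<in> pole_index" and N: "N \<in> {0..<3 * int n}" "N \<noteq> l"
  shows "isCont (dissect_term q n N) (pole (Some (l, k)))"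
proof (rule dissect_term_isCont)
  show "pole (Some (l, k)) \<noteq> 0" by (rule pole_nz[OF s])
  show "jtheta (dissect_arg q n N * pole (Some (l, k)) ^ (3 * n) * \<i>) dissect_base \<noteq> 0"
  proof
    define P where "P = pole (Some (l, k)) ^ (3 * n)"
    assume j0: "jtheta (dissect_arg q n N * pole (Some (l, k)) ^ (3 * n) * \<i>) dissect_base = 0"
    have P: "P * (dissect_arg q n l * \<i>) = 1" using pole_power[OF s] by (simp add: P_def)
    hence "P \<noteq> 0" by auto
    then obtain m where m: "dissect_arg q n N * P * \<i> = q powi (3 * (int n)\<^sup>2 * m)"
      using j0 nome.jtheta_eq_0_iff[OF nome_base] dissect_arg_nz by (auto simp: base_powi P_def)
    have "P * \<i> * dissect_arg q n N = P * \<i> * (q powi (3 * (int n)\<^sup>2 * m) * dissect_arg q n l)"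
      using m P by (metis mult.assoc mult.commute mult_1_right)
    hence "dissect_arg q n N = q powi (3 * (int n)\<^sup>2 * m) * dissect_arg q n l" using \<open>P \<noteq> 0\<close> by simp
    hence "q powi (int n * (3 * int n - 1) div 2 - int n * N) =
       q powi (3 * (int n)\<^sup>2 * m) * q powi (int n * (3 * int n - 1) div 2 - int n * l)"
      unfolding dissect_arg_def by simp
    hence "int n * (3 * int n - 1) div 2 - int n * N = 3 * (int n)\<^sup>2 * m + (int n * (3 * int n - 1) div 2 - int n * l)"
      unfolding power_int_add[OF disjI1[OF q_nz], symmetric] powi_eq_iff .
    hence "int n * (l - N) = int n * (3 * int n * m)" by (simp add: algebra_simps power2_eq_square)
    hence "l - N = 3 * int n * m" using n_pos by simp
    moreover have "0 \<le> l" "l \<le> 2" "1 \<le> int n" using s n_pos by (auto simp: pole_index_def)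
    hence "0 \<le> l" "l < 3 * int n" by linarith+
    hence "\<bar>l - N\<bar> < 3 * int n" using N by auto
    ultimately have "m = 0" using n_pos by (simp add: abs_mult)
    thus False using \<open>l - N = 3 * int n * m\<close> N by simp
  qed
qed

lemma dissect_sum_isCont_1: "isCont dissect_sum 1"
proof -
  have "isCont (dissect_term q n N) 1" for N
  proof (rule dissect_term_isCont)
    show "jtheta (dissect_arg q n N * 1 ^ (3 * n) * \<i>) dissect_base \<noteq> 0"
    proof
      assume "jtheta (dissect_arg q n N * 1 ^ (3 * n) * \<i>) dissect_base = 0"
      then obtain m where "dissect_arg q n N * \<i> = q powi (3 * (int n)\<^sup>2 * m)"
        using nome.jtheta_eq_0_iff[OF nome_base] dissect_arg_nz by (auto simp: base_powi)
      hence "(-1) ^ (n + 1) * \<i> * q powi (int n * (3 * int n - 1) div 2 - int n * N) = q powi (3 * (int n)\<^sup>2 * m)"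
        by (simp add: dissect_arg_def mult_ac)
      thus False using i_powi_neq by blast
    qed
  qed simp
  thus ?thesis unfolding dissect_sum_def[abs_def] by (intro continuous_intros)
qed

lemma level3_isCont: "x \<noteq> 0 \<Longrightarrow> jtheta x q \<noteq> 0 \<Longrightarrow> isCont level3 x"
proof -
  assume x: "x \<noteq> 0" "jtheta x q \<noteq> 0"
  have "continuous_on (-{0}) (\<lambda>x. jtheta x q)"
    by (intro holomorphic_on_imp_continuous_on holomorphic_intros) auto
  hence "open (-{0} \<inter> (\<lambda>x. jtheta x q) -` (-{0}))"
    by (intro continuous_open_preimage) auto
  moreover have "-{0} \<inter> (\<lambda>x. jtheta x q) -` (-{0}) = {x. x \<noteq> 0 \<and> jtheta x q \<noteq> 0}" by auto
  ultimately show ?thesis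
    using holomorphic_on_imp_continuous_on[OF level3_holomorphic] x
    by (simp add: continuous_on_eq_continuous_at)
qed

text \<open>Without the twist by b^3 the multiplier would be q itself, which the partial fraction
  theorem excludes.\<close>

lemma jtheta_multiplier: "multiplier \<noteq> 0" "jtheta multiplier q \<noteq> 0"
proof -
  show m0: "multiplier \<noteq> 0" using q_nz b_nz by (simp add: multiplier_def)
  show "jtheta multiplier q \<noteq> 0"
  proof
    assume "jtheta multiplier q = 0"
    then obtain m where "b ^ 3 * q powi 1 = q powi m"
      using jtheta_eq_0_iff[OF m0] by (auto simp: multiplier_def mult.commute)
    hence "b ^ 3 = 1" by (rule unit_mult_powi_eq[THEN conjunct1]) (simp add: norm_b norm_power)
    hence "(b ^ 3) ^ (4 * n) = 1" by simp
    thus False using b_power by (simp flip: power_mult)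
  qed
qed

text \<open>The difference of the two sides of the dissection satisfies the homogeneous equation and
  has finitely many orbits of simple poles, so its partial fraction expansion determines it
  completely.\<close>

theorem level3_dissection:
  assumes x: "x \<in> regular_points pole_index pole" and xb: "jtheta (x / b) q \<noteq> 0"
  shows "level3 x / J = dissect_sum x + dissect_remainder x"
proof -
  define f where "f = (\<lambda>x. level3 x / J - dissect_sum x)"
  \<comment> \<open>The factor \<open>j(x/b; q)\<^sup>3\<close> turns the multiplier \<open>- q x\<^sup>3\<close> of \<open>f\<close> into the constant \<open>q b\<^sup>3\<close>.\<close>
  define g where "g = (\<lambda>x. f x * jtheta (x / b) q ^ 3)"
  have "g x = (\<Sum>s\<in>pole_index. pole_weight s *
      (J ^ 3 * jtheta (x / (multiplier * pole s)) q / (jtheta (inverse multiplier) q * jtheta (x / pole s) q)))"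
  proof (rule quasi_periodic_partial_fractions)
    show "finite pole_index" by (simp add: pole_index_def)
    show "g holomorphic_on regular_points pole_index pole"
      unfolding g_def f_def using b_nz regular_jtheta_nz J_nz
      by (intro holomorphic_intros dissect_sum_holomorphic holomorphic_on_subset[OF level3_holomorphic]) auto
    show "g (q * x) = multiplier * g x" if x: "x \<in> regular_points pole_index pole" for x
    proof -
      have x0: "x \<noteq> 0" "jtheta x q \<noteq> 0" using regular_jtheta_nz[OF x] by auto
      have "level3 (q * x) / J = - q * x ^ 3 * (level3 x / J) + (1 - q * x ^ 2)"
        unfolding level3_mult_q[OF x0] using J_nz by (simp add: add_divide_distrib diff_divide_distrib)
      hence f: "f (q * x) = - q * x ^ 3 * f x"
        unfolding f_def dissect_sum_mult_q[OF x] by (simp add: algebra_simps)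
      have j: "jtheta (q * x / b) q = - jtheta (x / b) q / (x / b)"
        using jtheta_mult_q[of "x / b"] x0 b_nz by simp
      show ?thesis unfolding g_def f j multiplier_def using x0 b_nz
        by (simp add: power3_eq_cube field_simps)
    qed
    show "((\<lambda>x. (1 - x / pole s) * g x) \<longlongrightarrow> pole_weight s) (at (pole s))" if s: "s \<in> pole_index" for s
    proof -
      \<comment> \<open>At 1 only \<open>level3\<close> is singular. At a pole with index l only the
        term l is, and it enters f with a minus sign, which reverses the sign in
        \<open>dissect_term_pole\<close>.\<close>
      have "((\<lambda>x. (1 - x / pole s) * f x) \<longlongrightarrow> (case s of None \<Rightarrow> 1 / J
          | Some (l, k) \<Rightarrow> dissect_sign l * dissect_coeff q l * pole s powi l * \<i> /
             (of_nat (3 * n) * jtheta \<i> dissect_base))) (at (pole s))"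
      proof (cases s)
        case None
        have "((\<lambda>x. (1 - x) * level3 x * (1 / J) - (1 - x) * dissect_sum x) \<longlongrightarrow> 1 * (1 / J) - (1 - 1) * dissect_sum 1) (at 1)"
          using dissect_sum_isCont_1 by (intro tendsto_intros level3_pole) (simp add: isCont_def)
        thus ?thesis unfolding None pole_def f_def by (simp add: right_diff_distrib)
      next
        case (Some lk)
        obtain l k where lk: "lk = (l, k)" by (cases lk)
        define p where "p = pole s"
        have sl: "Some (l, k) \<in> pole_index" using s Some lk by simp
        have "0 \<le> l" "l \<le> 2" "1 \<le> int n" using sl n_pos by (auto simp: pole_index_def)
        hence l: "l \<in> {0..<3 * int n}" by auto
        have p0: "p \<noteq> 0" using pole_nz[OF s] by (simp add: p_def)
        have "jtheta (pole s / pole None) q \<noteq> 0"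
          using pole_distinct[OF s, of None] Some by (auto simp: pole_index_def)
        hence c1: "isCont level3 p" using p0 by (intro level3_isCont) (auto simp: p_def pole_def[of None])
        define R where "R = (\<lambda>x. \<Sum>N\<in>{0..<3 * int n} - {l}. dissect_term q n N x)"
        have c2: "isCont R p" unfolding R_def
          using dissect_term_isCont_pole[OF sl] Some lk by (intro continuous_intros) (auto simp: p_def)
        have dec: "dissect_sum x = dissect_term q n l x + R x" for x
          unfolding dissect_sum_def R_def using l by (intro sum.remove) auto
        have t: "((\<lambda>x. (1 - x / p) * dissect_term q n l x) \<longlongrightarrow>
          - (dissect_sign l * dissect_coeff q l * p powi l * \<i> / (of_nat (3 * n) * jtheta \<i> dissect_base))) (at p)"
          using dissect_term_pole[OF sl] Some lk by (simp add: p_def)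
        have "((\<lambda>x. (1 - x / p) * (level3 x / J) - ((1 - x / p) * dissect_term q n l x
           + (1 - x / p) * R x)) \<longlongrightarrow>
           (1 - p / p) * (level3 p / J) - (- (dissect_sign l * dissect_coeff q l * p powi l * \<i> / (of_nat (3 * n) * jtheta \<i> dissect_base))
           + (1 - p / p) * R p)) (at p)"
          using p0 J_nz c1 c2 by (intro tendsto_intros t) (auto simp: isCont_def)
        moreover have "(\<lambda>x. (1 - x / p) * (level3 x / J) - ((1 - x / p) * dissect_term q n l x + (1 - x / p) * R x)) =
            (\<lambda>x. (1 - x / p) * f x)"
          by (simp only: f_def dec right_diff_distrib distrib_left)
        moreover have "(1 - p / p) * (level3 p / J) - (- E + (1 - p / p) * R p) = E" for E
          using p0 by simp
        ultimately have "((\<lambda>x. (1 - x / p) * f x) \<longlongrightarrow>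
            dissect_sign l * dissect_coeff q l * p powi l * \<i> / (of_nat (3 * n) * jtheta \<i> dissect_base)) (at p)"
          by (simp only:)
        thus ?thesis by (simp only: p_def Some lk option.case prod.case)
      qed
      moreover have "((\<lambda>x. jtheta (x / b) q ^ 3) \<longlongrightarrow> jtheta (pole s / b) q ^ 3) (at (pole s))"
        using b_nz pole_nz[OF s] by (intro tendsto_intros) auto
      ultimately have "((\<lambda>x. (1 - x / pole s) * f x * jtheta (x / b) q ^ 3) \<longlongrightarrow>
         (case s of None \<Rightarrow> 1 / J
          | Some (l, k) \<Rightarrow> dissect_sign l * dissect_coeff q l * pole s powi l * \<i> /
             (of_nat (3 * n) * jtheta \<i> dissect_base)) * jtheta (pole s / b) q ^ 3) (at (pole s))"
        by (rule tendsto_mult)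
      moreover have "(case s of None \<Rightarrow> 1 / J
          | Some (l, k) \<Rightarrow> dissect_sign l * dissect_coeff q l * pole s powi l * \<i> /
             (of_nat (3 * n) * jtheta \<i> dissect_base)) * jtheta (pole s / b) q ^ 3 = pole_weight s"
      proof (cases s)
        case None
        have "pole None / b = inverse b" by (simp add: pole_def divide_inverse)
        thus ?thesis unfolding None pole_weight_def by simp
      next
        case (Some lk)
        thus ?thesis unfolding pole_weight_def by (cases lk) simp
      qed
      ultimately show ?thesis unfolding g_def by (simp only: mult.assoc)
    qed
  qed (use pole_nz pole_distinct jtheta_multiplier x in auto)
  hence "f x = dissect_remainder x"
    using xb unfolding g_def dissect_remainder_def by (subst nonzero_eq_divide_eq) simp_all
  thus ?thesis unfolding f_def by (simp add: diff_eq_eq add.commute)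
qed

end

section \<open>The generating function of the rank\<close>

definition bounded_partitions :: "nat \<Rightarrow> nat list set" where
  "bounded_partitions k = {xs. sorted_wrt (\<ge>) xs \<and> (\<forall>x\<in>set xs. 0 < x \<and> x \<le> k)}"

lemma bounded_partitions_0: "bounded_partitions 0 = {[]}"
proof -
  have "xs = []" if "\<forall>x\<in>set xs. 0 < x \<and> x \<le> (0 :: nat)" for xs
    using that by (cases xs) auto
  thus ?thesis by (auto simp: bounded_partitions_def)
qed

text \<open>A partition is cut after its copies of the largest admissible part.\<close>

lemma bounded_partitions_Suc:
  "bij_betw (\<lambda>(c, xs). replicate c (Suc k) @ xs) (UNIV \<times> bounded_partitions k) (bounded_partitions (Suc k))"
proof (rule bij_betwI')
  fix p p' :: "nat \<times> nat list" assume p: "p \<in> UNIV \<times> bounded_partitions k" and p': "p' \<in> UNIV \<times> bounded_partitions k"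
  have count: "count_list (replicate c (Suc k) @ xs) (Suc k) = c" if "xs \<in> bounded_partitions k" for c xs
  proof -
    have "Suc k \<notin> set xs" using that by (auto simp: bounded_partitions_def)
    hence "count_list xs (Suc k) = 0" by (simp add: count_list_0_iff)
    moreover have "count_list (replicate c (Suc k)) (Suc k) = c" by (induction c) auto
    ultimately show ?thesis by simp
  qed
  show "((\<lambda>(c, xs). replicate c (Suc k) @ xs) p = (\<lambda>(c, xs). replicate c (Suc k) @ xs) p') = (p = p')"
    using p p' count by (auto split: prod.splits) (metis count, metis append_same_eq count same_append_eq)
next
  fix p :: "nat \<times> nat list" assume "p \<in> UNIV \<times> bounded_partitions k"
  show "(\<lambda>(c, xs). replicate c (Suc k) @ xs) p \<in> bounded_partitions (Suc k)"
  proof -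
    have "sorted_wrt (\<ge>) (replicate c (Suc k))" for c by (induction c) auto
    thus ?thesis using \<open>p \<in> _\<close> by (force simp: bounded_partitions_def sorted_wrt_append)
  qed
next
  fix ys assume "ys \<in> bounded_partitions (Suc k)"
  thus "\<exists>p\<in>UNIV \<times> bounded_partitions k. ys = (\<lambda>(c, xs). replicate c (Suc k) @ xs) p"
  proof (induction ys)
    case Nil
    show ?case by (intro bexI[of _ "(0, [])"]) (auto simp: bounded_partitions_def)
  next
    case (Cons y ys)
    have "ys \<in> bounded_partitions (Suc k)" using Cons.prems by (auto simp: bounded_partitions_def)
    then obtain c xs where cx: "xs \<in> bounded_partitions k" "ys = replicate c (Suc k) @ xs"
      using Cons.IH by auto
    show ?case
    proof (cases "y = Suc k")
      case True
      thus ?thesis using cx by (intro bexI[of _ "(Suc c, xs)"]) auto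
    next
      case False
      have "y # ys \<in> bounded_partitions k"
        using Cons.prems False by (fastforce simp: bounded_partitions_def)
      thus ?thesis by (intro bexI[of _ "(0, y # ys)"]) auto
    qed
  qed
qed

text \<open>Here y marks the number of parts. Absolute summability is carried along in the
  induction, since the geometric series over the multiplicity of the largest part is summed together
  with the rest.\<close>

lemma bounded_partitions_gf:
  fixes q y :: complex
  assumes q: "norm q < 1" and y: "norm y \<le> 1"
  shows "(\<lambda>xs. norm (y ^ length xs * q ^ sum_list xs)) summable_on bounded_partitions k"
    and "((\<lambda>xs. y ^ length xs * q ^ sum_list xs) has_sum (\<Prod>i<k. 1 / (1 - y * q ^ Suc i))) (bounded_partitions k)"
proof (induction k)
  case 0
  {
    case 1 show ?case by (simp add: bounded_partitions_0)
  next
    case 2 show ?case by (simp add: bounded_partitions_0 has_sum_finite_iff)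
  }
next
  case (Suc k)
  define f where "f = (\<lambda>xs. y ^ length xs * q ^ sum_list xs)"
  define r where "r = y * q ^ Suc k"
  have r: "norm r < 1"
  proof -
    have "norm r \<le> 1 * norm q ^ Suc k"
      unfolding r_def norm_mult norm_power using y by (intro mult_right_mono) auto
    also have "\<dots> < 1" using q by (simp add: power_less_one_iff del: power_Suc)
    finally show ?thesis .
  qed
  define g where "g = (\<lambda>(c::nat, xs). r ^ c * f xs)"
  have fg: "f ((\<lambda>(c, xs). replicate c (Suc k) @ xs) p) = g p" for p
    by (cases p) (simp add: f_def g_def r_def power_add power_mult_distrib sum_list_replicate
        flip: power_mult add: mult.commute)
  have abs: "(\<lambda>p. norm (g p)) summable_on (UNIV \<times> bounded_partitions k)"
  proof (rule summable_on_SigmaI)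
    fix c :: nat
    show "((\<lambda>xs. norm (g (c, xs))) has_sum norm r ^ c * (\<Sum>\<^sub>\<infinity>xs\<in>bounded_partitions k. norm (f xs))) (bounded_partitions k)"
      unfolding g_def prod.case norm_mult norm_power using Suc.IH(1)
      by (intro has_sum_cmult_right has_sum_infsum) (simp add: f_def norm_mult)
  next
    have "(\<lambda>c. norm r ^ c) summable_on (UNIV :: nat set)"
      using r by (subst summable_on_UNIV_nonneg_real_iff) (auto intro!: summable_geometric)
    thus "(\<lambda>c. norm r ^ c * (\<Sum>\<^sub>\<infinity>xs\<in>bounded_partitions k. norm (f xs))) summable_on (UNIV :: nat set)"
      by (rule summable_on_cmult_left)
  qed auto
  have geo: "((\<lambda>c. r ^ c) has_sum 1 / (1 - r)) (UNIV :: nat set)"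
    using r geometric_sums[OF r] by (intro norm_summable_imp_has_sum) (auto simp: norm_power intro!: summable_geometric)
  have "(g has_sum (1 / (1 - r) * (\<Prod>i<k. 1 / (1 - y * q ^ Suc i)))) (UNIV \<times> bounded_partitions k)"
  proof (rule has_sum_SigmaI)
    fix c :: nat
    show "((\<lambda>xs. g (c, xs)) has_sum r ^ c * (\<Prod>i<k. 1 / (1 - y * q ^ Suc i))) (bounded_partitions k)"
      unfolding g_def prod.case f_def by (intro has_sum_cmult_right Suc.IH(2))
  next
    show "((\<lambda>c. r ^ c * (\<Prod>i<k. 1 / (1 - y * q ^ Suc i))) has_sum (1 / (1 - r) * (\<Prod>i<k. 1 / (1 - y * q ^ Suc i)))) UNIV"
      by (intro has_sum_cmult_left geo)
    show "g summable_on (UNIV \<times> bounded_partitions k)" using abs by (rule abs_summable_summable)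
  qed
  moreover have "1 / (1 - r) * (\<Prod>i<k. 1 / (1 - y * q ^ Suc i)) = (\<Prod>i<Suc k. 1 / (1 - y * q ^ Suc i))"
    by (simp add: r_def mult.commute)
  ultimately have sum: "(g has_sum (\<Prod>i<Suc k. 1 / (1 - y * q ^ Suc i))) (UNIV \<times> bounded_partitions k)" by (simp only:)
  {
    case 1
    show ?case
      using summable_on_reindex_bij_betw[OF bounded_partitions_Suc[of k], of "\<lambda>xs. norm (f xs)"] abs
      by (simp add: fg) (simp add: f_def)
  next
    case 2
    show ?case
      using has_sum_reindex_bij_betw[OF bounded_partitions_Suc[of k], of f] sum
      by (simp add: fg) (simp add: f_def)
  }
qed

definition all_partitions :: "nat list set" where
  "all_partitions = {xs. sorted_wrt (\<ge>) xs \<and> (\<forall>x\<in>set xs. 0 < x)}"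

text \<open>The head is the largest part m + 1, so the rank becomes m minus the number of the other
  parts.\<close>

lemma nonempty_partitions_bij:
  "bij_betw (\<lambda>(m, xs). Suc m # xs) (Sigma UNIV (\<lambda>m. bounded_partitions (Suc m))) (all_partitions - {[]})"
proof (rule bij_betwI')
  fix ys assume "ys \<in> all_partitions - {[]}"
  then obtain y xs where ys: "ys = y # xs" "y # xs \<in> all_partitions" by (cases ys) auto
  hence "(y - 1, xs) \<in> Sigma UNIV (\<lambda>m. bounded_partitions (Suc m))" "Suc (y - 1) = y"
    by (auto simp: all_partitions_def bounded_partitions_def)
  thus "\<exists>p\<in>Sigma UNIV (\<lambda>m. bounded_partitions (Suc m)). ys = (\<lambda>(m, xs). Suc m # xs) p"
    using ys by (intro bexI[of _ "(y - 1, xs)"]) auto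
qed (auto simp: all_partitions_def bounded_partitions_def)

lemma partition_rank_Cons:
  assumes "xs \<in> bounded_partitions (Suc m)"
  shows "partition_rank (Suc m # xs) = int m - int (length xs)"
proof -
  have "Max (insert (Suc m) (set xs)) = Suc m"
    using assms by (intro Max_eqI) (auto simp: bounded_partitions_def)
  thus ?thesis by (simp add: partition_rank_def)
qed

lemma finite_partitions_of: "finite (partitions_of n)"
proof (rule finite_subset)
  show "partitions_of n \<subseteq> {xs. set xs \<subseteq> {..n} \<and> length xs \<le> n}"
  proof
    fix xs assume "xs \<in> partitions_of n"
    hence xs: "\<forall>x\<in>set xs. 0 < x" "sum_list xs = n" by (auto simp: partitions_of_def)
    have "length xs \<le> sum_list xs" using xs(1) by (induction xs) (auto simp: Suc_le_eq add_strict_increasing)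
    moreover have "x \<le> sum_list xs" if "x \<in> set xs" for x using that member_le_sum_list by blast
    ultimately show "xs \<in> {xs. set xs \<subseteq> {..n} \<and> length xs \<le> n}" using xs(2) by auto
  qed
  show "finite {xs. set xs \<subseteq> {..n} \<and> length xs \<le> n}" by (rule finite_lists_length_le) simp
qed

section \<open>Summation over the largest part, and the Rogers-Fine iteration\<close>

context nome
begin

text \<open>Each factor has modulus at least 1 - |q|^j, and prefixing the missing factors, all at
  most 1, reduces to the partial products of (|q|;|q|), which are bounded below.\<close>

lemma norm_qpoch_lower_bound:
  obtains c where "0 < c" "\<And>z N m. norm z = 1 \<Longrightarrow> c \<le> norm (qpoch (q ^ Suc N * z) q m)"
proof -
  define r where "r = norm q"
  interpret R: nome "of_real r" using q_nz q_lt1 by unfold_locales (auto simp: r_def)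
  have r: "0 < r" "r < 1" using q_nz q_lt1 by (auto simp: r_def)
  obtain C where C: "C > 0" "\<And>k. norm (R.rq k) \<le> C" using R.rq_bounded by blast
  have f: "0 \<le> 1 - r ^ Suc i" "1 - r ^ Suc i \<le> 1" "0 < 1 - r ^ Suc i" for i
    using r by (auto simp: power_le_one power_Suc_less_one simp del: power_Suc)
  have rr: "qpoch (of_real r) (of_real r) n = of_real (\<Prod>i<n. 1 - r ^ Suc i)" for n
    by (simp add: qpoch_def)
  have pos: "0 < (\<Prod>i<n. 1 - r ^ Suc i)" for n by (intro prod_pos f) 
  have low: "1 / C \<le> (\<Prod>i<n. 1 - r ^ Suc i)" for n
  proof -
    have "norm (1 / complex_of_real (\<Prod>i<n. 1 - r ^ Suc i)) \<le> C"
      using C(2)[of "int n"] unfolding R.rq_of_nat rr .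
    hence "1 / (\<Prod>i<n. 1 - r ^ Suc i) \<le> C"
      using pos[of n] by (simp only: norm_divide norm_of_real norm_one abs_of_pos)
    thus ?thesis using pos[of n] C(1) by (simp add: field_simps)
  qed
  show ?thesis
  proof (rule that[of "1 / C"])
    show "0 < 1 / C" using C by simp
    fix z :: complex and N m assume z: "norm z = 1"
    have "1 / C \<le> (\<Prod>i<N + m. 1 - r ^ Suc i)" by (rule low)
    also have "\<dots> = (\<Prod>i<N. 1 - r ^ Suc i) * (\<Prod>i<m. 1 - r ^ Suc (N + i))"
      by (induction m) (simp_all add: mult_ac)
    also have "\<dots> \<le> 1 * (\<Prod>i<m. 1 - r ^ Suc (N + i))"
      by (intro mult_right_mono prod_le_1 prod_nonneg) (use f in auto)
    also have "\<dots> \<le> (\<Prod>i<m. norm (1 - q ^ Suc N * z * q ^ i))"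
    proof -
      have "(\<Prod>i<m. 1 - r ^ Suc (N + i)) \<le> (\<Prod>i<m. norm (1 - q ^ Suc N * z * q ^ i))"
      proof (intro prod_mono conjI)
        fix i
        show "0 \<le> 1 - r ^ Suc (N + i)" by (rule f)
        have "norm (q ^ Suc N * z * q ^ i) = r ^ Suc (N + i)"
          using z by (simp add: norm_mult norm_power r_def power_add)
        thus "1 - r ^ Suc (N + i) \<le> norm (1 - q ^ Suc N * z * q ^ i)"
          using norm_triangle_ineq2[of 1 "q ^ Suc N * z * q ^ i"] by simp
      qed
      thus ?thesis by simp
    qed
    finally show "1 / C \<le> norm (qpoch (q ^ Suc N * z) q m)" by (simp add: qpoch_def prod_norm)
  qed
qed

text \<open>At N = 0 this is the generating function of the partitions with largest part m + 1, with
  x marking the rank; N counts the steps of the Rogers-Fine iteration.\<close>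

definition fine_term :: "complex \<Rightarrow> nat \<Rightarrow> nat \<Rightarrow> complex" where
  "fine_term x N m = x ^ m * q ^ (Suc m * Suc N) / qpoch (q ^ Suc N * inverse x) q (Suc m)"

lemma fine_term_bound:
  obtains C where "0 < C" "\<And>x N m. norm x = 1 \<Longrightarrow> norm (fine_term x N m) \<le> C * norm q ^ m"
proof -
  obtain c where c: "0 < c" "\<And>z N m. norm z = 1 \<Longrightarrow> c \<le> norm (qpoch (q ^ Suc N * z) q m)"
    using norm_qpoch_lower_bound by blast
  show ?thesis
  proof (rule that[of "1 / c"])
    fix x :: complex and N m assume x: "norm x = 1"
    have "norm q ^ (Suc m * Suc N) \<le> norm q ^ m" using q_lt1 by (intro power_decreasing) auto
    hence "norm (fine_term x N m) \<le> norm q ^ m / c"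
      unfolding fine_term_def norm_divide norm_mult norm_power x
      using c(1) c(2)[of "inverse x" N "Suc m"] x by (intro frac_le) (auto simp: norm_inverse)
    thus "norm (fine_term x N m) \<le> 1 / c * norm q ^ m" by simp
  qed (use c in auto)
qed

lemma fine_term_summable:
  assumes "norm x = 1"
  shows "summable (\<lambda>m. norm (fine_term x N m))"
proof -
  obtain C where C: "0 < C" "\<And>x N m. norm x = 1 \<Longrightarrow> norm (fine_term x N m) \<le> C * norm q ^ m"
    using fine_term_bound by blast
  show ?thesis
    by (rule summable_comparison_test'[of "\<lambda>m. C * norm q ^ m"])
      (use C assms q_lt1 in \<open>auto intro!: summable_mult summable_geometric\<close>)
qed

lemma one_minus_unit_nz: "norm z = 1 \<Longrightarrow> 1 - q ^ Suc N * z \<noteq> 0"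
proof
  assume "norm z = 1" "1 - q ^ Suc N * z = 0"
  hence "norm q ^ Suc N = 1" by (metis eq_iff_diff_eq_0 mult.right_neutral norm_mult norm_one norm_power)
  thus False using power_Suc_less_one[OF norm_q_pos q_lt1, of N] by simp
qed

text \<open>One step of the Rogers-Fine identity. It extracts one pair of denominator factors and
  raises N by one.\<close>

lemma fine_recurrence:
  assumes x: "norm x = 1"
  shows "(\<Sum>m. fine_term x N m) = q ^ Suc N / ((1 - q ^ Suc N * inverse x) * (1 - q ^ Suc N * x)) *
      (1 + q ^ Suc N * (\<Sum>m. fine_term x (Suc N) m))"
proof -
  have x0: "x \<noteq> 0" using x by auto
  have xi: "norm (inverse x) = 1" using x by (simp add: norm_inverse)
  define A B where "A = 1 - q ^ Suc N * inverse x" and "B = 1 - q ^ Suc N * x"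
  have AB: "A \<noteq> 0" "B \<noteq> 0" using one_minus_unit_nz x xi by (auto simp: A_def B_def)
  define G where "G = (\<lambda>N. \<Sum>m. fine_term x N m)"
  have sm: "summable (fine_term x N)" for N
    using fine_term_summable[OF x] by (rule summable_norm_cancel)
  \<comment> \<open>Split 1 = (1 - u) + u, where 1 - u is the last factor of the denominator. The
    first part cancels it and leaves index m; in the second part the first factor A is pulled out,
    which raises N.\<close>
  have rec: "fine_term x N (Suc m) = q ^ Suc N * x * fine_term x N m + q ^ (2 * N + 2) / A * fine_term x (Suc N) m" for m
  proof -
    define P where "P = qpoch (q ^ Suc N * inverse x) q (Suc m)"
    define u where "u = q ^ Suc N * inverse x * q ^ Suc m"
    have nz: "1 - q ^ Suc N * inverse x * q ^ i \<noteq> 0" for i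
      using one_minus_unit_nz[OF xi, of "N + i"] by (simp add: power_add mult_ac)
    have u: "1 - u \<noteq> 0" unfolding u_def by (rule nz)
    have P2: "qpoch (q ^ Suc N * inverse x) q (Suc (Suc m)) = P * (1 - u)"
      by (subst qpoch_Suc) (simp add: P_def u_def)
    have P3: "A * qpoch (q ^ Suc (Suc N) * inverse x) q (Suc m) = P * (1 - u)"
      unfolding P2[symmetric] using qpoch_Suc'[of "q ^ Suc N * inverse x" "Suc m"] by (simp add: A_def mult_ac)
    have e1: "fine_term x N (Suc m) = x ^ Suc m * q ^ (Suc (Suc m) * Suc N) / (P * (1 - u))"
      unfolding fine_term_def P2 ..
    have e2: "q ^ Suc N * x * fine_term x N m = x ^ Suc m * q ^ (Suc (Suc m) * Suc N) * (1 - u) / (P * (1 - u))"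
      unfolding fine_term_def P_def[symmetric] using u by (simp add: power_add mult_ac)
    have e3: "q ^ (2 * N + 2) / A * fine_term x (Suc N) m = x ^ m * (q ^ (2 * N + 2) * q ^ (Suc m * Suc (Suc N))) / (P * (1 - u))"
      unfolding fine_term_def P3[symmetric] by simp
    have e4: "x ^ m * (q ^ (2 * N + 2) * q ^ (Suc m * Suc (Suc N))) = x ^ Suc m * q ^ (Suc (Suc m) * Suc N) * u"
    proof -
      have "2 * N + 2 + Suc m * Suc (Suc N) = Suc (Suc m) * Suc N + (Suc N + Suc m)" by simp
      hence "q ^ (2 * N + 2) * q ^ (Suc m * Suc (Suc N)) = q ^ (Suc (Suc m) * Suc N) * (q ^ Suc N * q ^ Suc m)"
        by (simp only: power_add[symmetric])
      thus ?thesis using x0 by (simp only: u_def power_Suc) (simp add: field_simps)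
    qed
    have "a / p = a * (1 - u) / p + a * u / p" for a p by (simp add: add_divide_distrib[symmetric] algebra_simps)
    thus ?thesis unfolding e1 e2 e3 e4 .
  qed
  have "G N = fine_term x N 0 + (\<Sum>m. fine_term x N (Suc m))"
    using suminf_split_head[OF sm] by (simp add: G_def)
  also have "(\<Sum>m. fine_term x N (Suc m)) = q ^ Suc N * x * G N + q ^ (2 * N + 2) / A * G (Suc N)"
    unfolding rec G_def
    by (rule sums_unique[symmetric], intro sums_add sums_mult summable_sums sm)
  also have "fine_term x N 0 = q ^ Suc N / A" by (simp add: fine_term_def qpoch_Suc A_def)
  finally have "B * G N = q ^ Suc N / A + q ^ (2 * N + 2) / A * G (Suc N)"
    by (simp add: B_def algebra_simps)
  also have "q ^ (2 * N + 2) = q ^ Suc N * q ^ Suc N"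
  proof -
    have "2 * N + 2 = Suc N + Suc N" by simp
    thus ?thesis by (simp only: power_add)
  qed
  also have "q ^ Suc N / A + q ^ Suc N * q ^ Suc N / A * G (Suc N) = q ^ Suc N / A * (1 + q ^ Suc N * G (Suc N))"
    by (simp add: algebra_simps)
  finally have "G N = q ^ Suc N / A * (1 + q ^ Suc N * G (Suc N)) / B" using AB by (simp add: field_simps)
  thus ?thesis unfolding G_def A_def[symmetric] B_def[symmetric] by simp
qed

definition rank_gf :: "complex \<Rightarrow> complex" where
  "rank_gf x = 1 + (\<Sum>m. fine_term x 0 m)"

text \<open>Iterating \<open>fine_recurrence\<close> turns the series over the largest part into the
  series over Durfee squares, with a remainder that tends to 0. The latter is 1 - x times the series
  of \<open>universal_mock_theta_level3\<close>.\<close>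

theorem rank_gf_level3:
  assumes x: "norm x = 1" "x \<noteq> 1"
  shows "rank_gf x = (1 - x) * level3 x / J"
proof -
  have x0: "x \<noteq> 0" using x by auto
  have xi: "norm (inverse x) = 1" using x by (simp add: norm_inverse)
  have jx: "jtheta x q \<noteq> 0"
    using jtheta_eq_0_iff[OF x0] unit_mult_powi_eq[of x 0] x by auto
  define G where "G = (\<lambda>N. \<Sum>m. fine_term x N m)"
  define e where "e = (\<lambda>n. q ^ (n ^ 2) / (qpoch (q * x) q n * qpoch (q * inverse x) q n))"
  have step: "e N * q ^ N * G N = e (Suc N) + e (Suc N) * q ^ Suc N * G (Suc N)" for N
  proof -
    have eS: "e (Suc N) = e N * q ^ N * (q ^ Suc N / ((1 - q ^ Suc N * inverse x) * (1 - q ^ Suc N * x)))"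
    proof -
      have "(Suc N)\<^sup>2 = N\<^sup>2 + N + Suc N" by (simp add: power2_eq_square)
      thus ?thesis unfolding e_def qpoch_Suc by (simp add: power_add mult_ac)
    qed
    show ?thesis unfolding eS G_def fine_recurrence[OF x(1), of N] by (simp add: distrib_left mult.assoc)
  qed
  have tele: "rank_gf x = (\<Sum>n<Suc N. e n) + e N * q ^ N * G N" for N
  proof (induction N)
    case 0
    thus ?case by (simp add: rank_gf_def G_def e_def)
  next
    case (Suc N)
    thus ?case using step[of N] by simp
  qed
  obtain c where c: "0 < c" "\<And>z N m. norm z = 1 \<Longrightarrow> c \<le> norm (qpoch (q ^ Suc N * z) q m)"
    using norm_qpoch_lower_bound by blast
  obtain C where C: "0 < C" "\<And>x N m. norm x = 1 \<Longrightarrow> norm (fine_term x N m) \<le> C * norm q ^ m"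
    using fine_term_bound by blast
  define D where "D = (\<Sum>m. C * norm q ^ m)"
  have GD: "norm (G N) \<le> D" for N
  proof -
    have "norm (G N) \<le> (\<Sum>m. norm (fine_term x N m))"
      unfolding G_def by (rule summable_norm[OF fine_term_summable[OF x(1)]])
    also have "\<dots> \<le> D" unfolding D_def
      using C x q_lt1 by (intro suminf_le fine_term_summable summable_mult summable_geometric) auto
    finally show ?thesis .
  qed
  have eb: "norm (e N) \<le> 1 / (c * c)" for N
    unfolding e_def norm_divide norm_mult norm_power
    using c(1) c(2)[of x 0 N] c(2)[of "inverse x" 0 N] x xi q_lt1
    by (intro frac_le mult_mono power_le_one) auto
  have lim0: "(\<lambda>N. e N * q ^ N * G N) \<longlonglongrightarrow> 0"
  proof (rule Lim_null_comparison)
    show "\<forall>\<^sub>F N in sequentially. norm (e N * q ^ N * G N) \<le> 1 / (c * c) * norm q ^ N * D"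
    proof (intro always_eventually allI)
      fix N
      have "norm (e N) * norm q ^ N * norm (G N) \<le> 1 / (c * c) * norm q ^ N * D"
        using eb GD c by (intro mult_mono) auto
      thus "norm (e N * q ^ N * G N) \<le> 1 / (c * c) * norm q ^ N * D" by (simp add: norm_mult norm_power)
    qed
    have "(\<lambda>N. 1 / (c * c) * norm q ^ N * D) \<longlonglongrightarrow> 1 / (c * c) * 0 * D"
      using q_lt1 by (intro tendsto_intros LIMSEQ_power_zero) auto
    thus "(\<lambda>N. 1 / (c * c) * norm q ^ N * D) \<longlonglongrightarrow> 0" by simp
  qed
  have "(\<lambda>n. (1 - x) * (q ^ (n ^ 2) / (qpoch x q (n + 1) * qpoch (q / x) q n))) sums ((1 - x) * (level3 x / J))"
    by (intro sums_mult has_sum_imp_sums universal_mock_theta_level3 x0 jx)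
  moreover have "(1 - x) * (q ^ (n ^ 2) / (qpoch x q (n + 1) * qpoch (q / x) q n)) = e n" for n
    using qpoch_Suc'[of x n] x by (simp add: e_def divide_inverse)
  ultimately have "e sums ((1 - x) * (level3 x / J))" by simp
  hence "(\<lambda>N. \<Sum>n<Suc N. e n) \<longlonglongrightarrow> (1 - x) * (level3 x / J)"
    unfolding sums_def by (rule LIMSEQ_Suc)
  from tendsto_add[OF this lim0]
  have "(\<lambda>N. rank_gf x) \<longlonglongrightarrow> (1 - x) * (level3 x / J)" unfolding tele[symmetric] by simp
  from LIMSEQ_unique[OF tendsto_const this] show ?thesis by simp
qed

text \<open>All nonempty partitions are summed by their largest part and regrouped by their size.
  Regrouping is legitimate because |x| = 1 reduces absolute convergence to the case x = 1 with base
  |q|.\<close>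

lemma partition_rank_sums:
  assumes x: "norm x = 1"
  shows "(\<lambda>n. (\<Sum>xs\<in>partitions_of n. x powi partition_rank xs) * q ^ n) sums rank_gf x"
proof -
  have x0: "x \<noteq> 0" using x by auto
  have xi: "norm (inverse x) = 1" using x by (simp add: norm_inverse)
  define F where "F = (\<lambda>xs. x powi partition_rank xs * q ^ sum_list xs)"
  define h where "h = (\<lambda>(m, xs). F (Suc m # xs))"
  define S where "S = Sigma (UNIV :: nat set) (\<lambda>m. bounded_partitions (Suc m))"
  have Fm: "F (Suc m # xs) = x ^ m * q ^ Suc m * (inverse x ^ length xs * q ^ sum_list xs)"
    if "xs \<in> bounded_partitions (Suc m)" for m xs
    unfolding F_def partition_rank_Cons[OF that] using x0
    by (simp add: power_int_diff power_add divide_inverse power_inverse mult_ac)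
  have inner: "((\<lambda>xs. F (Suc m # xs)) has_sum fine_term x 0 m) (bounded_partitions (Suc m))" for m
  proof -
    have "((\<lambda>xs. x ^ m * q ^ Suc m * (inverse x ^ length xs * q ^ sum_list xs)) has_sum
        x ^ m * q ^ Suc m * (\<Prod>i<Suc m. 1 / (1 - inverse x * q ^ Suc i))) (bounded_partitions (Suc m))"
      using q_lt1 xi by (intro has_sum_cmult_right bounded_partitions_gf(2)) auto
    also have "x ^ m * q ^ Suc m * (\<Prod>i<Suc m. 1 / (1 - inverse x * q ^ Suc i)) = fine_term x 0 m"
      unfolding fine_term_def qpoch_def prod_dividef by (simp add: mult_ac)
    finally show ?thesis using Fm by (simp cong: has_sum_cong)
  qed
  \<comment> \<open>These products are the values of \<open>rq\<close> for the base |q|, which are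
    bounded.\<close>
  obtain K where K: "\<And>m. (\<Prod>i<m. 1 / (1 - norm q ^ Suc i)) \<le> K"
  proof -
    interpret R: nome "of_real (norm q)" using q_nz q_lt1 by unfold_locales auto
    obtain C where C: "C > 0" "\<And>k. norm (R.rq k) \<le> C" using R.rq_bounded by blast
    have f: "0 < 1 - norm q ^ Suc i" for i
      using q_nz q_lt1 by (auto simp: power_Suc_less_one simp del: power_Suc)
    have "(\<Prod>i<m. 1 / (1 - norm q ^ Suc i)) \<le> C" for m
    proof -
      have "R.rq (int m) = of_real (\<Prod>i<m. 1 / (1 - norm q ^ Suc i))"
        unfolding R.rq_of_nat qpoch_def by (simp add: prod_dividef)
      moreover have "0 \<le> (\<Prod>i<m. 1 / (1 - norm q ^ Suc i))" using f by (intro prod_nonneg) (simp add: less_imp_le)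
      ultimately show ?thesis using C(2)[of "int m"] by (simp only: norm_of_real abs_of_nonneg)
    qed
    thus ?thesis using that by blast
  qed
  have Fnorm: "norm (F (Suc m # xs)) = norm q ^ Suc m * norm (1 ^ length xs * of_real (norm q) ^ sum_list xs :: complex)"
    if "xs \<in> bounded_partitions (Suc m)" for m xs
    unfolding Fm[OF that] using x xi by (simp add: norm_mult norm_power)
  have nsum: "((\<lambda>xs. norm (1 ^ length xs * of_real (norm q) ^ sum_list xs :: complex)) has_sum
      (\<Prod>i<k. 1 / (1 - norm q ^ Suc i))) (bounded_partitions k)" for k
  proof -
    have "((\<lambda>xs. 1 ^ length xs * complex_of_real (norm q) ^ sum_list xs) has_sum
        (\<Prod>i<k. 1 / (1 - 1 * complex_of_real (norm q) ^ Suc i))) (bounded_partitions k)"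
      using q_lt1 by (intro bounded_partitions_gf(2)) auto
    hence "((\<lambda>xs. complex_of_real (norm q ^ sum_list xs)) has_sum
        complex_of_real (\<Prod>i<k. 1 / (1 - norm q ^ Suc i))) (bounded_partitions k)" by simp
    hence "((\<lambda>xs. norm q ^ sum_list xs) has_sum (\<Prod>i<k. 1 / (1 - norm q ^ Suc i))) (bounded_partitions k)"
      by (simp only: has_sum_of_real_iff)
    thus ?thesis by (simp add: norm_power)
  qed
  have abs: "(\<lambda>p. norm (h p)) summable_on S"
    unfolding S_def
  proof (rule summable_on_SigmaI)
    fix m :: nat
    have "((\<lambda>xs. norm q ^ Suc m * norm (1 ^ length xs * of_real (norm q) ^ sum_list xs :: complex)) has_sum
      norm q ^ Suc m * (\<Prod>i<Suc m. 1 / (1 - norm q ^ Suc i))) (bounded_partitions (Suc m))"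
      by (intro has_sum_cmult_right nsum)
    thus "((\<lambda>xs. norm (h (m, xs))) has_sum norm q ^ Suc m * (\<Prod>i<Suc m. 1 / (1 - norm q ^ Suc i))) (bounded_partitions (Suc m))"
      unfolding h_def prod.case by (rule has_sum_cong[THEN iffD2, rotated]) (rule Fnorm)
  next
    have "(\<lambda>m. norm q ^ m) summable_on (UNIV :: nat set)"
      using q_lt1 by (subst summable_on_UNIV_nonneg_real_iff) (auto intro!: summable_geometric)
    from summable_on_cmult_left[OF this, of "norm q * K"]
    have "(\<lambda>m. norm q ^ Suc m * K) summable_on UNIV" by (simp add: mult_ac)
    thus "(\<lambda>m. norm q ^ Suc m * (\<Prod>i<Suc m. 1 / (1 - norm q ^ Suc i))) summable_on UNIV"
      by (rule summable_on_comparison_test)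
        (use q_lt1 in \<open>auto intro!: mult_left_mono K mult_nonneg_nonneg prod_nonneg simp: power_le_one simp del: power_Suc prod.lessThan_Suc\<close>)
  qed auto
  have hS: "(h has_sum (\<Sum>m. fine_term x 0 m)) S"
    unfolding S_def
  proof (rule has_sum_SigmaI)
    fix m show "((\<lambda>xs. h (m, xs)) has_sum fine_term x 0 m) (bounded_partitions (Suc m))"
      unfolding h_def prod.case by (rule inner)
  next
    show "(fine_term x 0 has_sum (\<Sum>m. fine_term x 0 m)) UNIV"
      by (rule norm_summable_imp_has_sum[OF fine_term_summable[OF x]
            summable_sums[OF summable_norm_cancel[OF fine_term_summable[OF x]]]])
    show "h summable_on Sigma UNIV (\<lambda>m. bounded_partitions (Suc m))"
      using abs unfolding S_def by (rule abs_summable_summable)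
  qed
  have hF: "h = (\<lambda>p. F ((\<lambda>(m, xs). Suc m # xs) p))" by (auto simp: h_def fun_eq_iff)
  have Fsum: "(F has_sum (\<Sum>m. fine_term x 0 m)) (all_partitions - {[]})"
    by (rule has_sum_reindex_bij_betw[OF nonempty_partitions_bij, THEN iffD1])
      (rule hS[unfolded S_def hF])
  have "(F has_sum (F [] + (\<Sum>m. fine_term x 0 m))) (insert [] (all_partitions - {[]}))"
    by (rule has_sum_insert[OF _ Fsum]) simp
  moreover have "insert [] (all_partitions - {[]}) = all_partitions" by (auto simp: all_partitions_def)
  moreover have "F [] = 1" by (simp add: F_def partition_rank_def)
  ultimately have tot: "(F has_sum rank_gf x) all_partitions" by (simp add: rank_gf_def)
  have bij: "bij_betw snd (Sigma UNIV partitions_of) all_partitions"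
    by (rule bij_betwI[of _ _ _ "\<lambda>xs. (sum_list xs, xs)"]) (auto simp: partitions_of_def all_partitions_def)
  have "((\<lambda>p. F (snd p)) has_sum rank_gf x) (Sigma UNIV partitions_of)"
    using has_sum_reindex_bij_betw[OF bij, of F] tot by simp
  hence "((\<lambda>n. \<Sum>xs\<in>partitions_of n. F xs) has_sum rank_gf x) UNIV"
    by (rule has_sum_SigmaD) (auto intro!: has_sum_finite finite_partitions_of)
  moreover have "(\<Sum>xs\<in>partitions_of n. F xs) = (\<Sum>xs\<in>partitions_of n. x powi partition_rank xs) * q ^ n" for n
    unfolding sum_distrib_right by (intro sum.cong) (auto simp: F_def partitions_of_def)
  ultimately show ?thesis using has_sum_imp_sums by simp
qed

end

section \<open>Extraction of a residue class of ranks by roots of unity\<close>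

definition zeta :: "int \<Rightarrow> nat \<Rightarrow> complex" where
  "zeta M j = cis (2 * pi * real j / real_of_int M)"

lemma norm_zeta: "norm (zeta M j) = 1" and zeta_nz: "zeta M j \<noteq> 0"
  by (auto simp: zeta_def)

lemma zeta_powi: "zeta M j powi k = cis (2 * pi * real j * of_int k / of_int M)"
  by (simp add: zeta_def cis_power_int mult_ac)

lemma zeta_power_order: "1 \<le> M \<Longrightarrow> zeta M j powi M = 1"
proof -
  assume "1 \<le> M"
  hence "2 * pi * real j * of_int M / of_int M = 2 * pi * of_nat j" by simp
  thus ?thesis unfolding zeta_powi by (simp only:) (rule cis_multiple_2pi, rule Ints_of_nat)
qed

lemma zeta_orthogonality:
  assumes M: "1 \<le> M"
  shows "(\<Sum>j<nat M. zeta M j powi k) = (if M dvd k then of_int M else 0)"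
proof -
  define w where "w = cis (2 * pi * of_int k / of_int M)"
  have wj: "zeta M j powi k = w ^ j" for j
    unfolding zeta_powi w_def Complex.DeMoivre by (simp add: mult_ac)
  have wM: "w ^ nat M = 1"
  proof -
    have "real (nat M) * (2 * pi * of_int k / of_int M) = 2 * pi * of_int k" using M by simp
    thus ?thesis unfolding w_def Complex.DeMoivre by (simp only:) (rule cis_multiple_2pi, rule Ints_of_int)
  qed
  have w1: "w = 1 \<longleftrightarrow> M dvd k"
  proof
    assume "M dvd k"
    then obtain l where "k = M * l" by blast
    hence "2 * pi * of_int k / of_int M = 2 * pi * of_int l" using M by simp
    thus "w = 1" unfolding w_def by (simp only:) (rule cis_multiple_2pi, rule Ints_of_int)
  next
    assume "w = 1"
    hence "cos (2 * pi * of_int k / of_int M) = 1" by (metis Re_complex_of_real cis.sel(1) w_def of_real_1 one_complex.sel(1))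
    then obtain n :: int where "2 * pi * of_int k / of_int M = of_int n * 2 * pi"
      using cos_one_2pi_int by blast
    hence "2 * pi * of_int k = 2 * pi * (of_int n * of_int M)" using M by (simp add: field_simps)
    hence "real_of_int k = of_int n * of_int M" by simp
    hence "k = n * M" by (simp flip: of_int_mult)
    thus "M dvd k" by simp
  qed
  show ?thesis
  proof (cases "M dvd k")
    case True
    thus ?thesis using w1 M by (simp add: wj)
  next
    case False
    thus ?thesis using w1 wM by (simp add: wj sum_gp_strict)
  qed
qed

lemma zeta_neq_1: "1 \<le> M \<Longrightarrow> 0 < j \<Longrightarrow> j < nat M \<Longrightarrow> zeta M j \<noteq> 1"
proof
  assume M: "1 \<le> M" "0 < j" "j < nat M" "zeta M j = 1"
  have "j = 0" using cis_root_of_unity_inj[of "nat M" j 0] M by (simp add: zeta_def)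
  thus False using M by simp
qed

text \<open>The trivial root of unity contributes exactly p(n)/M, which the deviation subtracts; at
  the other roots \<open>rank_gf_level3\<close> applies.\<close>

theorem rank_deviation_level3:
  assumes M: "1 \<le> M" and q: "nome q"
  shows "rank_deviation a M q =
    1 / of_int M * (\<Sum>j\<in>{1..<nat M}. zeta M j powi (- a) * ((1 - zeta M j) * (nome.level3 q (zeta M j) / nome.J q)))"
proof -
  interpret nome q by (rule q)
  have cnt: "of_nat (rank_count a M n) - of_nat (num_partitions n) / of_int M =
     (\<Sum>j\<in>{1..<nat M}. 1 / of_int M * (zeta M j powi (- a) * (\<Sum>xs\<in>partitions_of n. zeta M j powi partition_rank xs)))" for n
  proof -
    have "of_nat (rank_count a M n) = (\<Sum>xs\<in>partitions_of n. if M dvd (partition_rank xs - a) then 1 else 0 :: complex)"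
      unfolding rank_count_def by (simp add: sum.If_cases finite_partitions_of Int_def cong_iff_dvd_diff)
    also have "\<dots> = (\<Sum>xs\<in>partitions_of n. 1 / of_int M * (\<Sum>j<nat M. zeta M j powi (partition_rank xs - a)))"
      using M by (intro sum.cong refl) (simp add: zeta_orthogonality)
    also have "\<dots> = (\<Sum>j<nat M. 1 / of_int M * (\<Sum>xs\<in>partitions_of n. zeta M j powi (partition_rank xs - a)))"
      unfolding sum_distrib_left by (rule sum.swap)
    also have "{..<nat M} = insert 0 {1..<nat M}" using M by auto
    also have "(\<Sum>j\<in>insert 0 {1..<nat M}. 1 / of_int M * (\<Sum>xs\<in>partitions_of n. zeta M j powi (partition_rank xs - a))) =
       of_nat (num_partitions n) / of_int M + (\<Sum>j\<in>{1..<nat M}. 1 / of_int M * (\<Sum>xs\<in>partitions_of n. zeta M j powi (partition_rank xs - a)))"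
      by (subst sum.insert) (auto simp: zeta_def num_partitions_def)
    finally have "of_nat (rank_count a M n) - of_nat (num_partitions n) / of_int M =
      (\<Sum>j\<in>{1..<nat M}. 1 / of_int M * (\<Sum>xs\<in>partitions_of n. zeta M j powi (partition_rank xs - a)))" by simp
    moreover have "zeta M j powi (r - a) = zeta M j powi (- a) * zeta M j powi r" for j r
      using zeta_nz by (simp flip: power_int_add)
    ultimately show ?thesis by (simp add: sum_distrib_left)
  qed
  have "(\<lambda>n. \<Sum>j\<in>{1..<nat M}. 1 / of_int M * (zeta M j powi (- a) * ((\<Sum>xs\<in>partitions_of n. zeta M j powi partition_rank xs) * q ^ n)))
     sums (\<Sum>j\<in>{1..<nat M}. 1 / of_int M * (zeta M j powi (- a) * rank_gf (zeta M j)))"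
    by (intro sums_sum sums_mult partition_rank_sums norm_zeta)
  moreover have "(\<Sum>j\<in>{1..<nat M}. 1 / of_int M * (zeta M j powi (- a) * ((\<Sum>xs\<in>partitions_of n. zeta M j powi partition_rank xs) * q ^ n)))
    = (of_nat (rank_count a M n) - of_nat (num_partitions n) / of_int M) * q ^ n" for n
    unfolding cnt by (subst sum_distrib_right) (simp only: mult.assoc)
  ultimately have "(\<lambda>n. (of_nat (rank_count a M n) - of_nat (num_partitions n) / of_int M) * q ^ n)
     sums (\<Sum>j\<in>{1..<nat M}. 1 / of_int M * (zeta M j powi (- a) * rank_gf (zeta M j)))"
    by (simp only:)
  hence "rank_deviation a M q = (\<Sum>j\<in>{1..<nat M}. 1 / of_int M * (zeta M j powi (- a) * rank_gf (zeta M j)))"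
    unfolding rank_deviation_def by (rule sums_unique[symmetric])
  also have "\<dots> = (\<Sum>j\<in>{1..<nat M}. 1 / of_int M * (zeta M j powi (- a) * ((1 - zeta M j) * (level3 (zeta M j) / J))))"
    using M zeta_neq_1[of M] by (intro sum.cong refl) (simp add: rank_gf_level3 norm_zeta)
  finally show ?thesis by (simp add: sum_distrib_left)
qed

section \<open>Closure properties of theta functions\<close>

definition qpr :: "complex \<Rightarrow> rat \<Rightarrow> complex" where
  "qpr q s = q powr of_rat s"

lemma qpr_add: "qpr q (s + t) = qpr q s * qpr q t"
  by (simp add: qpr_def of_rat_add powr_add)

lemma qpr_0 [simp]: "q \<noteq> 0 \<Longrightarrow> qpr q 0 = 1"
  by (simp add: qpr_def)

lemma qpr_nz [simp]: "q \<noteq> 0 \<Longrightarrow> qpr q s \<noteq> 0"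
  by (simp add: qpr_def)

lemma qpr_minus: "q \<noteq> 0 \<Longrightarrow> qpr q (- s) = inverse (qpr q s)"
  by (simp add: qpr_def of_rat_minus powr_minus)

lemma qpr_diff: "q \<noteq> 0 \<Longrightarrow> qpr q (s - t) = qpr q s / qpr q t"
  using qpr_add[of q s "- t"] by (simp add: qpr_minus divide_inverse)

lemma qpr_nat: "q \<noteq> 0 \<Longrightarrow> qpr q (of_nat k) = q ^ k"
  by (simp add: qpr_def powr_nat')

lemma qpr_power: "q \<noteq> 0 \<Longrightarrow> qpr q s ^ k = qpr q (of_nat k * s)"
  by (induction k) (auto simp: qpr_add algebra_simps)

lemma qpr_int: "q \<noteq> 0 \<Longrightarrow> qpr q (of_int k) = q powi k"
proof (cases "k \<ge> 0")
  case True
  assume "q \<noteq> 0"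
  thus ?thesis using True qpr_nat[of q "nat k"] by (simp add: power_int_def)
next
  case False
  assume q: "q \<noteq> 0"
  have "qpr q (of_int k) = inverse (qpr q (of_int (- k)))" using qpr_minus[OF q, of "of_int (- k)"] by simp
  also have "qpr q (of_int (- k)) = q ^ nat (- k)" using False qpr_nat[OF q, of "nat (- k)"] by simp
  finally show ?thesis using False by (simp add: power_int_def power_inverse)
qed

lemma qpr_powi: "q \<noteq> 0 \<Longrightarrow> qpr q s powi k = qpr q (of_int k * s)"
proof (cases "k \<ge> 0")
  case True
  assume "q \<noteq> 0"
  thus ?thesis using True by (simp add: power_int_def qpr_power)
next
  case False
  assume q: "q \<noteq> 0"
  have "qpr q s powi k = inverse (qpr q s ^ nat (- k))" using False by (simp add: power_int_def power_inverse)
  also have "\<dots> = qpr q (- (of_nat (nat (- k)) * s))" using q by (simp add: qpr_power qpr_minus)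
  also have "- (of_nat (nat (- k)) * s) = of_int k * s" using False by simp
  finally show ?thesis .
qed

lemma norm_qpr: "q \<noteq> 0 \<Longrightarrow> norm (qpr q s) = norm q powr of_rat s"
proof -
  assume q: "q \<noteq> 0"
  have "(of_rat s :: complex) = of_real (of_rat s)" by (cases s) (simp add: of_rat_rat)
  hence "norm (qpr q s) = exp (of_rat s * ln (norm q))"
    using q by (simp add: qpr_def powr_def)
  thus ?thesis using q by (simp add: powr_def)
qed

text \<open>A zero would force s to be a multiple of k by absolute values, and then c = 1. As this
  does not depend on q, it certifies denominators on the whole domain.\<close>

lemma jtheta_qpr_nz:
  assumes q: "q \<noteq> 0" "norm q < 1" and k: "0 < k" and c: "norm c = 1" "c = 1 \<Longrightarrow> \<forall>m::int. s \<noteq> of_int (int k * m)"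
  shows "jtheta (c * qpr q s) (q ^ k) \<noteq> 0"
proof
  interpret nome q using q by unfold_locales
  interpret Q: nome "q ^ k" using k by (rule nome_power)
  assume "jtheta (c * qpr q s) (q ^ k) = 0"
  moreover have "c \<noteq> 0" using c by auto
  ultimately obtain m where "c * qpr q s = (q ^ k) powi m" using Q.jtheta_eq_0_iff q by auto
  also have "(q ^ k) powi m = qpr q (of_int (int k * m))"
    unfolding qpr_int[OF q(1)] power_int_mult by simp
  finally have m: "c * qpr q s = qpr q (of_int (int k * m))" .
  hence "norm q powr of_rat s = norm q powr of_rat (of_int (int k * m))"
    using c q by (metis mult_1 norm_mult norm_qpr)
  hence "(of_rat s :: real) = of_rat (of_int (int k * m))"
    using q by (subst (asm) powr_inj) auto
  hence s: "s = of_int (int k * m)" by (simp only: of_rat_eq_iff)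
  with m have "c = 1" using q by simp
  thus False using c(2) s by blast
qed

locale theta_domain =
  fixes M :: int and \<Omega> :: "(complex \<times> complex) set"
  assumes M_pos: "1 \<le> M"
    and domain: "\<And>q z. (q, z) \<in> \<Omega> \<Longrightarrow> q \<noteq> 0 \<and> norm q < 1 \<and> (3 dvd M \<longrightarrow> z \<noteq> 0)"
begin

definition good_term :: "theta_term \<Rightarrow> bool" where
  "good_term t \<longleftrightarrow> term_coeff t \<in> \<rat> \<and>
     (\<forall>f\<in>set (term_factors t). factor_const f \<noteq> 0 \<and> 0 < factor_base f) \<and>
     (\<not> 3 dvd M \<longrightarrow> term_zexp t = 0 \<and> (\<forall>f\<in>set (term_factors t). factor_zexp f = 0))"

definition nonvanishing :: "theta_term list \<Rightarrow> bool" where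
  "nonvanishing ts \<longleftrightarrow> (\<forall>q z. (q, z) \<in> \<Omega> \<longrightarrow>
     (\<forall>t\<in>set ts. \<forall>f\<in>set (term_factors t). factor_inverted f \<longrightarrow> factor_j f q z \<noteq> 0))"

text \<open>
  The coefficients are restricted to rational numbers, so that products of sums of terms are
  again of this form.
\<close>

definition theta_rep :: "(complex \<Rightarrow> complex \<Rightarrow> complex) \<Rightarrow> bool" where
  "theta_rep T \<longleftrightarrow> (\<exists>ts. (\<forall>t\<in>set ts. good_term t) \<and> nonvanishing ts \<and>
     (\<forall>q z. (q, z) \<in> \<Omega> \<longrightarrow> T q z = (\<Sum>t\<leftarrow>ts. term_eval t q z)))"

lemma rat_cyclotomic: "c \<in> \<rat> \<Longrightarrow> c \<in> cyclotomic M"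
proof -
  assume "c \<in> \<rat>"
  then obtain r where r: "c = of_rat r" by (rule Rats_cases)
  have "(\<Sum>k<nat M. of_rat (if k = 0 then r else 0) * cis (2 * pi * real k / real_of_int M)) = (\<Sum>k<nat M. if k = 0 then c else 0)"
    by (intro sum.cong) (auto simp: r)
  also have "\<dots> = c" using M_pos by (simp add: sum.delta)
  finally show ?thesis unfolding cyclotomic_def by (intro CollectI exI[of _ "\<lambda>k. if k = 0 then r else 0"]) simp
qed

lemma theta_rep_imp_theta: "theta_rep T \<Longrightarrow> is_theta_function M \<Omega> T"
proof -
  assume "theta_rep T"
  then obtain ts where ts: "\<forall>t\<in>set ts. good_term t" "nonvanishing ts"
    "\<forall>q z. (q, z) \<in> \<Omega> \<longrightarrow> T q z = (\<Sum>t\<leftarrow>ts. term_eval t q z)"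
    unfolding theta_rep_def by blast
  have "\<forall>t\<in>set ts. wf_theta_term M t"
    using ts(1) rat_cyclotomic unfolding good_term_def wf_theta_term_def by blast
  thus ?thesis unfolding is_theta_function_def
    using ts(2,3) unfolding nonvanishing_def by (intro exI[of _ ts] conjI) (simp, clarsimp)
qed

lemma theta_rep_cong:
  assumes "theta_rep S" "\<And>q z. (q, z) \<in> \<Omega> \<Longrightarrow> T q z = S q z"
  shows "theta_rep T"
proof -
  obtain ts where "\<forall>t\<in>set ts. good_term t" "nonvanishing ts"
    "\<forall>q z. (q, z) \<in> \<Omega> \<longrightarrow> S q z = (\<Sum>t\<leftarrow>ts. term_eval t q z)"
    using assms(1) unfolding theta_rep_def by blast
  thus ?thesis unfolding theta_rep_def using assms(2) by (intro exI[of _ ts]) simp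
qed

lemma theta_rep_single:
  assumes "good_term t" "\<And>q z f. (q, z) \<in> \<Omega> \<Longrightarrow> f \<in> set (term_factors t) \<Longrightarrow> factor_inverted f \<Longrightarrow> factor_j f q z \<noteq> 0"
    and "\<And>q z. (q, z) \<in> \<Omega> \<Longrightarrow> T q z = term_eval t q z"
  shows "theta_rep T"
  unfolding theta_rep_def nonvanishing_def using assms by (intro exI[of _ "[t]"]) auto

lemma theta_rep_rat: "c \<in> \<rat> \<Longrightarrow> theta_rep (\<lambda>q z. c)"
  using domain by (intro theta_rep_single[of "ThetaTerm c 0 0 []"]) (auto simp: good_term_def term_eval_def)

lemma theta_rep_qpr: "theta_rep (\<lambda>q z. qpr q s)"
  by (intro theta_rep_single[of "ThetaTerm 1 0 s []"]) (auto simp: good_term_def term_eval_def qpr_def)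

lemma theta_rep_jtheta:
  assumes "c \<noteq> 0" "0 < k" "\<not> 3 dvd M \<Longrightarrow> t = 0"
  shows "theta_rep (\<lambda>q z. jtheta (c * z powi t * qpr q s) (q ^ k))"
  using domain assms
  by (intro theta_rep_single[of "ThetaTerm 1 0 0 [ThetaFactor c t s k False]"])
     (auto simp: good_term_def term_eval_def factor_eval_def factor_j_def qpr_def)

lemma theta_rep_inverse_jtheta:
  assumes "c \<noteq> 0" "0 < k" "\<not> 3 dvd M \<Longrightarrow> t = 0"
    and "\<And>q z. (q, z) \<in> \<Omega> \<Longrightarrow> jtheta (c * z powi t * qpr q s) (q ^ k) \<noteq> 0"
  shows "theta_rep (\<lambda>q z. inverse (jtheta (c * z powi t * qpr q s) (q ^ k)))"
  using domain assms
  by (intro theta_rep_single[of "ThetaTerm 1 0 0 [ThetaFactor c t s k True]"])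
     (auto simp: good_term_def term_eval_def factor_eval_def factor_j_def qpr_def)

lemma theta_rep_add:
  assumes "theta_rep S" "theta_rep T"
  shows "theta_rep (\<lambda>q z. S q z + T q z)"
proof -
  obtain ss where ss: "\<forall>t\<in>set ss. good_term t" "nonvanishing ss" "\<forall>q z. (q, z) \<in> \<Omega> \<longrightarrow> S q z = (\<Sum>t\<leftarrow>ss. term_eval t q z)"
    using assms(1) unfolding theta_rep_def by blast
  obtain ts where ts: "\<forall>t\<in>set ts. good_term t" "nonvanishing ts" "\<forall>q z. (q, z) \<in> \<Omega> \<longrightarrow> T q z = (\<Sum>t\<leftarrow>ts. term_eval t q z)"
    using assms(2) unfolding theta_rep_def by blast
  show ?thesis unfolding theta_rep_def
    using ss ts by (intro exI[of _ "ss @ ts"]) (auto simp: nonvanishing_def)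
qed

definition term_mult :: "theta_term \<Rightarrow> theta_term \<Rightarrow> theta_term" where
  "term_mult s t = ThetaTerm (term_coeff s * term_coeff t) (term_zexp s + term_zexp t)
     (term_qexp s + term_qexp t) (term_factors s @ term_factors t)"

lemma term_eval_mult:
  assumes "(q, z) \<in> \<Omega>" "good_term s" "good_term t"
  shows "term_eval (term_mult s t) q z = term_eval s q z * term_eval t q z"
proof -
  \<comment> \<open>Either z is nonzero or, when 3 does not divide M, both exponents are 0.\<close>
  have "z powi (term_zexp s + term_zexp t) = z powi term_zexp s * z powi term_zexp t"
    using assms domain[OF assms(1)] by (cases "3 dvd M") (auto simp: good_term_def power_int_add)
  thus ?thesis by (simp add: term_eval_def term_mult_def of_rat_add powr_add mult_ac)
qed

lemma theta_rep_mult: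
  assumes "theta_rep S" "theta_rep T"
  shows "theta_rep (\<lambda>q z. S q z * T q z)"
proof -
  obtain ss where ss: "\<forall>t\<in>set ss. good_term t" "nonvanishing ss" "\<forall>q z. (q, z) \<in> \<Omega> \<longrightarrow> S q z = (\<Sum>t\<leftarrow>ss. term_eval t q z)"
    using assms(1) unfolding theta_rep_def by blast
  obtain ts where ts: "\<forall>t\<in>set ts. good_term t" "nonvanishing ts" "\<forall>q z. (q, z) \<in> \<Omega> \<longrightarrow> T q z = (\<Sum>t\<leftarrow>ts. term_eval t q z)"
    using assms(2) unfolding theta_rep_def by blast
  define us where "us = concat (map (\<lambda>s. map (term_mult s) ts) ss)"
  have ev: "(\<Sum>t\<leftarrow>us. term_eval t q z) = (\<Sum>t\<leftarrow>ss. term_eval t q z) * (\<Sum>t\<leftarrow>ts. term_eval t q z)"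
    if qz: "(q, z) \<in> \<Omega>" for q z
  proof -
    have "(\<Sum>t\<leftarrow>map (term_mult s) ts. term_eval t q z) = term_eval s q z * (\<Sum>t\<leftarrow>ts. term_eval t q z)" if "good_term s" for s
      using ts(1) that by (induction ts) (auto simp: term_eval_mult[OF qz] algebra_simps)
    thus ?thesis unfolding us_def using ss(1) by (induction ss) (auto simp: algebra_simps)
  qed
  have "good_term u" if "u \<in> set us" for u
    using that ss(1) ts(1) by (fastforce simp: us_def good_term_def term_mult_def)
  moreover have "nonvanishing us"
    using ss(2) ts(2) by (fastforce simp: us_def nonvanishing_def term_mult_def)
  ultimately show ?thesis unfolding theta_rep_def using ss(3) ts(3) ev
    by (intro exI[of _ us]) auto
qed

lemma theta_rep_minus: "theta_rep S \<Longrightarrow> theta_rep (\<lambda>q z. - S q z)"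
  using theta_rep_mult[OF theta_rep_rat[of "-1"], of S] by simp

lemma theta_rep_diff: "theta_rep S \<Longrightarrow> theta_rep T \<Longrightarrow> theta_rep (\<lambda>q z. S q z - T q z)"
  using theta_rep_add[OF _ theta_rep_minus, of S T] by simp

lemma theta_rep_power: "theta_rep S \<Longrightarrow> theta_rep (\<lambda>q z. S q z ^ k)"
  by (induction k) (auto intro: theta_rep_rat theta_rep_mult)

lemma theta_rep_sum: "finite A \<Longrightarrow> (\<And>i. i \<in> A \<Longrightarrow> theta_rep (S i)) \<Longrightarrow> theta_rep (\<lambda>q z. \<Sum>i\<in>A. S i q z)"
  by (induction A rule: finite_induct) (auto intro: theta_rep_rat theta_rep_add)

lemma theta_rep_jtheta':
  assumes "c \<noteq> 0" "0 < k"
  shows "theta_rep (\<lambda>q z. jtheta (c * qpr q s) (q ^ k))"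
  using theta_rep_jtheta[of c k 0 s] assms by simp

lemma theta_rep_inverse_jtheta':
  assumes "norm c = 1" "0 < k" "c = 1 \<Longrightarrow> \<forall>m::int. s \<noteq> of_int (int k * m)"
  shows "theta_rep (\<lambda>q z. inverse (jtheta (c * qpr q s) (q ^ k)))"
proof -
  have "jtheta (c * qpr q s) (q ^ k) \<noteq> 0" if "(q, z) \<in> \<Omega>" for q z
    using jtheta_qpr_nz[of q k c s] domain[OF that] assms by blast
  thus ?thesis using theta_rep_inverse_jtheta[of c k 0 s] assms by fastforce
qed

text \<open>
  A constant of modulus one is a quotient of theta functions, because
  \<open>j(q \<kappa>; q) = - j(\<kappa>; q) / \<kappa>\<close>.
\<close>

lemma theta_rep_unit:
  assumes u: "norm u = 1"
  shows "theta_rep (\<lambda>q z. u)"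
proof (cases "u = -1")
  case True
  thus ?thesis using theta_rep_rat[of "-1"] by simp
next
  case False
  define k where "k = - inverse u"
  have k: "norm k = 1" "k \<noteq> 1" "k \<noteq> 0" using u False by (auto simp: k_def norm_inverse) (metis inverse_inverse_eq inverse_minus_eq minus_equation_iff inverse_1)
  have "theta_rep (\<lambda>q z. jtheta (k * qpr q 1) (q ^ 1) * inverse (jtheta (k * qpr q 0) (q ^ 1)))"
    using k by (intro theta_rep_mult theta_rep_jtheta' theta_rep_inverse_jtheta') auto
  thus ?thesis
  proof (rule theta_rep_cong)
    fix q z assume "(q, z) \<in> \<Omega>"
    then interpret nome q using domain by unfold_locales auto
    have "jtheta (k * qpr q 0) (q ^ 1) \<noteq> 0"
      using jtheta_qpr_nz[of q 1 k 0] q_nz q_lt1 k by auto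
    moreover have "qpr q 1 = q" using qpr_nat[OF q_nz, of 1] by simp
    ultimately show "u = jtheta (k * qpr q 1) (q ^ 1) * inverse (jtheta (k * qpr q 0) (q ^ 1))"
      using jtheta_mult_q[OF k(3)] q_nz u by (cases "u = 0") (auto simp: mult.commute k_def divide_inverse)
  qed
qed

lemma theta_rep_powi: "theta_rep (\<lambda>q z. q powi k)"
  by (rule theta_rep_cong[OF theta_rep_qpr[of "of_int k"]]) (use domain in \<open>simp add: qpr_int\<close>)

text \<open>By \<open>jtheta_q_cube\<close>, J in base q^L is j(q^L; q^(3L)), and L is no multiple
  of 3L.\<close>

lemma theta_rep_J:
  assumes "0 < L"
  shows "theta_rep (\<lambda>q z. nome.J (q ^ L))" "theta_rep (\<lambda>q z. inverse (nome.J (q ^ L)))"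
proof -
  have J: "nome.J (q ^ L) = jtheta (1 * qpr q (of_nat L)) (q ^ (3 * L))" if "(q, z) \<in> \<Omega>" for q z
  proof -
    interpret nome q using domain[OF that] by unfold_locales auto
    show ?thesis using nome.jtheta_q_cube[OF nome_power[OF assms]] q_nz
      by (simp add: qpr_nat power_mult[symmetric] mult.commute)
  qed
  have "(of_nat L :: rat) \<noteq> of_int (int (3 * L) * m)" for m
  proof
    assume "(of_nat L :: rat) = of_int (int (3 * L) * m)"
    hence "int L = int (3 * L) * m" by (metis of_int_eq_iff of_int_of_nat_eq)
    hence "1 = 3 * m" using assms by simp
    thus False by presburger
  qed
  hence "theta_rep (\<lambda>q z. inverse (jtheta (1 * qpr q (of_nat L)) (q ^ (3 * L))))"
    using assms by (intro theta_rep_inverse_jtheta') auto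
  thus "theta_rep (\<lambda>q z. inverse (nome.J (q ^ L)))"
    by (rule theta_rep_cong) (simp add: J)
  have "theta_rep (\<lambda>q z. jtheta (1 * qpr q (of_nat L)) (q ^ (3 * L)))"
    using assms by (intro theta_rep_jtheta') auto
  thus "theta_rep (\<lambda>q z. nome.J (q ^ L))"
    by (rule theta_rep_cong) (simp add: J)
qed

section \<open>The remainder of the dissection is a theta function\<close>

definition root_b :: "nat \<Rightarrow> complex" where "root_b n = cis (pi / real (12 * n))"

text \<open>A 3n-th root of the inverse of (-1)^(n+1) i, the unit factor in the pole
  equation.\<close>

definition root_p :: "nat \<Rightarrow> complex" where
  "root_p n = cis (- (pi / 2 + pi * real (n + 1)) / real (3 * n))"

text \<open>The exponent is L times -1/(3n) of the exponent n(3n-1)/2 - nl in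
  \<open>dissect_arg\<close>. The power is fractional, but any solution of the pole equation
  serves.\<close>

definition pole_param :: "nat \<Rightarrow> nat \<Rightarrow> complex \<Rightarrow> int \<Rightarrow> complex" where
  "pole_param n L q l = root_p n * qpr q (of_nat L * (1 + 2 * of_int l - 3 * of_nat n) / 6)"

definition pole_const :: "nat \<Rightarrow> (int \<times> nat) option \<Rightarrow> complex" where
  "pole_const n s = (case s of None \<Rightarrow> 1 | Some (l, k) \<Rightarrow> root_p n * cis (2 * pi * real k / real (3 * n)))"

definition pole_exp :: "nat \<Rightarrow> nat \<Rightarrow> (int \<times> nat) option \<Rightarrow> rat" where
  "pole_exp n L s = (case s of None \<Rightarrow> 0 | Some (l, k) \<Rightarrow> of_nat L * (1 + 2 * of_int l - 3 * of_nat n) / 6)"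

lemma root_b_power: "0 < n \<Longrightarrow> root_b n ^ (12 * n) = -1"
proof -
  assume "0 < n"
  hence "real (12 * n) * (pi / real (12 * n)) = pi" by simp
  thus ?thesis unfolding root_b_def Complex.DeMoivre by (simp only: cis_pi)
qed

lemma cis_pi_multiple: "cis (pi * real m) = (-1) ^ m"
  by (metis Complex.DeMoivre cis_pi mult.commute)

lemma root_p_power: "0 < n \<Longrightarrow> root_p n ^ (3 * n) * ((-1) ^ (n + 1) * \<i>) = 1"
proof -
  assume n: "0 < n"
  have "real (3 * n) * (- (pi / 2 + pi * real (n + 1)) / real (3 * n)) = - (pi / 2 + pi * real (n + 1))"
    using n by simp
  hence "root_p n ^ (3 * n) = cis (- (pi / 2 + pi * real (n + 1)))"
    unfolding root_p_def Complex.DeMoivre by (simp only:)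
  moreover have "(-1) ^ (n + 1) * \<i> = cis (pi / 2 + pi * real (n + 1))"
    unfolding cis_mult[symmetric] cis_pi_multiple by simp
  ultimately show ?thesis by (simp only: cis_mult) simp
qed

lemma dissection_intro:
  assumes "q \<noteq> 0" "norm q < 1" "0 < L" "0 < n"
  shows "dissection (q ^ L) n (root_b n) (pole_param n L q)"
proof -
  interpret nome q using assms by unfold_locales
  interpret Q: nome "q ^ L" using assms by (intro nome_power)
  show ?thesis
  proof
    fix l :: int
    define h where "h = int n * (3 * int n - 1) div 2"
    have "even (int n * (3 * int n - 1))" by auto
    hence h: "int n * (3 * int n - 1) = 2 * h" by (simp add: h_def)
    have hr: "(of_int (int n * (3 * int n - 1)) :: rat) = of_int (2 * h)" by (simp only: h)
    have "(q ^ L) powi (h - int n * l) = qpr q (of_int (int L * (h - int n * l)))"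
      unfolding qpr_int[OF q_nz] power_int_mult by simp
    moreover have "qpr q (of_nat L * (1 + 2 * of_int l - 3 * of_nat n) / 6) ^ (3 * n) =
       qpr q (of_nat (3 * n) * (of_nat L * (1 + 2 * of_int l - 3 * of_nat n) / 6))"
      by (rule qpr_power[OF q_nz])
    moreover have "of_nat (3 * n) * (of_nat L * (1 + 2 * of_int l - 3 * of_nat n) / 6) = - (of_int (int L * (h - int n * l)) :: rat)"
    proof -
      have "(of_nat n :: rat) * (3 * of_nat n - 1) = 2 * of_int h" using hr by simp
      hence h2: "of_int h = (of_nat n :: rat) * (3 * of_nat n - 1) / 2" by simp
      show ?thesis by (simp add: h2 field_simps)
    qed
    ultimately have "qpr q (of_nat L * (1 + 2 * of_int l - 3 * of_nat n) / 6) ^ (3 * n) * (q ^ L) powi (h - int n * l) = 1"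
      using q_nz by (simp add: qpr_minus)
    moreover have "pole_param n L q l ^ (3 * n) * (dissect_arg (q ^ L) n l * \<i>) =
       (root_p n ^ (3 * n) * ((-1) ^ (n + 1) * \<i>)) *
       (qpr q (of_nat L * (1 + 2 * of_int l - 3 * of_nat n) / 6) ^ (3 * n) * (q ^ L) powi (h - int n * l))"
      unfolding pole_param_def dissect_arg_def h_def power_mult_distrib by (simp only: mult_ac)
    ultimately show "pole_param n L q l ^ (3 * n) * (dissect_arg (q ^ L) n l * \<i>) = 1"
      using root_p_power[OF assms(4)] by simp
  qed (use assms root_b_power in auto)
qed

lemma norm_pole_const: "norm (pole_const n s) = 1"
  by (cases s) (auto simp: pole_const_def norm_mult root_p_def split: prod.splits)

lemma norm_root_b: "norm (root_b n) = 1"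
  by (simp add: root_b_def)

text \<open>Unit parts of these poles are 6n-th roots of -1, so they never meet evaluation points
  whose unit part is a 6n-th root of 1.\<close>

lemma pole_const_power:
  assumes "0 < n"
  shows "pole_const n (Some (l, k)) ^ (6 * n) = -1"
proof -
  have "cis (2 * pi * real k / real (3 * n)) ^ (3 * n) = 1"
    using cis_root_of_unity_power[of "3 * n" k] assms by simp
  hence p: "pole_const n (Some (l, k)) ^ (3 * n) * ((-1) ^ (n + 1) * \<i>) = 1"
    using root_p_power[OF assms] by (simp add: pole_const_def power_mult_distrib)
  have "((-1) ^ (n + 1) * \<i>)\<^sup>2 = (-1 :: complex)"
    by (simp add: power_mult_distrib flip: power_mult)
  hence "(pole_const n (Some (l, k)) ^ (3 * n))\<^sup>2 * (-1) = 1"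
    using arg_cong[OF p, of "\<lambda>x. x\<^sup>2"] by (simp only: power_mult_distrib power_one)
  hence "(pole_const n (Some (l, k)) ^ (3 * n))\<^sup>2 = -1"
    by (metis minus_minus mult_minus1_right)
  moreover have "6 * n = 3 * n * 2" by simp
  ultimately show ?thesis by (simp only: power_mult)
qed

text \<open>Covers both uses of the dissection: L = 1 at M-th roots of unity, and L = M^2 with n = 1
  at signs times powers of q. Every factor of the remainder is rewritten as j of a unit times a
  rational power of q; only the pole at 1 can give the unit 1, and there \<open>reg\<close> excludes
  a zero.\<close>

lemma dissection_theta:
  assumes L: "0 < L" and n: "0 < n" and u: "norm u = 1" "u ^ (6 * n) = 1"
    and reg: "u = 1 \<Longrightarrow> \<forall>m::int. s \<noteq> of_int (int L * m)"
  shows "theta_rep (\<lambda>q z. nome.level3 (q ^ L) (u * qpr q s) / nome.J (q ^ L)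
     - (\<Sum>N\<in>{0..<3 * int n}. dissect_term (q ^ L) n N (u * qpr q s)))"
proof -
  define b where "b = root_b n"
  define I :: "(int \<times> nat) option set" where "I = insert None (Some ` ({0, 2} \<times> {..<3 * n}))"
  have finI: "finite I" by (simp add: I_def)
  define pc where "pc = pole_const n"
  define pe where "pe = pole_exp n L"
  have b12: "b ^ (12 * n) = -1" using root_b_power[OF n] by (simp add: b_def)
  have nb: "norm b = 1" by (simp add: b_def norm_root_b)
  have b0: "b \<noteq> 0" using nb by auto
  have npc: "norm (pc i) = 1" for i by (simp add: pc_def norm_pole_const)
  have pc0: "pc i \<noteq> 0" for i using npc[of i] by auto
  have u0: "u \<noteq> 0" using u by auto
  define B where "B = L * (3 * n\<^sup>2)"
  have B: "0 < B" using L n by (simp add: B_def)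
  define w where "w = (\<lambda>q i. case i of None \<Rightarrow> jtheta (inverse b * qpr q 0) (q ^ L) ^ 3 * inverse (nome.J (q ^ L))
      | Some (l, k) \<Rightarrow> dissect_sign l * ((-1) powi l * q powi (int L * (- (l * (l + 1)) div 6))) *
          (pc i ^ nat l * qpr q (of_int l * pe i)) * \<i> * (inverse (of_nat (3 * n)) * inverse (jtheta (\<i> * qpr q 0) (q ^ B)))
           * jtheta (pc i * inverse b * qpr q (pe i)) (q ^ L) ^ 3)"
  define E where "E = (\<lambda>q. (\<Sum>i\<in>I. w q i * (nome.J (q ^ L) ^ 3 *
       jtheta (u * inverse (b ^ 3 * pc i) * qpr q (s - of_nat L - pe i)) (q ^ L) *
       (inverse (jtheta (inverse (b ^ 3) * qpr q (- of_nat L)) (q ^ L)) *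
        inverse (jtheta (u * inverse (pc i) * qpr q (s - pe i)) (q ^ L)))))
       * inverse (jtheta (u * inverse b * qpr q s) (q ^ L)) ^ 3)"
  \<comment> \<open>This and the next two facts keep the unit parts of the denominators away from 1:
    for the multiplier, for the factor j(x/b), and for the poles other than 1.\<close>
  have cb3: "inverse (b ^ 3) \<noteq> 1"
  proof
    assume "inverse (b ^ 3) = 1"
    hence "b ^ 3 = 1" by (metis inverse_1 inverse_inverse_eq)
    hence "(b ^ 3) ^ (4 * n) = 1" by simp
    thus False using b12 by (simp flip: power_mult)
  qed
  have cub: "u * inverse b \<noteq> 1"
  proof
    assume "u * inverse b = 1"
    hence "u = b" using b0 by (simp add: field_simps)
    hence "(u ^ (6 * n)) ^ 2 = -1" using b12 by (simp flip: power_mult add: mult.commute)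
    thus False using u by simp
  qed
  have cup: "u * inverse (pc i) \<noteq> 1" if i: "i \<noteq> None" for i
  proof
    assume "u * inverse (pc i) = 1"
    hence "u = pc i" using pc0[of i] by (simp add: field_simps)
    moreover obtain l k where "i = Some (l, k)" using i by (cases i) auto
    ultimately show False using u pole_const_power[OF n, of l k] by (simp add: pc_def)
  qed
  have regp: "\<forall>m::int. s - pe i \<noteq> of_int (int L * m)" if "u * inverse (pc i) = 1" for i
  proof -
    have "i = None" using cup that by blast
    thus ?thesis using reg that by (simp add: pc_def pe_def pole_const_def pole_exp_def)
  qed
  have "theta_rep (\<lambda>q z. w q i)" if "i \<in> I" for i
  proof (cases i)
    case None
    show ?thesis unfolding w_def None option.case
      using b0 L by (intro theta_rep_mult theta_rep_power theta_rep_jtheta' theta_rep_J) auto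
  next
    case (Some lk)
    obtain l k where lk: "lk = (l, k)" by (cases lk)
    have d: "dissect_sign l \<in> \<rat>" "(-1 :: complex) powi l \<in> \<rat>" "inverse (complex_of_nat (3 * n)) \<in> \<rat>"
      by (auto simp: dissect_sign_def power_int_def)
    show ?thesis unfolding w_def Some lk option.case prod.case
      using d b0 L B pc0 npc[of i] Some lk
      by (intro theta_rep_mult theta_rep_power theta_rep_jtheta' theta_rep_inverse_jtheta' theta_rep_rat
          theta_rep_unit theta_rep_qpr theta_rep_powi) (auto simp: norm_power)
  qed
  hence "theta_rep (\<lambda>q z. E q)"
    unfolding E_def using finI L b0 u0 pc0 u nb npc cb3 cub regp
    by (intro theta_rep_mult theta_rep_power theta_rep_sum theta_rep_jtheta' theta_rep_inverse_jtheta' theta_rep_J)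
      (auto simp: norm_mult norm_inverse norm_power)
  thus ?thesis
  proof (rule theta_rep_cong)
    fix q z assume qz: "(q, z) \<in> \<Omega>"
    have q: "q \<noteq> 0" "norm q < 1" using domain[OF qz] by auto
    interpret D: dissection "q ^ L" n b "pole_param n L q"
      unfolding b_def by (rule dissection_intro[OF q L n])
    define x where "x = u * qpr q s"
    have x0: "x \<noteq> 0" using u0 q by (simp add: x_def)
    have pole: "D.pole i = pc i * qpr q (pe i)" for i
      using q by (cases i) (auto simp: D.pole_def pc_def pe_def pole_const_def pole_exp_def pole_param_def split: prod.splits)
    have I: "D.pole_index = I" by (simp add: D.pole_index_def I_def)
    have xp: "x / D.pole i = u * inverse (pc i) * qpr q (s - pe i)" for i
      using q by (simp add: x_def pole qpr_diff divide_inverse mult_ac)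
    have xb: "x / b = u * inverse b * qpr q s" by (simp add: x_def divide_inverse mult_ac)
    have mult: "D.multiplier = b ^ 3 * qpr q (of_nat L)"
      using q by (simp add: D.multiplier_def qpr_nat)
    have xm: "x / (D.multiplier * D.pole i) = u * inverse (b ^ 3 * pc i) * qpr q (s - of_nat L - pe i)" for i
      using q by (simp add: x_def pole mult qpr_diff divide_inverse mult_ac)
    have im: "inverse D.multiplier = inverse (b ^ 3) * qpr q (- of_nat L)"
      using q by (simp add: mult qpr_minus)
    have base: "D.dissect_base = q ^ B" by (simp add: D.dissect_base_def B_def power_mult)
    have wi: "D.pole_weight i = w q i" if "i \<in> I" for i
    proof (cases i)
      case None
      thus ?thesis using q by (simp add: D.pole_weight_def w_def divide_inverse)
    next
      case (Some lk)
      obtain l k where lk: "lk = (l, k)" by (cases lk)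
      have l: "0 \<le> l" using that Some lk by (auto simp: I_def)
      have c: "dissect_coeff (q ^ L) l = (-1) powi l * q powi (int L * (- (l * (l + 1)) div 6))"
        by (simp add: dissect_coeff_def power_int_mult)
      have pl: "D.pole i powi l = pc i ^ nat l * qpr q (of_int l * pe i)"
      proof -
        have "D.pole i powi l = pc i powi l * qpr q (pe i) powi l" unfolding pole by (rule power_int_mult_distrib)
        thus ?thesis using l q by (simp add: qpr_powi) (simp add: power_int_def)
      qed
      have pb: "D.pole i / b = pc i * inverse b * qpr q (pe i)" by (simp add: pole divide_inverse mult_ac)
      have "D.pole_weight i = dissect_sign l * dissect_coeff (q ^ L) l * D.pole i powi l * \<i> /
         (of_nat (3 * n) * jtheta \<i> D.dissect_base) * jtheta (D.pole i / b) (q ^ L) ^ 3"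
        by (simp add: D.pole_weight_def Some lk)
      also have "\<dots> = w q i"
        unfolding c pl pb base
        unfolding w_def Some lk option.case prod.case divide_inverse inverse_mult_distrib
        using q by simp
      finally show ?thesis .
    qed
    have jz: "jtheta (x / D.pole i) (q ^ L) \<noteq> 0" for i
      unfolding xp using u npc regp[of i] by (intro jtheta_qpr_nz[OF q L]) (auto simp: norm_mult norm_inverse)
    have "jtheta (x / b) (q ^ L) \<noteq> 0"
      unfolding xb using u nb cub by (intro jtheta_qpr_nz[OF q L]) (auto simp: norm_mult norm_inverse)
    moreover have "x \<in> D.regular_points D.pole_index D.pole" using x0 jz by (simp add: D.regular_points_def)
    ultimately have "D.level3 x / D.J = D.dissect_sum x + D.dissect_remainder x"
      by (intro D.level3_dissection)
    moreover have "D.dissect_remainder x = E q"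
      unfolding D.dissect_remainder_def E_def I xp xm im xb
      unfolding divide_inverse
      using wi by (simp add: power_inverse cong: sum.cong)
    ultimately show "nome.level3 (q ^ L) (u * qpr q s) / nome.J (q ^ L)
     - (\<Sum>N\<in>{0..<3 * int n}. dissect_term (q ^ L) n N (u * qpr q s)) = E q"
      unfolding x_def[symmetric] D.dissect_sum_def by simp
  qed
qed

text \<open>With t = 1 this replaces the fixed parameter by the free z; with t = 0 it compares two
  constant parameters.\<close>

lemma appell_m_change_theta:
  assumes B: "0 < B" and c: "norm u = 1" "norm c0 = 1" "norm c1 = 1" "c0 \<noteq> 1" "u * c0 \<noteq> 1" and t: "\<not> 3 dvd M \<Longrightarrow> t = 0"
    and nz: "\<And>q z. (q, z) \<in> \<Omega> \<Longrightarrow> jtheta (c1 * z powi t) (q ^ B) \<noteq> 0"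
      "\<And>q z. (q, z) \<in> \<Omega> \<Longrightarrow> jtheta (u * qpr q s * (c1 * z powi t)) (q ^ B) \<noteq> 0"
  shows "theta_rep (\<lambda>q z. appell_m (u * qpr q s) (q ^ B) (c1 * z powi t) - appell_m (u * qpr q s) (q ^ B) c0)"
proof -
  have c0: "u \<noteq> 0" "c0 \<noteq> 0" "c1 \<noteq> 0" using c by auto
  have nc: "norm (u * c0) = 1" using c by (simp add: norm_mult)
  have "theta_rep (\<lambda>q z. c0 * nome.J (q ^ B) ^ 3 * jtheta (c1 * inverse c0 * z powi t * qpr q 0) (q ^ B)
     * jtheta (u * c0 * c1 * z powi t * qpr q s) (q ^ B) *
      (inverse (jtheta (c0 * qpr q 0) (q ^ B)) * inverse (jtheta (c1 * z powi t * qpr q 0) (q ^ B)) *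
       inverse (jtheta (u * c0 * qpr q s) (q ^ B)) * inverse (jtheta (u * c1 * z powi t * qpr q s) (q ^ B))))"
  proof (intro theta_rep_mult theta_rep_power theta_rep_jtheta theta_rep_inverse_jtheta'
      theta_rep_inverse_jtheta theta_rep_J theta_rep_unit)
    fix q z assume qz: "(q, z) \<in> \<Omega>"
    show "jtheta (c1 * z powi t * qpr q 0) (q ^ B) \<noteq> 0" using nz(1)[OF qz] domain[OF qz] by simp
    show "jtheta (u * c1 * z powi t * qpr q s) (q ^ B) \<noteq> 0" using nz(2)[OF qz] by (simp add: mult_ac)
  qed (use c c0 B t nc in auto)
  thus ?thesis
  proof (rule theta_rep_cong)
    fix q z assume qz: "(q, z) \<in> \<Omega>"
    have q: "q \<noteq> 0" "norm q < 1" using domain[OF qz] by auto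
    interpret N: nome q using q by unfold_locales
    interpret Q: nome "q ^ B" using B by (rule N.nome_power)
    have z: "z powi t \<noteq> 0" using domain[OF qz] t by (cases "3 dvd M") auto
    have j0: "jtheta c0 (q ^ B) \<noteq> 0" using jtheta_qpr_nz[OF q B, of c0 0] c q by simp
    have j1: "jtheta (u * qpr q s * c0) (q ^ B) \<noteq> 0"
      using jtheta_qpr_nz[OF q B, of "u * c0" s] c nc by (simp add: mult_ac)
    have "appell_m (u * qpr q s) (q ^ B) (c1 * z powi t) - appell_m (u * qpr q s) (q ^ B) c0 =
      c0 * Q.J ^ 3 * jtheta (c1 * z powi t / c0) (q ^ B) * jtheta (u * qpr q s * c0 * (c1 * z powi t)) (q ^ B) /
      (jtheta c0 (q ^ B) * jtheta (c1 * z powi t) (q ^ B) * jtheta (u * qpr q s * c0) (q ^ B) * jtheta (u * qpr q s * (c1 * z powi t)) (q ^ B))"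
      using c0 q z j0 j1 nz[OF qz] by (intro Q.appell_m_change_z) auto
    also have "c1 * z powi t / c0 = c1 * inverse c0 * z powi t * qpr q 0" using q by (simp add: divide_inverse mult_ac)
    also have "u * qpr q s * c0 * (c1 * z powi t) = u * c0 * c1 * z powi t * qpr q s" by (simp add: mult_ac)
    also have "u * qpr q s * c0 = u * c0 * qpr q s" by (simp add: mult_ac)
    also have "u * qpr q s * (c1 * z powi t) = u * c1 * z powi t * qpr q s" by (simp add: mult_ac)
    finally show "appell_m (u * qpr q s) (q ^ B) (c1 * z powi t) - appell_m (u * qpr q s) (q ^ B) c0 =
      c0 * nome.J (q ^ B) ^ 3 * jtheta (c1 * inverse c0 * z powi t * qpr q 0) (q ^ B)
     * jtheta (u * c0 * c1 * z powi t * qpr q s) (q ^ B) *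
      (inverse (jtheta (c0 * qpr q 0) (q ^ B)) * inverse (jtheta (c1 * z powi t * qpr q 0) (q ^ B)) *
       inverse (jtheta (u * c0 * qpr q s) (q ^ B)) * inverse (jtheta (u * c1 * z powi t * qpr q s) (q ^ B)))"
      using q by (simp add: divide_inverse)
  qed
qed

end

section \<open>The rank deviation modulo theta functions\<close>

lemma minus_one_powi_cong:
  assumes "even (k - l)"
  shows "(-1 :: complex) powi k = (-1) powi l"
proof -
  obtain m where "k = l + 2 * m" using assms by (metis add.commute diff_add_cancel evenE)
  thus ?thesis by (simp add: power_int_add power_int_mult)
qed

lemma minus_one_powi_Suc: "(-1 :: complex) powi (k + 1) = - ((-1) powi k)"
  by (simp add: power_int_add)

lemma norm_minus_one_powi: "norm ((-1 :: complex) powi k) = 1"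
  by (simp add: norm_power_int)

lemma minus_one_powi_squared: "((-1 :: complex) powi k) ^ 2 = 1"
  by (simp add: power2_eq_square flip: power_int_mult_distrib)

context theta_domain
begin

lemma theta_rep_dissect_coeff: "theta_rep (\<lambda>q z. dissect_sign N * dissect_coeff q N)"
proof -
  have "dissect_sign N \<in> \<rat>" "(-1 :: complex) powi N \<in> \<rat>" by (auto simp: dissect_sign_def power_int_def)
  thus ?thesis unfolding dissect_coeff_def by (intro theta_rep_mult theta_rep_rat theta_rep_powi)
qed

lemma dissect_term_one_shift:
  assumes qz: "(q, z) \<in> \<Omega>" and n: "0 < n"
  shows "dissect_term q n (N + 3 * int n) 1 = dissect_term q n N 1 - dissect_sign N * dissect_coeff q N"
proof -
  have q: "q \<noteq> 0" "norm q < 1" using domain[OF qz] by auto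
  interpret D: dissection q n "root_b n" "pole_param n 1 q"
    using dissection_intro[OF q, of 1 n] n by simp
  have "jtheta (dissect_arg q n N * 1 ^ (3 * n) * \<i>) D.dissect_base \<noteq> 0"
  proof
    assume "jtheta (dissect_arg q n N * 1 ^ (3 * n) * \<i>) D.dissect_base = 0"
    then obtain m where "dissect_arg q n N * \<i> = q powi (3 * (int n)\<^sup>2 * m)"
      using nome.jtheta_eq_0_iff[OF D.nome_base] D.dissect_arg_nz by (auto simp: D.base_powi)
    hence "(-1) ^ (n + 1) * \<i> * q powi (int n * (3 * int n - 1) div 2 - int n * N) = q powi (3 * (int n)\<^sup>2 * m)"
      by (simp add: dissect_arg_def mult_ac)
    thus False using D.i_powi_neq by blast
  qed
  thus ?thesis using D.dissect_term_shift[of 1 N] by simp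
qed

text \<open>Each shift of the index by 3n costs one monomial in q, so modulo theta functions only
  the residue of N modulo 3n counts.\<close>

lemma dissect_term_one_periodic:
  assumes n: "0 < n"
  shows "theta_rep (\<lambda>q z. dissect_term q n (N + 3 * int n * k) 1 - dissect_term q n N 1)"
proof (induction k rule: int_induct[where k = 0])
  case base
  show ?case using theta_rep_rat[of 0] by simp
next
  case (step1 i)
  have "theta_rep (\<lambda>q z. (dissect_term q n (N + 3 * int n * i) 1 - dissect_term q n N 1) -
      dissect_sign (N + 3 * int n * i) * dissect_coeff q (N + 3 * int n * i))"
    by (intro theta_rep_diff step1 theta_rep_dissect_coeff)
  thus ?case
    by (rule theta_rep_cong) (use dissect_term_one_shift[OF _ n, of _ _ "N + 3 * int n * i"] in \<open>simp add: algebra_simps\<close>)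
next
  case (step2 i)
  have "theta_rep (\<lambda>q z. (dissect_term q n (N + 3 * int n * i) 1 - dissect_term q n N 1) +
      dissect_sign (N + 3 * int n * (i - 1)) * dissect_coeff q (N + 3 * int n * (i - 1)))"
    by (intro theta_rep_add step2 theta_rep_dissect_coeff)
  thus ?case
  proof (rule theta_rep_cong)
    fix q z assume qz: "(q, z) \<in> \<Omega>"
    have "N + 3 * int n * (i - 1) + 3 * int n = N + 3 * int n * i" by (simp add: algebra_simps)
    thus "dissect_term q n (N + 3 * int n * (i - 1)) 1 - dissect_term q n N 1 =
      dissect_term q n (N + 3 * int n * i) 1 - dissect_term q n N 1 +
      dissect_sign (N + 3 * int n * (i - 1)) * dissect_coeff q (N + 3 * int n * (i - 1))"
      using dissect_term_one_shift[OF qz n, of "N + 3 * int n * (i - 1)"] by (simp only:) simp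
  qed
qed

definition class_sum :: "nat \<Rightarrow> complex \<Rightarrow> int \<Rightarrow> complex" where
  "class_sum n q c = (\<Sum>N\<in>{0..<3 * int n}. if M dvd N - c then dissect_term q n N 1 else 0)"

text \<open>As M divides 3n, every M-th root of unity \<zeta> has \<zeta>^(3n) = 1, so m does not
  depend on it and only \<zeta>^N is averaged. The factor 1 - \<zeta> is what produces the second
  class a - 1, with a minus sign.\<close>

lemma rank_deviation_class_sum:
  assumes n: "0 < n" and Mn: "M dvd 3 * int n"
  shows "theta_rep (\<lambda>q z. rank_deviation a M q - (class_sum n q a - class_sum n q (a - 1)))"
proof -
  have z3n: "zeta M j ^ (3 * n) = 1" for j
  proof -
    obtain r where r: "3 * int n = M * r" using Mn by blast
    have "zeta M j ^ (3 * n) = zeta M j powi (3 * int n)" by (metis of_nat_mult of_nat_numeral power_int_of_nat)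
    also have "\<dots> = 1" unfolding r power_int_mult zeta_power_order[OF M_pos] by simp
    finally show ?thesis .
  qed
  define w where "w = (\<lambda>j. 1 / of_int M * (zeta M j powi (- a) * (1 - zeta M j)))"
  have "theta_rep (\<lambda>q z. w j * (nome.level3 (q ^ 1) (zeta M j * qpr q 0) / nome.J (q ^ 1)
     - (\<Sum>N\<in>{0..<3 * int n}. dissect_term (q ^ 1) n N (zeta M j * qpr q 0))))" if "j \<in> {1..<nat M}" for j
  proof (intro theta_rep_mult dissection_theta)
    have "norm (zeta M j powi (- a)) = 1" by (simp add: norm_power_int norm_zeta)
    thus "theta_rep (\<lambda>q z. w j)" unfolding w_def
      by (intro theta_rep_mult theta_rep_diff theta_rep_rat theta_rep_unit norm_zeta) auto
    have "zeta M j ^ (6 * n) = (zeta M j ^ (3 * n)) ^ 2" by (simp flip: power_mult add: mult.commute)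
    thus "zeta M j ^ (6 * n) = 1" using z3n by simp
    show "\<forall>m. 0 \<noteq> of_int (int 1 * m)" if "zeta M j = 1"
      using zeta_neq_1[OF M_pos, of j] that \<open>j \<in> _\<close> by simp
  qed (use n norm_zeta in auto)
  hence "theta_rep (\<lambda>q z. \<Sum>j\<in>{1..<nat M}. w j * (nome.level3 (q ^ 1) (zeta M j * qpr q 0) / nome.J (q ^ 1)
     - (\<Sum>N\<in>{0..<3 * int n}. dissect_term (q ^ 1) n N (zeta M j * qpr q 0))))"
    by (intro theta_rep_sum) auto
  thus ?thesis
  proof (rule theta_rep_cong)
    fix q z assume qz: "(q, z) \<in> \<Omega>"
    have q: "q \<noteq> 0" "norm q < 1" using domain[OF qz] by auto
    interpret nome q using q by unfold_locales
    have dt: "dissect_term q n N (zeta M j) = zeta M j powi N * dissect_term q n N 1" for N j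
      unfolding dissect_term_def z3n by (simp add: mult_ac)
    have orth: "(\<Sum>j\<in>{1..<nat M}. w j * zeta M j powi N) = (if M dvd N - a then 1 else 0) - (if M dvd N - (a - 1) then 1 else 0)" for N
    proof -
      \<comment> \<open>The weight vanishes at the trivial root, so the sum may be completed to all
        roots of unity.\<close>
      have "w 0 = 0" by (simp add: w_def zeta_def)
      moreover have "{..<nat M} = insert 0 {1..<nat M}" using M_pos by auto
      ultimately have "(\<Sum>j\<in>{1..<nat M}. w j * zeta M j powi N) = (\<Sum>j<nat M. w j * zeta M j powi N)" by simp
      also have "\<dots> = (\<Sum>j<nat M. 1 / of_int M * (zeta M j powi (N - a) - zeta M j powi (N - (a - 1))))"
      proof (intro sum.cong refl)
        fix j
        have e: "zeta M j powi (N - a) = zeta M j powi (- a) * zeta M j powi N"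
          using zeta_nz by (simp flip: power_int_add)
        have "N - (a - 1) = (N - a) + 1" by simp
        hence "zeta M j powi (N - (a - 1)) = zeta M j powi (N - a) * zeta M j"
          using zeta_nz by (metis power_int_add_1)
        thus "w j * zeta M j powi N = 1 / of_int M * (zeta M j powi (N - a) - zeta M j powi (N - (a - 1)))"
          unfolding w_def e by (simp add: algebra_simps)
      qed
      also have "\<dots> = 1 / of_int M * ((\<Sum>j<nat M. zeta M j powi (N - a)) - (\<Sum>j<nat M. zeta M j powi (N - (a - 1))))"
        by (simp only: sum_distrib_left sum_subtractf right_diff_distrib)
      also have "\<dots> = (if M dvd N - a then 1 else 0) - (if M dvd N - (a - 1) then 1 else 0)"
        unfolding zeta_orthogonality[OF M_pos] using M_pos by auto
      finally show ?thesis .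
    qed
    have "rank_deviation a M q = (\<Sum>j\<in>{1..<nat M}. w j * (level3 (zeta M j) / J))"
      unfolding rank_deviation_level3[OF M_pos nome_axioms] sum_distrib_left w_def by (simp add: mult_ac)
    moreover have "(\<Sum>j\<in>{1..<nat M}. w j * (\<Sum>N\<in>{0..<3 * int n}. dissect_term q n N (zeta M j))) =
        class_sum n q a - class_sum n q (a - 1)"
    proof -
      have "(\<Sum>j\<in>{1..<nat M}. w j * (\<Sum>N\<in>{0..<3 * int n}. dissect_term q n N (zeta M j))) =
         (\<Sum>j\<in>{1..<nat M}. \<Sum>N\<in>{0..<3 * int n}. w j * zeta M j powi N * dissect_term q n N 1)"
        unfolding dt sum_distrib_left by (simp only: mult.assoc)
      also have "\<dots> = (\<Sum>N\<in>{0..<3 * int n}. (\<Sum>j\<in>{1..<nat M}. w j * zeta M j powi N) * dissect_term q n N 1)"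
        unfolding sum_distrib_right by (rule sum.swap)
      also have "\<dots> = class_sum n q a - class_sum n q (a - 1)"
        unfolding orth class_sum_def sum_subtractf[symmetric] by (intro sum.cong) (auto simp: algebra_simps)
      finally show ?thesis .
    qed
    ultimately show "rank_deviation a M q - (class_sum n q a - class_sum n q (a - 1)) =
      (\<Sum>j\<in>{1..<nat M}. w j * (nome.level3 (q ^ 1) (zeta M j * qpr q 0) / nome.J (q ^ 1)
     - (\<Sum>N\<in>{0..<3 * int n}. dissect_term (q ^ 1) n N (zeta M j * qpr q 0))))"
      using q by (simp add: right_diff_distrib sum_subtractf)
  qed
qed

text \<open>A class modulo M has r = 3n/M lifts modulo 3n. Starting them at a freely chosen d later
  makes the exponents agree with those of the stated formulas.\<close>

lemma class_sum_lifts: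
  assumes n: "0 < n" and r: "3 * int n = M * r" and cd: "M dvd c - d"
  shows "theta_rep (\<lambda>q z. class_sum n q c - (\<Sum>k\<in>{0..<r}. dissect_term q n (d + k * M) 1))"
proof -
  have r0: "0 < r" using r n M_pos by (metis mult_pos_pos of_nat_0_less_iff zero_less_mult_pos zero_less_numeral less_le_trans zero_less_one)
  have Mr: "0 < M * r" using r0 M_pos by simp
  have "class_sum n q c = (\<Sum>k\<in>{0..<r}. dissect_term q n ((d + k * M) mod (M * r)) 1)" for q
  proof -
    have "class_sum n q c = (\<Sum>N\<in>{N \<in> {0..<M * r}. M dvd N - d}. dissect_term q n N 1)"
    proof -
      have "M dvd N - c \<longleftrightarrow> M dvd N - d" for N
        using cd by (metis diff_add_cancel dvd_add_right_iff diff_add_eq diff_diff_eq2 dvd_diff_commute add.commute)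
      hence "class_sum n q c = (\<Sum>N\<in>{0..<M * r}. if M dvd N - d then dissect_term q n N 1 else 0)"
        unfolding class_sum_def r by simp
      thus ?thesis by (simp only: sum.inter_filter[OF finite_atLeastLessThan_int])
    qed
    also have "\<dots> = (\<Sum>k\<in>{0..<r}. dissect_term q n ((d + k * M) mod (M * r)) 1)"
    proof (rule sum.reindex_bij_witness[of _ "\<lambda>k. (d + k * M) mod (M * r)" "\<lambda>N. ((N - d) div M) mod r"])
      fix N assume N: "N \<in> {N \<in> {0..<M * r}. M dvd N - d}"
      then obtain t where t: "N - d = M * t" by blast
      have e: "(N - d) div M mod r = t - r * (t div r)" unfolding t using M_pos by (simp add: minus_mult_div_eq_mod)
      have "d + (t - r * (t div r)) * M = N + (M * r) * (- (t div r))" using t by (simp add: algebra_simps)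
      hence "(d + (N - d) div M mod r * M) mod (M * r) = N mod (M * r)" unfolding e by (simp only: mod_mult_self2)
      thus "(d + (N - d) div M mod r * M) mod (M * r) = N" using N by simp
      thus "dissect_term q n ((d + (N - d) div M mod r * M) mod (M * r)) 1 = dissect_term q n N 1" by simp
      show "(N - d) div M mod r \<in> {0..<r}" using r0 by simp
    next
      fix k assume k: "k \<in> {0..<r}"
      define u where "u = (d + k * M) div (M * r)"
      have e: "(d + k * M) mod (M * r) - d = M * (k - r * u)"
        unfolding u_def minus_mult_div_eq_mod[symmetric] by (simp add: algebra_simps)
      have "((d + k * M) mod (M * r) - d) div M mod r = (k + r * (- u)) mod r" unfolding e using M_pos by simp
      thus "((d + k * M) mod (M * r) - d) div M mod r = k" using k by (simp only: mod_mult_self2) simp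
      show "(d + k * M) mod (M * r) \<in> {N \<in> {0..<M * r}. M dvd N - d}" using Mr e by simp
    qed
    finally show ?thesis .
  qed
  moreover have "theta_rep (\<lambda>q z. - (\<Sum>k\<in>{0..<r}. dissect_term q n ((d + k * M) mod (M * r) + 3 * int n * ((d + k * M) div (M * r))) 1
       - dissect_term q n ((d + k * M) mod (M * r)) 1))"
    by (intro theta_rep_minus theta_rep_sum dissect_term_one_periodic n) auto
  ultimately show ?thesis by (simp add: r sum_subtractf)
qed

section \<open>Moduli divisible by three\<close>

lemma dissect_arg_appell_x:
  assumes "M = 3 * int n"
  shows "dissect_arg q n N = appell_x M q (M - 1 - 2 * N)"
proof -
  have "even (int n * (3 * int n - 1))" by auto
  then obtain h where h: "int n * (3 * int n - 1) = 2 * h" by (rule evenE)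
  have "M * (M - 1 - 2 * N) = 3 * (int n * (3 * int n - 1)) - 6 * (int n * N)" by (simp add: assms algebra_simps)
  also have "\<dots> = 6 * (h - int n * N)" unfolding h by simp
  finally have 1: "M * (M - 1 - 2 * N) div 6 = h - int n * N" by simp
  have "(-1 :: complex) powi (M + 1) = (-1) powi int (n + 1)" by (rule minus_one_powi_cong) (simp add: assms)
  thus ?thesis unfolding dissect_arg_def appell_x_def 1 h by (simp only: power_int_of_nat) simp
qed

lemma appell_x_qpr:
  assumes "q \<noteq> 0"
  shows "appell_x M q k = (-1) powi (M + 1) * qpr q (of_int (M * k div 6))"
  using qpr_int[OF assms] by (simp add: appell_x_def)

lemma base_three:
  assumes "M = 3 * int n"
  shows "q powi (M\<^sup>2 div 3) = q ^ (3 * n\<^sup>2)"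
proof -
  have "M\<^sup>2 div 3 = int (3 * n\<^sup>2)" by (simp add: assms power_mult_distrib)
  thus ?thesis by (simp only: power_int_of_nat)
qed

text \<open>The fixed parameter may be i or -i, because the case a = 0 produces a sum with
  -i.\<close>

lemma appell_m_at_theta:
  assumes Mn: "M = 3 * int n" and c0: "c0 = \<i> \<or> c0 = - \<i>"
    and ok: "\<And>q z. (q, z) \<in> \<Omega> \<Longrightarrow> appell_defined (appell_x M q k) (q powi (M\<^sup>2 div 3)) z"
  shows "theta_rep (\<lambda>q z. m_at M q z k - appell_m (appell_x M q k) (q ^ (3 * n\<^sup>2)) c0)"
proof -
  have n: "0 < n" using Mn M_pos by simp
  hence B: "0 < 3 * n\<^sup>2" by simp
  have u: "(-1 :: complex) powi (M + 1) = 1 \<or> (-1 :: complex) powi (M + 1) = -1"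
    using minus_one_powi_squared[of "M + 1"] by (simp add: power2_eq_1_iff)
  have "theta_rep (\<lambda>q z. appell_m ((-1) powi (M + 1) * qpr q (of_int (M * k div 6))) (q ^ (3 * n\<^sup>2)) (1 * z powi 1)
      - appell_m ((-1) powi (M + 1) * qpr q (of_int (M * k div 6))) (q ^ (3 * n\<^sup>2)) c0)"
  proof (rule appell_m_change_theta[OF B])
    show "\<not> 3 dvd M \<Longrightarrow> (1::int) = 0" using Mn by simp
    show "norm ((-1 :: complex) powi (M + 1)) = 1" by (rule norm_minus_one_powi)
    show "norm c0 = 1" using c0 by auto
    show "c0 \<noteq> 1" using c0 by (auto simp: complex_eq_iff)
    show "(-1) powi (M + 1) * c0 \<noteq> 1" using u c0 by (auto simp: complex_eq_iff)
    fix q z assume qz: "(q, z) \<in> \<Omega>"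
    have q: "q \<noteq> 0" "norm q < 1" using domain[OF qz] by auto
    interpret N: nome q using q by unfold_locales
    interpret Q: nome "q ^ (3 * n\<^sup>2)" by (rule N.nome_power[OF B])
    have "appell_defined ((-1) powi (M + 1) * qpr q (of_int (M * k div 6))) (q ^ (3 * n\<^sup>2)) z"
      using ok[OF qz] unfolding base_three[OF Mn] appell_x_qpr[OF q(1)] .
    thus "jtheta (1 * z powi 1) (q ^ (3 * n\<^sup>2)) \<noteq> 0"
      "jtheta ((-1) powi (M + 1) * qpr q (of_int (M * k div 6)) * (1 * z powi 1)) (q ^ (3 * n\<^sup>2)) \<noteq> 0"
      using Q.jtheta_eq_0_iff by (auto simp: appell_defined_def)
  qed auto
  thus ?thesis
    by (rule theta_rep_cong) (use domain in \<open>simp add: base_three[OF Mn] appell_x_qpr\<close>)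
qed

lemma rank_deviation_three:
  assumes Mn: "M = 3 * int n"
  shows "theta_rep (\<lambda>q z. rank_deviation a M q - (dissect_term q n a 1 - dissect_term q n (a - 1) 1))"
proof -
  have n: "0 < n" using Mn M_pos by simp
  have d: "theta_rep (\<lambda>q z. class_sum n q c - dissect_term q n c 1)" for c
  proof -
    have "{0..<1 :: int} = {0}" by auto
    thus ?thesis using class_sum_lifts[OF n, of 1 c c] Mn by simp
  qed
  have "theta_rep (\<lambda>q z. (rank_deviation a M q - (class_sum n q a - class_sum n q (a - 1)))
      + ((class_sum n q a - dissect_term q n a 1) - (class_sum n q (a - 1) - dissect_term q n (a - 1) 1)))"
    using Mn by (intro theta_rep_add theta_rep_diff d rank_deviation_class_sum n) simp
  thus ?thesis by (rule theta_rep_cong) simp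
qed

text \<open>The indices a and a - 1 give the two Appell-Lerch sums directly when a is nonzero, and
  one of them has sign 0 if a is 1 modulo 3. For a = 0 the index -1 has to be transformed back to
  the index 0, which doubles the sum.\<close>

lemma mock_part0_theta:
  assumes Mn: "M = 3 * int n" and a: "a = 0 \<or> a mod 3 = 0 \<or> a mod 3 = 1"
    and ok: "\<And>q z k. (q, z) \<in> \<Omega> \<Longrightarrow>
      k \<in> (if a = 0 then {M - 1} else if a mod 3 = 0 then {M - 2 * a - 1, M - 2 * a + 1} else {M - 2 * a + 1}) \<Longrightarrow>
      appell_defined (appell_x M q k) (q powi (M\<^sup>2 div 3)) z"
  shows "theta_rep (\<lambda>q z. rank_deviation a M q - mock_part0 a M q z)"
proof -
  have n: "0 < n" using Mn M_pos by simp
  define B where "B = 3 * n\<^sup>2"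
  have dt: "dissect_term q n N 1 = dissect_sign N * dissect_coeff q N * appell_m (appell_x M q (M - 1 - 2 * N)) (q ^ B) \<i>" for q N
    by (simp add: dissect_term_def dissect_arg_appell_x[OF Mn] B_def)
  have ch: "theta_rep (\<lambda>q z. m_at M q z k - appell_m (appell_x M q k) (q ^ B) c0)"
    if "c0 = \<i> \<or> c0 = - \<i>"
      "k \<in> (if a = 0 then {M - 1} else if a mod 3 = 0 then {M - 2 * a - 1, M - 2 * a + 1} else {M - 2 * a + 1})" for k c0
    unfolding B_def using appell_m_at_theta[OF Mn that(1) ok[OF _ that(2)]] by blast
  note rd = rank_deviation_three[OF Mn, of a]
  show ?thesis
  proof (cases "a = 0")
    case True
    have ch0: "theta_rep (\<lambda>q z. m_at M q z (M - 1) - appell_m (appell_x M q (M - 1)) (q ^ B) \<i>)"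
      "theta_rep (\<lambda>q z. m_at M q z (M - 1) - appell_m (appell_x M q (M - 1)) (q ^ B) (- \<i>))"
      using ch True by auto
    have "theta_rep (\<lambda>q z. (rank_deviation a M q - (dissect_term q n a 1 - dissect_term q n (a - 1) 1))
       - (m_at M q z (M - 1) - appell_m (appell_x M q (M - 1)) (q ^ B) \<i>)
       - (m_at M q z (M - 1) - appell_m (appell_x M q (M - 1)) (q ^ B) (- \<i>)) - 1)"
      by (intro theta_rep_diff rd ch0 theta_rep_rat) auto
    thus ?thesis
    proof (rule theta_rep_cong)
      fix q z assume qz: "(q, z) \<in> \<Omega>"
      have q: "q \<noteq> 0" "norm q < 1" using domain[OF qz] by auto
      interpret N: nome q using q by unfold_locales
      have B0: "0 < B" using n by (simp add: B_def)
      interpret Q: nome "q ^ B" by (rule N.nome_power[OF B0])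
      interpret D: dissection q n "root_b n" "pole_param n 1 q"
        using dissection_intro[OF q, of 1 n] n by simp
      define W where "W = appell_x M q (M - 1)"
      have W0: "W \<noteq> 0" using q by (simp add: W_def appell_x_def)
      have W: "W = dissect_arg q n 0" using dissect_arg_appell_x[OF Mn, of q 0] by (simp add: W_def)
      \<comment> \<open>The arguments for the indices 0 and -1 multiply to the base, so a shift
        followed by inversion leads from one to the other.\<close>
      have W1: "appell_x M q (M - 1 - 2 * (-1)) = q ^ B * inverse W"
      proof -
        have "even (int n * (3 * int n - 1))" by auto
        then obtain h where h: "int n * (3 * int n - 1) = 2 * h" by (rule evenE)
        have "h + int n + h = 3 * (int n)\<^sup>2" using h by (simp add: power2_eq_square algebra_simps)
        hence "q powi (h + int n + h) = q powi (int B)" by (simp add: B_def)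
        hence "q powi (h + int n) * q powi h = q ^ B"
          by (simp only: power_int_add[OF disjI1[OF q(1)]] power_int_of_nat)
        moreover have "((-1 :: complex) ^ n) * (-1) ^ n = 1" by (simp flip: power_mult_distrib)
        ultimately have "dissect_arg q n (-1) * dissect_arg q n 0 = q ^ B"
          unfolding dissect_arg_def h by (simp add: mult_ac)
        hence "dissect_arg q n (-1) = q ^ B * inverse W" using W0 W by (simp add: field_simps)
        thus ?thesis using dissect_arg_appell_x[OF Mn, of q "-1"] by simp
      qed
      have jW: "jtheta (inverse W * \<i>) (q ^ B) \<noteq> 0"
      proof
        assume "jtheta (inverse W * \<i>) (q ^ B) = 0"
        then obtain m where "inverse W * \<i> = (q ^ B) powi m" using Q.jtheta_eq_0_iff W0 by auto
        also have "(q ^ B) powi m = q powi (int B * m)" by (simp add: power_int_mult)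
        finally have iW: "\<i> = q powi (int B * m) * W" using W0 by (simp add: field_simps)
        have "(-1) ^ (n + 1) * \<i> = ((-1) ^ (n + 1) * (-1) ^ (n + 1)) * (q powi (int B * m) *
            q powi (int n * (3 * int n - 1) div 2 - int n * 0))"
          unfolding iW[unfolded W dissect_arg_def] by (simp only: mult_ac)
        moreover have "((-1 :: complex) ^ (n + 1)) * (-1) ^ (n + 1) = 1" by (simp flip: power_mult_distrib)
        ultimately have "(-1) ^ (n + 1) * \<i> * q powi 0 = q powi (int B * m + (int n * (3 * int n - 1) div 2 - int n * 0))"
          unfolding power_int_add[OF disjI1[OF q(1)]] by (simp only: power_int_0_right mult_1 mult_1_right)
        thus False using D.i_powi_neq by blast
      qed
      have ji: "jtheta \<i> (q ^ B) \<noteq> 0" using D.jtheta_i_base by (simp add: D.dissect_base_def B_def)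
      have "appell_m (q ^ B * inverse W) (q ^ B) \<i> = 1 - inverse W * appell_m (inverse W) (q ^ B) \<i>"
        using W0 jW ji by (intro Q.appell_m_mult_q) auto
      also have "appell_m (inverse W) (q ^ B) \<i> = W * appell_m W (q ^ B) (- \<i>)"
        using Q.appell_m_inverse[of "- \<i>" W] W0 by simp
      finally have m1: "appell_m (appell_x M q (M - 1 - 2 * (-1))) (q ^ B) \<i> = 1 - appell_m W (q ^ B) (- \<i>)"
        unfolding W1 using W0 by simp
      have "dissect_term q n a 1 = appell_m W (q ^ B) \<i>"
        using True by (simp add: dt W_def dissect_sign_def dissect_coeff_def)
      moreover have "dissect_term q n (a - 1) 1 = 1 - appell_m W (q ^ B) (- \<i>)"
        unfolding m1[symmetric] using True by (simp add: dt dissect_sign_def dissect_coeff_def power_int_minus)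
      ultimately show "rank_deviation a M q - mock_part0 a M q z =
        (rank_deviation a M q - (dissect_term q n a 1 - dissect_term q n (a - 1) 1))
       - (m_at M q z (M - 1) - appell_m (appell_x M q (M - 1)) (q ^ B) \<i>)
       - (m_at M q z (M - 1) - appell_m (appell_x M q (M - 1)) (q ^ B) (- \<i>)) - 1"
        using True by (simp add: mock_part0_def W_def[symmetric])
    qed
  next
    case False
    define t1 t2 where "t1 = (\<lambda>q. dissect_sign a * dissect_coeff q a)"
      and "t2 = (\<lambda>q. dissect_sign (a - 1) * dissect_coeff q (a - 1))"
    have k1: "M - 1 - 2 * a = M - 2 * a - 1" and k2: "M - 1 - 2 * (a - 1) = M - 2 * a + 1" by auto
    have T2: "theta_rep (\<lambda>q z. t2 q * (m_at M q z (M - 2 * a + 1) - appell_m (appell_x M q (M - 2 * a + 1)) (q ^ B) \<i>))"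
      unfolding t2_def using False a by (intro theta_rep_mult[OF theta_rep_dissect_coeff] ch) auto
    have e2: "(a - 1) * (a - 1 + 1) = a * (a - 1)" by (simp add: algebra_simps)
    have s2: "(-1 :: complex) powi (a - 1) = (-1) powi (a + 1)" by (rule minus_one_powi_cong) simp
    show ?thesis
    proof (cases "a mod 3 = 0")
      case a3: True
      have "theta_rep (\<lambda>q z. t1 q * (m_at M q z (M - 2 * a - 1) - appell_m (appell_x M q (M - 2 * a - 1)) (q ^ B) \<i>))"
        unfolding t1_def using False a3 by (intro theta_rep_mult[OF theta_rep_dissect_coeff] ch) auto
      from theta_rep_diff[OF rd theta_rep_diff[OF this T2]]
      show ?thesis
      proof (rule theta_rep_cong)
        fix q z assume "(q, z) \<in> \<Omega>"
        have "(a - 1) mod 3 = 2" using a3 by presburger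
        hence sg: "dissect_sign a = 1" "dissect_sign (a - 1) = -1" using a3 by (auto simp: dissect_sign_def)
        have mp: "mock_part0 a M q z = t1 q * m_at M q z (M - 2 * a - 1) - t2 q * m_at M q z (M - 2 * a + 1)"
          unfolding mock_part0_def t1_def t2_def sg dissect_coeff_def e2 s2 using False a3 by simp
        have dts: "dissect_term q n a 1 = t1 q * appell_m (appell_x M q (M - 2 * a - 1)) (q ^ B) \<i>"
          "dissect_term q n (a - 1) 1 = t2 q * appell_m (appell_x M q (M - 2 * a + 1)) (q ^ B) \<i>"
          by (simp_all only: dt k1 k2 t1_def t2_def)
        show "rank_deviation a M q - mock_part0 a M q z = rank_deviation a M q - (dissect_term q n a 1 - dissect_term q n (a - 1) 1)
          - (t1 q * (m_at M q z (M - 2 * a - 1) - appell_m (appell_x M q (M - 2 * a - 1)) (q ^ B) \<i>)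
            - t2 q * (m_at M q z (M - 2 * a + 1) - appell_m (appell_x M q (M - 2 * a + 1)) (q ^ B) \<i>))"
          unfolding mp dts by (simp only: algebra_simps)
      qed
    next
      case a3: False
      have am: "a mod 3 = 1" using a a3 False by auto
      from theta_rep_add[OF rd T2]
      show ?thesis
      proof (rule theta_rep_cong)
        fix q z assume "(q, z) \<in> \<Omega>"
        have "(a - 1) mod 3 = 0" using am by presburger
        hence sg: "dissect_sign a = 0" "dissect_sign (a - 1) = 1" using am by (auto simp: dissect_sign_def)
        have s3: "(-1 :: complex) powi (a + 1) = - ((-1) powi a)" by (rule minus_one_powi_Suc)
        have mp: "mock_part0 a M q z = - t2 q * m_at M q z (M - 2 * a + 1)"
          unfolding mock_part0_def t2_def sg dissect_coeff_def e2 s2 s3 using False a3 by simp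
        have dts: "dissect_term q n a 1 = 0"
          "dissect_term q n (a - 1) 1 = t2 q * appell_m (appell_x M q (M - 2 * a + 1)) (q ^ B) \<i>"
          by (simp_all only: dt k2 t2_def sg mult_zero_left)
        show "rank_deviation a M q - mock_part0 a M q z = rank_deviation a M q - (dissect_term q n a 1 - dissect_term q n (a - 1) 1)
          + t2 q * (m_at M q z (M - 2 * a + 1) - appell_m (appell_x M q (M - 2 * a + 1)) (q ^ B) \<i>)"
          unfolding mp dts by (simp add: algebra_simps)
      qed
    qed
  qed
qed

end

section \<open>Moduli coprime to three\<close>

context theta_domain
begin

definition coset_sum :: "int \<Rightarrow> complex \<Rightarrow> complex" where
  "coset_sum N q = (\<Sum>k\<in>{0..<3}. dissect_term q (nat M) (N + k * M) 1)"

lemma rank_deviation_coset_sum: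
  assumes "M dvd a - N" "M dvd a - 1 - N'"
  shows "theta_rep (\<lambda>q z. rank_deviation a M q - (coset_sum N q - coset_sum N' q))"
proof -
  have n: "0 < nat M" and Mn: "3 * int (nat M) = M * 3" using M_pos by auto
  have "theta_rep (\<lambda>q z. (rank_deviation a M q - (class_sum (nat M) q a - class_sum (nat M) q (a - 1)))
      + ((class_sum (nat M) q a - coset_sum N q) - (class_sum (nat M) q (a - 1) - coset_sum N' q)))"
    unfolding coset_sum_def
    by (intro theta_rep_add theta_rep_diff rank_deviation_class_sum class_sum_lifts n Mn assms) (simp add: Mn)
  thus ?thesis by (rule theta_rep_cong) simp
qed

text \<open>These residues modulo 3 are the ones for which N + M is 1 modulo 3, so that the middle
  lift drops out, and for which all divisions by 6 are exact.\<close>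

lemma leading_exponents:
  assumes A: "(M mod 3 = 1 \<and> N mod 3 = 0) \<or> (M mod 3 = 2 \<and> N mod 3 = 2)"
  obtains h e where "M * (M - 1 - 2 * N) = 6 * h" "N * (N + 1) = 6 * e"
proof -
  have six: "3 dvd X \<Longrightarrow> 2 dvd X \<Longrightarrow> 6 dvd X" for X :: int by presburger
  have "3 dvd M - 1 - 2 * N" using A by presburger
  hence "3 dvd M * (M - 1 - 2 * N)" by simp
  moreover have "even (M * (M - 1 - 2 * N))" by auto
  ultimately have "6 dvd M * (M - 1 - 2 * N)" by (intro six)
  moreover have "3 dvd N \<or> 3 dvd N + 1" using A by presburger
  hence "3 dvd N * (N + 1)" by (auto intro: dvd_mult dvd_mult2)
  moreover have "even (N * (N + 1))" by auto
  ultimately have "6 dvd M * (M - 1 - 2 * N)" "6 dvd N * (N + 1)" by (blast intro: six)+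
  thus ?thesis using that by (auto simp: dvd_def)
qed

text \<open>
  The lift \<open>N + M\<close> does not contribute, and the other two reassemble to the
  dissection with \<open>n = 1\<close> of the level three sum with base \<open>q ^ M\<^sup>2\<close>.
\<close>

lemma coset_sum_eq:
  assumes A: "(M mod 3 = 1 \<and> N mod 3 = 0) \<or> (M mod 3 = 2 \<and> N mod 3 = 2)"
    and q: "q \<noteq> 0"
  shows "coset_sum N q = dissect_sign N * dissect_coeff q N *
    (\<Sum>j\<in>{0..<3 * int 1}. dissect_term (q ^ (nat M)\<^sup>2) 1 j (appell_x M q (M - 1 - 2 * N)))"
proof -
  obtain h e where h: "M * (M - 1 - 2 * N) = 6 * h" and e: "N * (N + 1) = 6 * e"
    using leading_exponents[OF A] by blast
  define n where "n = nat M"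
  have M: "M = int n" using M_pos by (simp add: n_def)
  define \<kappa> where "\<kappa> = (-1 :: complex) powi (M + 1)"
  have k3: "\<kappa> ^ 3 = \<kappa>" "\<kappa> ^ 2 = 1"
    using minus_one_powi_squared[of "M + 1"] by (auto simp: \<kappa>_def power3_eq_cube power2_eq_square)
  define Q where "Q = q ^ n\<^sup>2"
  define X where "X = appell_x M q (M - 1 - 2 * N)"
  have "q powi (M\<^sup>2) = q powi int (n\<^sup>2)" by (simp add: M)
  hence Q: "Q = q powi (M\<^sup>2)" unfolding Q_def by (simp only: power_int_of_nat)
  have X: "X = \<kappa> * q powi h" unfolding X_def appell_x_def \<kappa>_def h by simp
  have qa: "q powi (x + y) = q powi x * q powi y" for x y using q by (simp add: power_int_add)
  have X3: "X ^ 3 = \<kappa> * q powi (3 * h)" "X ^ 2 = q powi (2 * h)"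
  proof -
    have "(q powi h) ^ 3 = q powi (h + h + h)" "(q powi h) ^ 2 = q powi (h + h)"
      by (simp_all only: qa power3_eq_cube power2_eq_square)
    thus "X ^ 3 = \<kappa> * q powi (3 * h)" "X ^ 2 = q powi (2 * h)"
      unfolding X power_mult_distrib k3 by simp_all
  qed
  have "even (int n * (3 * int n - 1))" by auto
  then obtain g where g: "int n * (3 * int n - 1) = 2 * g" by (rule evenE)
  have "2 * (g - int n * N) = 2 * (M\<^sup>2 + 3 * h)"
    using h g by (simp add: M algebra_simps power2_eq_square)
  hence g': "g - int n * N = M\<^sup>2 + 3 * h" by simp
  have k: "(-1 :: complex) ^ (n + 1) = \<kappa>" unfolding \<kappa>_def M by (simp add: power_int_add)
  have a0: "dissect_arg q n N = Q * X ^ 3"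
    unfolding dissect_arg_def g k X3 Q using g' by (simp add: qa)
  have g2: "g - int n * (N + 2 * M) = 3 * h - M\<^sup>2"
    using g' by (simp add: M algebra_simps power2_eq_square)
  have ga: "2 * g div 2 = g" by simp
  have a2: "dissect_arg q n (N + 2 * M) = inverse Q * X ^ 3"
    unfolding dissect_arg_def g ga g2 k X3 Q using q by (simp add: power_int_diff field_simps)
  have e2: "- ((N + 2 * M) * (N + 2 * M + 1)) = 6 * (- e + (2 * h - M\<^sup>2))"
    using e h by (simp add: algebra_simps power2_eq_square)
  have s2: "(-1 :: complex) powi (N + 2 * M) = (-1) powi N" by (rule minus_one_powi_cong) simp
  have c2: "dissect_coeff q (N + 2 * M) = dissect_coeff q N * (X ^ 2 * inverse Q)"
  proof -
    have "- (N * (N + 1)) = 6 * (- e)" using e by simp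
    hence "dissect_coeff q N = (-1) powi N * q powi (- e)"
      unfolding dissect_coeff_def by (simp only: nonzero_mult_div_cancel_left)
    moreover have "dissect_coeff q (N + 2 * M) = (-1) powi N * q powi (- e + (2 * h - M\<^sup>2))"
      unfolding dissect_coeff_def e2 s2 by simp
    ultimately show ?thesis unfolding X3 Q qa using q by (simp add: power_int_diff divide_inverse)
  qed
  have sg: "dissect_sign (N + M) = 0" "dissect_sign (N + 2 * M) = - dissect_sign N"
  proof -
    have "(N + M) mod 3 = 1" using A by presburger
    thus "dissect_sign (N + M) = 0" by (simp add: dissect_sign_def)
    have "N mod 3 = 0 \<and> (N + 2 * M) mod 3 = 2 \<or> N mod 3 = 2 \<and> (N + 2 * M) mod 3 = 0" using A by presburger
    thus "dissect_sign (N + 2 * M) = - dissect_sign N" by (auto simp: dissect_sign_def)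
  qed
  have B: "Q ^ (3 * 1\<^sup>2) = q ^ (3 * n\<^sup>2)" by (simp add: Q_def mult.commute flip: power_mult)
  have r: "{0..<3 :: int} = {0, 1, 2}" by auto
  have cQ: "dissect_coeff Q 0 = 1" "dissect_coeff Q 2 = inverse Q"
    "dissect_arg Q 1 0 = Q" "dissect_arg Q 1 2 = inverse Q"
    "dissect_sign 0 = 1" "dissect_sign 1 = 0" "dissect_sign 2 = -1"
    by (simp_all add: dissect_coeff_def dissect_arg_def dissect_sign_def power_int_minus)
  have L: "coset_sum N q = dissect_term q n N 1 + dissect_term q n (N + M) 1 + dissect_term q n (N + 2 * M) 1"
    unfolding coset_sum_def r n_def by simp
  have R: "(\<Sum>j\<in>{0..<3 * int 1}. dissect_term Q 1 j X)
      = dissect_term Q 1 0 X + dissect_term Q 1 1 X + dissect_term Q 1 2 X"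
    using r by simp
  have t: "dissect_term q n N 1 = dissect_sign N * dissect_coeff q N * appell_m (Q * X ^ 3) (q ^ (3 * n\<^sup>2)) \<i>"
    "dissect_term q n (N + M) 1 = 0"
    "dissect_term q n (N + 2 * M) 1 = - dissect_sign N * (dissect_coeff q N * (X ^ 2 * inverse Q)) *
        appell_m (inverse Q * X ^ 3) (q ^ (3 * n\<^sup>2)) \<i>"
    unfolding dissect_term_def sg a0 a2 c2 by simp_all
  have t': "dissect_term Q 1 0 X = appell_m (Q * X ^ 3) (q ^ (3 * n\<^sup>2)) \<i>"
    "dissect_term Q 1 1 X = 0"
    "dissect_term Q 1 2 X = - (X ^ 2 * inverse Q) * appell_m (inverse Q * X ^ 3) (q ^ (3 * n\<^sup>2)) \<i>"
    unfolding dissect_term_def cQ B by simp_all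
  have "coset_sum N q = dissect_sign N * dissect_coeff q N * (\<Sum>j\<in>{0..<3 * int 1}. dissect_term Q 1 j X)"
    unfolding L R t t' by (simp add: algebra_simps)
  thus ?thesis unfolding Q_def X_def n_def .
qed

text \<open>If M k / 6 were a multiple of M^2, then 6M would divide k. So the level three sum in
  base q^(M^2) is regular at the argument with index k.\<close>

lemma coset_exponent_not_multiple:
  assumes h: "M * k = 6 * h" and k: "k \<noteq> 0" "\<bar>k\<bar> < 6 * M"
  shows "(of_int h :: rat) \<noteq> of_int (int ((nat M)\<^sup>2) * m)"
proof
  assume "(of_int h :: rat) = of_int (int ((nat M)\<^sup>2) * m)"
  hence "h = int ((nat M)\<^sup>2) * m" by (simp only: of_int_eq_iff)
  also have "int ((nat M)\<^sup>2) = M\<^sup>2" using M_pos by simp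
  finally have "M * k = 6 * (M\<^sup>2 * m)" using h by simp
  also have "\<dots> = M * (6 * M * m)" by (simp add: power2_eq_square)
  finally have "M * k = M * (6 * M * m)" .
  hence km: "k = 6 * M * m" using M_pos by simp
  hence "\<bar>k\<bar> = 6 * M * \<bar>m\<bar>" using M_pos by (simp add: abs_mult)
  moreover have "1 \<le> \<bar>m\<bar>" using km k by auto
  hence "6 * M * 1 \<le> 6 * M * \<bar>m\<bar>" using M_pos by (intro mult_left_mono) auto
  ultimately show False using k by simp
qed

lemma coset_sum_level3:
  assumes A: "(M mod 3 = 1 \<and> N mod 3 = 0) \<or> (M mod 3 = 2 \<and> N mod 3 = 2)"
    and k: "k = M - 1 - 2 * N" "k \<noteq> 0" "\<bar>k\<bar> < 6 * M"
  shows "theta_rep (\<lambda>q z. coset_sum N q - dissect_sign N * dissect_coeff q N *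
    (nome.level3 (q ^ (nat M)\<^sup>2) (appell_x M q k) / nome.J (q ^ (nat M)\<^sup>2)))"
proof -
  obtain h e where h: "M * k = 6 * h" using leading_exponents[OF A] k(1) by blast
  have L: "0 < (nat M)\<^sup>2" using M_pos by simp
  have u6: "((-1 :: complex) powi (M + 1)) ^ (6 * 1) = 1"
    using minus_one_powi_squared[of "M + 1"] power_mult[of "(-1 :: complex) powi (M + 1)" 2 3] by simp
  have "theta_rep (\<lambda>q z. nome.level3 (q ^ (nat M)\<^sup>2) ((-1) powi (M + 1) * qpr q (of_int h)) / nome.J (q ^ (nat M)\<^sup>2)
     - (\<Sum>N\<in>{0..<3 * int 1}. dissect_term (q ^ (nat M)\<^sup>2) 1 N ((-1) powi (M + 1) * qpr q (of_int h))))"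
    using coset_exponent_not_multiple[OF h k(2,3)]
    by (intro dissection_theta L norm_minus_one_powi u6) auto
  from theta_rep_minus[OF theta_rep_mult[OF theta_rep_dissect_coeff[of N] this]]
  show ?thesis
  proof (rule theta_rep_cong)
    fix q z assume "(q, z) \<in> \<Omega>"
    hence q: "q \<noteq> 0" using domain by blast
    have X: "appell_x M q k = (-1) powi (M + 1) * qpr q (of_int h)"
      using appell_x_qpr[OF q, of k] h by simp
    show "coset_sum N q - dissect_sign N * dissect_coeff q N *
        (nome.level3 (q ^ (nat M)\<^sup>2) (appell_x M q k) / nome.J (q ^ (nat M)\<^sup>2)) =
      - (dissect_sign N * dissect_coeff q N *
         (nome.level3 (q ^ (nat M)\<^sup>2) ((-1) powi (M + 1) * qpr q (of_int h)) / nome.J (q ^ (nat M)\<^sup>2)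
     - (\<Sum>N\<in>{0..<3 * int 1}. dissect_term (q ^ (nat M)\<^sup>2) 1 N ((-1) powi (M + 1) * qpr q (of_int h)))))"
      unfolding coset_sum_eq[OF A q] k(1)[symmetric] X by (simp add: right_diff_distrib)
  qed
qed

lemma level3_mock_g:
  assumes qz: "(q, z) \<in> \<Omega>" and h: "M * k = 6 * h" and k: "k \<noteq> 0" "\<bar>k\<bar> < 6 * M"
  shows "nome.level3 (q ^ (nat M)\<^sup>2) (appell_x M q k) / nome.J (q ^ (nat M)\<^sup>2) = 1 + appell_x M q k * g_at M q k"
proof -
  have q: "q \<noteq> 0" "norm q < 1" using domain[OF qz] by auto
  interpret N: nome q using q by unfold_locales
  have L: "0 < (nat M)\<^sup>2" using M_pos by simp
  interpret Q: nome "q ^ (nat M)\<^sup>2" by (rule N.nome_power[OF L])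
  have "q powi M\<^sup>2 = q powi int ((nat M)\<^sup>2)" using M_pos by simp
  hence Q: "q powi M\<^sup>2 = q ^ (nat M)\<^sup>2" by (simp only: power_int_of_nat)
  have X: "appell_x M q k = (-1) powi (M + 1) * qpr q (of_int h)"
    using appell_x_qpr[OF q(1), of k] h by simp
  have X0: "appell_x M q k \<noteq> 0" using q X by simp
  have "jtheta (appell_x M q k) (q ^ (nat M)\<^sup>2) \<noteq> 0" unfolding X
    using coset_exponent_not_multiple[OF h k] by (intro jtheta_qpr_nz q L norm_minus_one_powi) auto
  from Q.mock_g_level3[OF X0 this] show ?thesis unfolding Q by simp
qed

lemma dissect_coeff_powi:
  assumes "N * (N + 1) = 6 * e"
  shows "dissect_coeff q N = (-1) powi N * q powi (- e)"
proof -
  have "- (N * (N + 1)) = 6 * (- e)" using assms by simp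
  thus ?thesis unfolding dissect_coeff_def by (simp only: nonzero_mult_div_cancel_left)
qed

text \<open>The constant in S = 1 + X g only contributes the monomial \<open>dissect_coeff\<close>;
  E and s collect the exponent and the sign of that monomial times X.\<close>

lemma coset_sum_plus:
  assumes A: "(M mod 3 = 1 \<and> N mod 3 = 0) \<or> (M mod 3 = 2 \<and> N mod 3 = 2)"
    and k: "k = M - 1 - 2 * N" "k \<noteq> 0" "\<bar>k\<bar> < 6 * M"
    and E: "E = M * k - N * (N + 1)" and s: "even (s - (N + M + 1))"
  shows "theta_rep (\<lambda>q z. coset_sum N q - dissect_sign N * ((-1) powi s * q powi (E div 6) * g_at M q k))"
proof -
  obtain h e where h: "M * k = 6 * h" and e: "N * (N + 1) = 6 * e" using leading_exponents[OF A] k(1) by blast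
  have E6: "E div 6 = h - e" using E h e by simp
  have sg: "(-1 :: complex) powi s = (-1) powi N * (-1) powi (M + 1)"
    using minus_one_powi_cong[OF s] by (simp add: power_int_add)
  show ?thesis
  proof (rule theta_rep_cong[OF theta_rep_add[OF coset_sum_level3[OF A k] theta_rep_dissect_coeff[of N]]])
    fix q z assume qz: "(q, z) \<in> \<Omega>"
    hence q: "q \<noteq> 0" using domain by blast
    have x: "appell_x M q k = (-1) powi (M + 1) * q powi h" using h by (simp add: appell_x_def)
    have c: "(-1) powi s * q powi (E div 6) = dissect_coeff q N * appell_x M q k"
      unfolding E6 sg dissect_coeff_powi[OF e] x using q by (simp add: power_int_diff power_int_minus divide_inverse)
    show "coset_sum N q - dissect_sign N * ((-1) powi s * q powi (E div 6) * g_at M q k) =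
      coset_sum N q - dissect_sign N * dissect_coeff q N *
        (nome.level3 (q ^ (nat M)\<^sup>2) (appell_x M q k) / nome.J (q ^ (nat M)\<^sup>2)) + dissect_sign N * dissect_coeff q N"
      unfolding level3_mock_g[OF qz h k(2,3)] c by (simp add: algebra_simps)
  qed
qed

text \<open>For cosets whose natural argument is the inverse of the Y in the stated formula. By
  \<open>level3_inverse\<close>, S(1/Y) = -Y - Y^2 g(Y), whence the doubled exponent in E and the
  opposite sign.\<close>

lemma coset_sum_minus:
  assumes A: "(M mod 3 = 1 \<and> N mod 3 = 0) \<or> (M mod 3 = 2 \<and> N mod 3 = 2)"
    and k: "k = 2 * N + 1 - M" "k \<noteq> 0" "\<bar>k\<bar> < 6 * M"
    and E: "E = 2 * M * k - N * (N + 1)" and s: "odd (s - N)"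
  shows "theta_rep (\<lambda>q z. coset_sum N q - dissect_sign N * ((-1) powi s * q powi (E div 6) * g_at M q k))"
proof -
  obtain h' e where h': "M * (M - 1 - 2 * N) = 6 * h'" and e: "N * (N + 1) = 6 * e" using leading_exponents[OF A] by blast
  define h where "h = - h'"
  have "M * k = - (M * (M - 1 - 2 * N))" unfolding k(1) by (simp add: algebra_simps)
  hence h: "M * k = 6 * h" using h' by (simp add: h_def)
  have mk: "M * (- k) = 6 * (- h)" using h by simp
  have E6: "E div 6 = 2 * h - e" using E h e by simp
  have k': "- k = M - 1 - 2 * N" "- k \<noteq> 0" "\<bar>- k\<bar> < 6 * M" using k by auto
  have "(-1 :: complex) powi s = (-1) powi (N + 1)" using s by (intro minus_one_powi_cong) auto
  hence sg: "(-1 :: complex) powi s = - ((-1) powi N)" using minus_one_powi_Suc[of N] by simp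
  have k2: "((-1 :: complex) powi (M + 1)) * (-1) powi (M + 1) = 1"
    using minus_one_powi_squared[of "M + 1"] by (simp add: power2_eq_square)
  have "theta_rep (\<lambda>q z. (coset_sum N q - dissect_sign N * dissect_coeff q N *
      (nome.level3 (q ^ (nat M)\<^sup>2) (appell_x M q (- k)) / nome.J (q ^ (nat M)\<^sup>2)))
      - dissect_sign N * dissect_coeff q N * ((-1) powi (M + 1) * q powi h))"
    by (intro theta_rep_diff coset_sum_level3[OF A k'] theta_rep_mult[OF theta_rep_dissect_coeff]
        theta_rep_mult[OF theta_rep_rat theta_rep_powi]) (auto simp: power_int_def)
  thus ?thesis
  proof (rule theta_rep_cong)
    fix q z assume qz: "(q, z) \<in> \<Omega>"
    have q: "q \<noteq> 0" "norm q < 1" using domain[OF qz] by auto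
    interpret Nq: nome q using q by unfold_locales
    have L: "0 < (nat M)\<^sup>2" using M_pos by simp
    interpret Q: nome "q ^ (nat M)\<^sup>2" by (rule Nq.nome_power[OF L])
    define Y where "Y = appell_x M q k"
    have x: "Y = (-1) powi (M + 1) * q powi h" using h by (simp add: appell_x_def Y_def)
    have x': "appell_x M q (- k) = (-1) powi (M + 1) * q powi (- h)" unfolding appell_x_def mk
      by (simp only: nonzero_mult_div_cancel_left)
    have Y0: "Y \<noteq> 0" using q x by simp
    have "Y * appell_x M q (- k) = ((-1) powi (M + 1) * (-1) powi (M + 1)) * (q powi h * q powi (- h))"
      unfolding x x' by (simp only: mult_ac)
    also have "\<dots> = 1" unfolding k2 using q by (simp add: power_int_minus)
    finally have inv: "appell_x M q (- k) = inverse Y" by (metis inverse_unique)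
    have YY: "Y * Y = q powi (2 * h)"
    proof -
      have "Y * Y = ((-1) powi (M + 1) * (-1) powi (M + 1)) * (q powi h * q powi h)"
        unfolding x by (simp only: mult_ac)
      also have "q powi h * q powi h = q powi (2 * h)" using q by (simp flip: power_int_add)
      finally show ?thesis unfolding k2 by simp
    qed
    have l: "Q.level3 Y / Q.J = 1 + Y * g_at M q k" unfolding Y_def by (rule level3_mock_g[OF qz h k(2,3)])
    have "Q.level3 (inverse Y) / Q.J = - Y * (Q.level3 Y / Q.J)" using Q.level3_inverse[OF Y0] by simp
    hence l': "Q.level3 (inverse Y) / Q.J = - Y - Y * Y * g_at M q k" unfolding l by (simp add: algebra_simps)
    have c: "(-1) powi s * q powi (E div 6) = - dissect_coeff q N * (Y * Y)"
      unfolding E6 sg dissect_coeff_powi[OF e] YY using q by (simp add: power_int_diff power_int_minus divide_inverse)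
    show "coset_sum N q - dissect_sign N * ((-1) powi s * q powi (E div 6) * g_at M q k) =
      (coset_sum N q - dissect_sign N * dissect_coeff q N *
        (Q.level3 (appell_x M q (- k)) / Q.J)) - dissect_sign N * dissect_coeff q N * ((-1) powi (M + 1) * q powi h)"
      unfolding inv l' c x[symmetric] by (simp add: algebra_simps)
  qed
qed

text \<open>Here the argument is 1, a pole of \<open>level3\<close>, so no value of g is available.
  The dissection itself is finite there, and \<open>appell_m_inverse\<close> turns its last term
  into minus a sum with parameter -i: only a change of parameter remains.\<close>

lemma coset_sum_special:
  assumes A: "(M mod 3 = 1 \<and> N mod 3 = 0) \<or> (M mod 3 = 2 \<and> N mod 3 = 2)" and MN: "M = 2 * N + 1"
  shows "theta_rep (\<lambda>q z. coset_sum N q)"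
proof -
  define n where "n = nat M"
  have n: "0 < n" using M_pos by (simp add: n_def)
  hence B: "0 < 3 * n\<^sup>2" by simp
  have nz: "jtheta \<i> (q ^ (3 * n\<^sup>2)) \<noteq> 0 \<and> jtheta (\<i> * qpr q (of_nat (n\<^sup>2))) (q ^ (3 * n\<^sup>2)) \<noteq> 0"
    if "(q, z) \<in> \<Omega>" for q z
  proof -
    have q: "q \<noteq> 0" "norm q < 1" using domain[OF that] by auto
    have "\<i> \<noteq> 1" by (simp add: complex_eq_iff)
    thus ?thesis using jtheta_qpr_nz[OF q B, of \<i> 0] jtheta_qpr_nz[OF q B, of \<i> "of_nat (n\<^sup>2)"] q by auto
  qed
  have "theta_rep (\<lambda>q z. appell_m (1 * qpr q (of_nat (n\<^sup>2))) (q ^ (3 * n\<^sup>2)) (\<i> * z powi 0) -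
      appell_m (1 * qpr q (of_nat (n\<^sup>2))) (q ^ (3 * n\<^sup>2)) (- \<i>))"
  proof (rule appell_m_change_theta[OF B])
    show "- \<i> \<noteq> 1" "1 * - \<i> \<noteq> 1" by (auto simp: complex_eq_iff)
    fix q z assume qz: "(q, z) \<in> \<Omega>"
    show "jtheta (\<i> * z powi 0) (q ^ (3 * n\<^sup>2)) \<noteq> 0"
      "jtheta (1 * qpr q (of_nat (n\<^sup>2)) * (\<i> * z powi 0)) (q ^ (3 * n\<^sup>2)) \<noteq> 0"
      using nz[OF qz] by (auto simp: mult.commute)
  qed auto
  from theta_rep_mult[OF theta_rep_dissect_coeff[of N] this]
  show ?thesis
  proof (rule theta_rep_cong)
    fix q z assume qz: "(q, z) \<in> \<Omega>"
    have q: "q \<noteq> 0" "norm q < 1" using domain[OF qz] by auto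
    interpret Nq: nome q using q by unfold_locales
    interpret Q: nome "q ^ (3 * n\<^sup>2)" by (rule Nq.nome_power[OF B])
    define Q where "Q = q ^ n\<^sup>2"
    have Q0: "Q \<noteq> 0" using q by (simp add: Q_def)
    have "M - 1 - 2 * N = 0" using MN by simp
    moreover have "(-1 :: complex) powi (M + 1) = (-1) powi 0" by (rule minus_one_powi_cong) (simp add: MN)
    ultimately have X: "appell_x M q (M - 1 - 2 * N) = 1" unfolding appell_x_def by simp
    have B': "Q ^ (3 * 1\<^sup>2) = q ^ (3 * n\<^sup>2)" by (simp add: Q_def mult.commute flip: power_mult)
    have r: "{0..<3 :: int} = {0, 1, 2}" by auto
    have t: "dissect_term Q 1 0 1 = appell_m Q (q ^ (3 * n\<^sup>2)) \<i>" "dissect_term Q 1 1 1 = 0"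
      "dissect_term Q 1 2 1 = - inverse Q * appell_m (inverse Q) (q ^ (3 * n\<^sup>2)) \<i>"
      unfolding dissect_term_def B' by (simp_all add: dissect_coeff_def dissect_arg_def dissect_sign_def power_int_minus)
    have "appell_m (inverse Q) (q ^ (3 * n\<^sup>2)) \<i> = Q * appell_m Q (q ^ (3 * n\<^sup>2)) (- \<i>)"
      using Q.appell_m_inverse[of "- \<i>" Q] Q0 by simp
    hence t2: "dissect_term Q 1 2 1 = - appell_m Q (q ^ (3 * n\<^sup>2)) (- \<i>)" unfolding t using Q0 by simp
    have S: "(\<Sum>j\<in>{0..<3 * int 1}. dissect_term Q 1 j 1) = appell_m Q (q ^ (3 * n\<^sup>2)) \<i> - appell_m Q (q ^ (3 * n\<^sup>2)) (- \<i>)"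
      using r t(1,2) t2 by simp
    have "qpr q (of_nat (n\<^sup>2)) = Q" unfolding Q_def by (rule qpr_nat[OF q(1)])
    thus "coset_sum N q = dissect_sign N * dissect_coeff q N *
      (appell_m (1 * qpr q (of_nat (n\<^sup>2))) (q ^ (3 * n\<^sup>2)) (\<i> * z powi 0) -
      appell_m (1 * qpr q (of_nat (n\<^sup>2))) (q ^ (3 * n\<^sup>2)) (- \<i>))"
      unfolding coset_sum_eq[OF A q(1)] X using S by (simp add: Q_def n_def)
  qed
qed

text \<open>U and V are the mock parts of the cosets of a and a - 1; S holds the monomials written
  out in the stated formulas, which are theta functions themselves.\<close>

lemma rank_deviation_coset_theta:
  assumes "M dvd a - N" "M dvd a - 1 - N'"
    and "theta_rep (\<lambda>q z. coset_sum N q - U q z)" "theta_rep (\<lambda>q z. coset_sum N' q - V q z)"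
    and "theta_rep S" and "\<And>q z. (q, z) \<in> \<Omega> \<Longrightarrow> F q z = U q z - V q z + S q z"
  shows "theta_rep (\<lambda>q z. rank_deviation a M q - F q z)"
proof -
  have "theta_rep (\<lambda>q z. (rank_deviation a M q - (coset_sum N q - coset_sum N' q))
      + (coset_sum N q - U q z) - (coset_sum N' q - V q z) - S q z)"
    by (intro theta_rep_add theta_rep_diff assms rank_deviation_coset_sum)
  thus ?thesis by (rule theta_rep_cong) (simp add: assms(6))
qed

lemma theta_rep_signed_powi: "theta_rep (\<lambda>q z. (-1) powi s * q powi k)"
  by (intro theta_rep_mult theta_rep_rat theta_rep_powi) (auto simp: power_int_def)

text \<open>For M = 1 modulo 3 both representatives have to be multiples of 3. They are chosen such
  that M - 1 - 2N is plus or minus the index in the stated g, which decides between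
  \<open>coset_sum_plus\<close> and \<open>coset_sum_minus\<close>.\<close>

lemma mock_part1_theta:
  assumes M: "M mod 3 = 1" and a: "0 \<le> a" "a < M" "a mod 3 \<noteq> 1"
  shows "theta_rep (\<lambda>q z. rank_deviation a M q - mock_part1 a M q)"
proof -
  consider "a = 0" "M = 1" | "a = 0" "M \<noteq> 1" | "a \<noteq> 0" "a mod 3 = 0" "M \<noteq> 2 * a + 1"
    | "a \<noteq> 0" "a mod 3 = 0" "M = 2 * a + 1" | "a mod 3 = 2"
    using a(3) by linarith
  thus ?thesis
  proof cases
    case 1
    show ?thesis
    proof (rule theta_rep_cong[OF theta_rep_rat[of 0]])
      fix q z assume "(q, z) \<in> \<Omega>"
      hence "nome q" using domain by unfold_locales auto
      \<comment> \<open>For M = 1 there are no nontrivial roots of unity to sum over.\<close>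
      thus "rank_deviation a M q - mock_part1 a M q = 0"
        using 1 by (simp add: rank_deviation_level3 mock_part1_def)
    qed simp
  next
    case 2
    \<comment> \<open>The class of -1 is represented by M - 1, whose argument is inverse to that of
      0; both cosets yield the same value of g and the two contributions add up.\<close>
    have m3: "(M - 1) mod 3 = 0" using M by presburger
    hence sg: "dissect_sign 0 = 1" "dissect_sign (M - 1) = 1" by (auto simp: dissect_sign_def)
    show ?thesis
    proof (rule rank_deviation_coset_theta)
      show "M dvd a - 0" "M dvd a - 1 - (M - 1)" using 2 by auto
      show "theta_rep (\<lambda>q z. coset_sum 0 q - dissect_sign 0 * ((-1) powi (M + 1) * q powi (M * (M - 1) div 6) * g_at M q (M - 1)))"
        using M 2 M_pos by (intro coset_sum_plus) auto
      show "theta_rep (\<lambda>q z. coset_sum (M - 1) q - dissect_sign (M - 1) * ((-1) powi M * q powi (M * (M - 1) div 6) * g_at M q (M - 1)))"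
      proof (rule coset_sum_minus)
        show "M * (M - 1) = 2 * M * (M - 1) - (M - 1) * (M - 1 + 1)" by (simp add: algebra_simps)
        show "odd (M - (M - 1))" by simp
      qed (use M 2 M_pos m3 in auto)
      show "theta_rep (\<lambda>q z. 2)" by (rule theta_rep_rat) simp
      show "mock_part1 a M q = dissect_sign 0 * ((-1) powi (M + 1) * q powi (M * (M - 1) div 6) * g_at M q (M - 1))
        - dissect_sign (M - 1) * ((-1) powi M * q powi (M * (M - 1) div 6) * g_at M q (M - 1)) + 2" for q
        unfolding mock_part1_def sg minus_one_powi_Suc[of M] using 2 by simp
    qed
  next
    case 3
    have m3: "(a - 1 + M) mod 3 = 0" using 3(2) M by presburger
    hence sg: "dissect_sign a = 1" "dissect_sign (a - 1 + M) = 1" using 3 by (auto simp: dissect_sign_def)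
    show ?thesis
    proof (rule rank_deviation_coset_theta)
      show "M dvd a - a" "M dvd a - 1 - (a - 1 + M)" by auto
      show "theta_rep (\<lambda>q z. coset_sum a q - dissect_sign a * ((-1) powi (M + a + 1) *
          q powi ((M * (M - 2 * a - 1) - a * (a + 1)) div 6) * g_at M q (M - 2 * a - 1)))"
        using M a 3 by (intro coset_sum_plus) auto
      show "theta_rep (\<lambda>q z. coset_sum (a - 1 + M) q - dissect_sign (a - 1 + M) * ((-1) powi (M + a) *
          q powi ((M * (M + 2 * a - 1) - a * (a - 1)) div 6) * g_at M q (M + 2 * a - 1)))"
        using M a 3 m3 by (intro coset_sum_minus) (auto simp: algebra_simps)
      show "theta_rep (\<lambda>q z. (-1) powi a * q powi (- (a * (a + 1)) div 6))" by (rule theta_rep_signed_powi)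
      show "mock_part1 a M q = dissect_sign a * ((-1) powi (M + a + 1) *
          q powi ((M * (M - 2 * a - 1) - a * (a + 1)) div 6) * g_at M q (M - 2 * a - 1))
        - dissect_sign (a - 1 + M) * ((-1) powi (M + a) *
          q powi ((M * (M + 2 * a - 1) - a * (a - 1)) div 6) * g_at M q (M + 2 * a - 1))
        + (-1) powi a * q powi (- (a * (a + 1)) div 6)" for q
        unfolding mock_part1_def sg minus_one_powi_Suc[of "M + a"] using 3 by simp
    qed
  next
    case 4
    \<comment> \<open>The coset of a degenerates because M - 1 - 2a = 0. The other one keeps its
      g-value, whose index M + 2a - 1 is now 4a.\<close>
    have m3: "(a - 1 + M) mod 3 = 0" using 4(2) M by presburger
    hence sg: "dissect_sign a = 1" "dissect_sign (a - 1 + M) = 1" using 4 by (auto simp: dissect_sign_def)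
    have k: "M * (4 * a) div 6 = 2 * a * M div 3"
    proof -
      have "M * (4 * a) = 2 * (2 * a * M)" by simp
      thus ?thesis using div_mult_mult1[of 2 "2 * a * M" 3] by simp
    qed
    have "(-1 :: complex) powi (M + 1) = (-1) powi 0" by (rule minus_one_powi_cong) (simp add: 4)
    hence x: "appell_x M q (4 * a) = q powi (2 * a * M div 3)" for q unfolding appell_x_def k by simp
    show ?thesis
    proof (rule rank_deviation_coset_theta)
      show "M dvd a - a" "M dvd a - 1 - (a - 1 + M)" by auto
      have "theta_rep (\<lambda>q z. coset_sum a q)" using M 4 by (intro coset_sum_special) auto
      thus "theta_rep (\<lambda>q z. coset_sum a q - 0)" by simp
      show "theta_rep (\<lambda>q z. coset_sum (a - 1 + M) q - dissect_sign (a - 1 + M) * ((-1) powi (a + 1) *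
          q powi (a * (7 * a + 5) div 6) * g_at M q (4 * a)))"
        using M a 4 m3 by (intro coset_sum_minus) (auto simp: algebra_simps)
      show "theta_rep (\<lambda>q z. 0)" by (rule theta_rep_rat) simp
      show "mock_part1 a M q = 0 - dissect_sign (a - 1 + M) * ((-1) powi (a + 1) *
          q powi (a * (7 * a + 5) div 6) * g_at M q (4 * a)) + 0" for q
        unfolding mock_part1_def sg minus_one_powi_Suc x using 4 by simp
    qed
  next
    case 5
    have a0: "a \<noteq> 0" using 5 by auto
    \<comment> \<open>Since a is 2 and a - 1 is 1 modulo 3, adding M once and twice reaches
      multiples of 3.\<close>
    have m3: "(a + M) mod 3 = 0" "(a - 1 + 2 * M) mod 3 = 0" using 5 M by presburger+
    hence sg: "dissect_sign (a + M) = 1" "dissect_sign (a - 1 + 2 * M) = 1" by (auto simp: dissect_sign_def)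
    show ?thesis
    proof (rule rank_deviation_coset_theta)
      show "M dvd a - (a + M)" "M dvd a - 1 - (a - 1 + 2 * M)" by auto
      show "theta_rep (\<lambda>q z. coset_sum (a + M) q - dissect_sign (a + M) * ((-1) powi (M + a + 1) *
          q powi ((M * (M + 2 * a + 1) - a * (a + 1)) div 6) * g_at M q (M + 2 * a + 1)))"
        using M a m3 by (intro coset_sum_minus) (auto simp: algebra_simps)
      show "theta_rep (\<lambda>q z. coset_sum (a - 1 + 2 * M) q - dissect_sign (a - 1 + 2 * M) * ((-1) powi a *
          q powi ((2 * M\<^sup>2 - a * (a - 1)) div 6) * g_at M q (3 * M + 2 * a - 1)))"
        using M a m3 by (intro coset_sum_minus) (auto simp: algebra_simps power2_eq_square)
      show "theta_rep (\<lambda>q z. 0)" by (rule theta_rep_rat) simp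
      show "mock_part1 a M q = dissect_sign (a + M) * ((-1) powi (M + a + 1) *
          q powi ((M * (M + 2 * a + 1) - a * (a + 1)) div 6) * g_at M q (M + 2 * a + 1))
        - dissect_sign (a - 1 + 2 * M) * ((-1) powi a *
          q powi ((2 * M\<^sup>2 - a * (a - 1)) div 6) * g_at M q (3 * M + 2 * a - 1)) + 0" for q
        unfolding mock_part1_def sg minus_one_powi_Suc[of a] using 5 a0 by simp
    qed
  qed
qed

text \<open>For M = 2 modulo 3 the representatives have to be 2 modulo 3. There
  \<open>dissect_sign\<close> is -1, which reverses the signs compared with
  \<open>mock_part1_theta\<close>.\<close>

lemma mock_part2_theta:
  assumes M: "M mod 3 = 2" and a: "0 \<le> a" "a < M" "a mod 3 \<noteq> 2"
  shows "theta_rep (\<lambda>q z. rank_deviation a M q - mock_part2 a M q)"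
proof -
  consider "a = 0" | "a \<noteq> 0" "a mod 3 = 0" "M \<noteq> 2 * a - 1"
    | "a \<noteq> 0" "a mod 3 = 0" "M = 2 * a - 1" | "a mod 3 = 1"
    using a(3) by linarith
  thus ?thesis
  proof cases
    case 1
    \<comment> \<open>The classes 0 and -1 are represented by M and -1, whose arguments are inverse
      to each other, so again one g-value occurs twice.\<close>
    have sg: "dissect_sign M = -1" "dissect_sign (-1) = -1"
      using M by (auto simp: dissect_sign_def)
    show ?thesis
    proof (rule rank_deviation_coset_theta)
      show "M dvd a - M" "M dvd a - 1 - (-1)" using 1 by auto
      show "theta_rep (\<lambda>q z. coset_sum M q - dissect_sign M * ((-1) powi (M + 1) * q powi (M * (M + 1) div 6) * g_at M q (M + 1)))"
        using M 1 M_pos by (intro coset_sum_minus) (auto simp: algebra_simps)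
      show "theta_rep (\<lambda>q z. coset_sum (-1) q - dissect_sign (-1) * ((-1) powi M * q powi (M * (M + 1) div 6) * g_at M q (M + 1)))"
        using M 1 M_pos by (intro coset_sum_plus) auto
      show "theta_rep (\<lambda>q z. 0)" by (rule theta_rep_rat) simp
      show "mock_part2 a M q = dissect_sign M * ((-1) powi (M + 1) * q powi (M * (M + 1) div 6) * g_at M q (M + 1))
        - dissect_sign (-1) * ((-1) powi M * q powi (M * (M + 1) div 6) * g_at M q (M + 1)) + 0" for q
        unfolding mock_part2_def sg minus_one_powi_Suc[of M] using 1 by simp
    qed
  next
    case 2
    have m3: "(a + M) mod 3 = 2" "(a - 1) mod 3 = 2" using 2(2) M by presburger+
    hence sg: "dissect_sign (a + M) = -1" "dissect_sign (a - 1) = -1" by (auto simp: dissect_sign_def)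
    show ?thesis
    proof (rule rank_deviation_coset_theta)
      show "M dvd a - (a + M)" "M dvd a - 1 - (a - 1)" by auto
      show "theta_rep (\<lambda>q z. coset_sum (a + M) q - dissect_sign (a + M) * ((-1) powi (M + a + 1) *
          q powi ((M * (M + 2 * a + 1) - a * (a + 1)) div 6) * g_at M q (M + 2 * a + 1)))"
        using M a m3 by (intro coset_sum_minus) (auto simp: algebra_simps)
      show "theta_rep (\<lambda>q z. coset_sum (a - 1) q - dissect_sign (a - 1) * ((-1) powi (M + a) *
          q powi ((M * (M - 2 * a + 1) - a * (a - 1)) div 6) * g_at M q (M - 2 * a + 1)))"
        using M a 2 m3 by (intro coset_sum_plus) (auto simp: algebra_simps)
      show "theta_rep (\<lambda>q z. (-1) powi (a + 1) * q powi (- (a * (a - 1)) div 6))" by (rule theta_rep_signed_powi)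
      show "mock_part2 a M q = dissect_sign (a + M) * ((-1) powi (M + a + 1) *
          q powi ((M * (M + 2 * a + 1) - a * (a + 1)) div 6) * g_at M q (M + 2 * a + 1))
        - dissect_sign (a - 1) * ((-1) powi (M + a) *
          q powi ((M * (M - 2 * a + 1) - a * (a - 1)) div 6) * g_at M q (M - 2 * a + 1))
        + (-1) powi (a + 1) * q powi (- (a * (a - 1)) div 6)" for q
        unfolding mock_part2_def sg minus_one_powi_Suc[of "M + a"] using 2 by simp
    qed
  next
    case 3
    \<comment> \<open>Now M = 2(a - 1) + 1, so it is the coset of a - 1 that degenerates.\<close>
    have m3: "(a + M) mod 3 = 2" "(a - 1) mod 3 = 2" using 3(2) M by presburger+
    hence sg: "dissect_sign (a + M) = -1" "dissect_sign (a - 1) = -1" by (auto simp: dissect_sign_def)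
    have k: "M * (4 * a) div 6 = 2 * a * M div 3"
    proof -
      have "M * (4 * a) = 2 * (2 * a * M)" by simp
      thus ?thesis using div_mult_mult1[of 2 "2 * a * M" 3] by simp
    qed
    have "(-1 :: complex) powi (M + 1) = (-1) powi 0" by (rule minus_one_powi_cong) (simp add: 3)
    hence x: "appell_x M q (4 * a) = q powi (2 * a * M div 3)" for q unfolding appell_x_def k by simp
    show ?thesis
    proof (rule rank_deviation_coset_theta)
      show "M dvd a - (a + M)" "M dvd a - 1 - (a - 1)" by auto
      show "theta_rep (\<lambda>q z. coset_sum (a + M) q - dissect_sign (a + M) * ((-1) powi a *
          q powi (a * (7 * a - 5) div 6) * g_at M q (4 * a)))"
      proof (rule coset_sum_minus)
        show "a * (7 * a - 5) = 2 * M * (4 * a) - (a + M) * (a + M + 1)" unfolding 3(3) by (simp add: algebra_simps)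
        show "odd (a - (a + M))" by (simp add: 3(3))
      qed (use M a 3 m3 in auto)
      have "theta_rep (\<lambda>q z. coset_sum (a - 1) q)" using M 3 m3 by (intro coset_sum_special) auto
      thus "theta_rep (\<lambda>q z. coset_sum (a - 1) q - 0)" by simp
      show "theta_rep (\<lambda>q z. 0)" by (rule theta_rep_rat) simp
      show "mock_part2 a M q = dissect_sign (a + M) * ((-1) powi a *
          q powi (a * (7 * a - 5) div 6) * g_at M q (4 * a)) - 0 + 0" for q
        unfolding mock_part2_def sg minus_one_powi_Suc x using 3 by simp
    qed
  next
    case 4
    have a0: "a \<noteq> 0" using 4 by auto
    \<comment> \<open>Taking a - M instead of a + 2M makes M - 1 - 2N equal to 3M - 2a - 1, the
      index in the stated formula.\<close>
    have m3: "(a - M) mod 3 = 2" "(a - 1 + M) mod 3 = 2" using 4 M by presburger+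
    hence sg: "dissect_sign (a - M) = -1" "dissect_sign (a - 1 + M) = -1" by (auto simp: dissect_sign_def)
    show ?thesis
    proof (rule rank_deviation_coset_theta)
      show "M dvd a - (a - M)" "M dvd a - 1 - (a - 1 + M)" by auto
      show "theta_rep (\<lambda>q z. coset_sum (a - M) q - dissect_sign (a - M) * ((-1) powi (a + 1) *
          q powi ((2 * M\<^sup>2 - a * (a + 1)) div 6) * g_at M q (3 * M - 2 * a - 1)))"
        using M a m3 by (intro coset_sum_plus) (auto simp: algebra_simps power2_eq_square)
      show "theta_rep (\<lambda>q z. coset_sum (a - 1 + M) q - dissect_sign (a - 1 + M) * ((-1) powi (M + a) *
          q powi ((M * (M + 2 * a - 1) - a * (a - 1)) div 6) * g_at M q (M + 2 * a - 1)))"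
        using M a a0 m3 by (intro coset_sum_minus) (auto simp: algebra_simps)
      show "theta_rep (\<lambda>q z. 0)" by (rule theta_rep_rat) simp
      show "mock_part2 a M q = dissect_sign (a - M) * ((-1) powi (a + 1) *
          q powi ((2 * M\<^sup>2 - a * (a + 1)) div 6) * g_at M q (3 * M - 2 * a - 1))
        - dissect_sign (a - 1 + M) * ((-1) powi (M + a) *
          q powi ((M * (M + 2 * a - 1) - a * (a - 1)) div 6) * g_at M q (M + 2 * a - 1)) + 0" for q
        unfolding mock_part2_def sg minus_one_powi_Suc[of a] using 4 a0 by simp
    qed
  qed
qed

end

text \<open>The substitution j -> M - j inverts the roots of unity, and (1 - x) level3 x is
  invariant under x -> 1/x. On partitions this is conjugation, which negates the rank.\<close>

lemma rank_deviation_reflect: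
  assumes M: "1 \<le> M" and q: "nome q"
  shows "rank_deviation (M - a) M q = rank_deviation a M q"
proof -
  interpret nome q by (rule q)
  have z: "zeta M (nat M - j) = inverse (zeta M j)" if "j \<in> {1..<nat M}" for j
  proof -
    have "zeta M (nat M - j) = zeta M (nat M - j) powi 1" by simp
    also have "\<dots> = cis (2 * pi - 2 * pi * real j / of_int M)"
      unfolding zeta_powi using that M by (simp add: of_nat_diff field_simps)
    also have "\<dots> = inverse (cis (2 * pi * real j / of_int M))" unfolding cis_divide[symmetric] by (simp add: inverse_eq_divide)
    also have "cis (2 * pi * real j / of_int M) = zeta M j powi 1" unfolding zeta_powi by simp
    finally show ?thesis by simp
  qed
  have "(\<Sum>j\<in>{1..<nat M}. zeta M j powi (- (M - a)) * ((1 - zeta M j) * (level3 (zeta M j) / J))) =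
      (\<Sum>j\<in>{1..<nat M}. zeta M j powi (- a) * ((1 - zeta M j) * (level3 (zeta M j) / J)))"
  proof (rule sum.reindex_bij_witness[where i = "\<lambda>j. nat M - j" and j = "\<lambda>j. nat M - j"])
    fix j assume j: "j \<in> {1..<nat M}"
    define w where "w = zeta M j"
    have w: "w \<noteq> 0" "zeta M (nat M - j) = inverse w" using z[OF j] zeta_nz by (auto simp: w_def)
    have "w powi (- (M - a)) = w powi a / w powi M" using w by (simp flip: power_int_diff)
    hence f1: "w powi (- (M - a)) = w powi a" using zeta_power_order[OF M] by (simp add: w_def)
    have f2: "inverse w powi (- a) = w powi a" using w by (simp add: power_int_minus power_int_inverse)
    have f3: "(1 - inverse w) * (level3 (inverse w) / J) = (1 - w) * (level3 w / J)"
    proof -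
      have "(1 - inverse w) * (- w) = 1 - w" using w by (simp add: algebra_simps)
      hence "((1 - inverse w) * (- w)) * (level3 w / J) = (1 - w) * (level3 w / J)" by (simp only:)
      thus ?thesis unfolding level3_inverse[OF w(1)] by (simp add: mult.assoc)
    qed
    show "zeta M (nat M - j) powi (- a) * ((1 - zeta M (nat M - j)) * (level3 (zeta M (nat M - j)) / J)) =
      zeta M j powi (- (M - a)) * ((1 - zeta M j) * (level3 (zeta M j) / J))"
      unfolding w(2) w_def[symmetric] f1 f2 f3 ..
  qed auto
  thus ?thesis unfolding rank_deviation_level3[OF M q] by simp
qed

theorem theorem3p1:
  fixes M a :: int
  assumes "1 \<le> M" and "0 \<le> a" and "a < M"
  shows "\<exists>T. is_theta_function M (admissible a M) T \<and>
           (\<forall>(q, z)\<in>admissible a M. rank_deviation a M q = mock_part a M q z + T q z)"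
proof -
  interpret theta_domain M "admissible a M"
  proof
    show "1 \<le> M" by (rule assms(1))
    fix q z assume qz: "(q, z) \<in> admissible a M"
    \<comment> \<open>At least one Appell-Lerch sum is required to be defined when 3 divides M, and
      this is what makes z nonzero.\<close>
    have "\<exists>k. k \<in> appell_indices a M" by (auto simp: appell_indices_def Let_def)
    thus "q \<noteq> 0 \<and> norm q < 1 \<and> (3 dvd M \<longrightarrow> z \<noteq> 0)"
      using qz by (auto simp: admissible_def appell_defined_def)
  qed
  define b where "b = reduced_residue a M"
  have b: "0 \<le> b" "b < M"
    "M mod 3 = 0 \<Longrightarrow> b mod 3 = 0 \<or> b mod 3 = 1" "M mod 3 = 1 \<Longrightarrow> b mod 3 \<noteq> 1" "M mod 3 = 2 \<Longrightarrow> b mod 3 \<noteq> 2"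
  proof -
    have "(M - a) mod 3 \<noteq> 2" if "M mod 3 = 0" "a mod 3 = 2" using that by presburger
    moreover have "(M - a) mod 3 \<noteq> 1" if "M mod 3 = 1" "a mod 3 = 1" using that by presburger
    moreover have "(M - a) mod 3 \<noteq> 2" if "M mod 3 = 2" "a mod 3 = 2" using that by presburger
    moreover have "x mod 3 = 0 \<or> x mod 3 = 1 \<or> x mod 3 = 2" for x :: int by presburger
    \<comment> \<open>Only residues that are nonzero modulo 3 are reflected, so M - a stays below
      M.\<close>
    moreover have "a mod 3 \<noteq> 0 \<Longrightarrow> 0 < a" using assms(2) by (cases "a = 0") auto
    ultimately show "0 \<le> b" "b < M" "M mod 3 = 0 \<Longrightarrow> b mod 3 = 0 \<or> b mod 3 = 1"
      "M mod 3 = 1 \<Longrightarrow> b mod 3 \<noteq> 1" "M mod 3 = 2 \<Longrightarrow> b mod 3 \<noteq> 2"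
      using assms unfolding b_def reduced_residue_def by (auto split: if_splits)
  qed
  have "theta_rep (\<lambda>q z. rank_deviation b M q - mock_part a M q z)"
  proof -
    have "M mod 3 = 0 \<or> M mod 3 = 1 \<or> M mod 3 = 2" by presburger
    then consider "M mod 3 = 0" | "M mod 3 = 1" | "M mod 3 = 2" by blast
    thus ?thesis
    proof cases
      case 1
      hence Mn: "M = 3 * int (nat (M div 3))" using assms(1) by auto
      have ok: "appell_defined (appell_x M q k) (q powi (M\<^sup>2 div 3)) z"
        if "(q, z) \<in> admissible a M"
          "k \<in> (if b = 0 then {M - 1} else if b mod 3 = 0 then {M - 2 * b - 1, M - 2 * b + 1} else {M - 2 * b + 1})" for q z k
      proof -
        have "k \<in> appell_indices a M" using that(2) unfolding appell_indices_def Let_def b_def .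
        thus ?thesis using that(1) 1 by (auto simp: admissible_def)
      qed
      have "b = 0 \<or> b mod 3 = 0 \<or> b mod 3 = 1" using b(3)[OF 1] by blast
      from mock_part0_theta[OF Mn this ok]
      have "theta_rep (\<lambda>q z. rank_deviation b M q - mock_part0 b M q z)" .
      thus ?thesis using 1 by (simp add: mock_part_def b_def)
    next
      case 2
      have "theta_rep (\<lambda>q z. rank_deviation b M q - mock_part1 b M q)"
        by (rule mock_part1_theta[OF 2 b(1,2) b(4)[OF 2]])
      thus ?thesis using 2 by (simp add: mock_part_def b_def)
    next
      case 3
      have "theta_rep (\<lambda>q z. rank_deviation b M q - mock_part2 b M q)"
        by (rule mock_part2_theta[OF 3 b(1,2) b(5)[OF 3]])
      thus ?thesis using 3 by (simp add: mock_part_def b_def)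
    qed
  qed
  hence "theta_rep (\<lambda>q z. rank_deviation a M q - mock_part a M q z)"
  proof (rule theta_rep_cong)
    fix q z assume "(q, z) \<in> admissible a M"
    hence "nome q" using domain by unfold_locales auto
    hence "rank_deviation b M q = rank_deviation a M q"
      using rank_deviation_reflect[OF assms(1)] by (simp add: b_def reduced_residue_def)
    thus "rank_deviation a M q - mock_part a M q z = rank_deviation b M q - mock_part a M q z" by simp
  qed
  \<comment> \<open>The witness T is the difference itself; the content is that one list of theta
    terms represents it on the whole domain.\<close>
  from theta_rep_imp_theta[OF this] show ?thesis
    by (intro exI[of _ "\<lambda>q z. rank_deviation a M q - mock_part a M q z"]) auto
qed

end
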